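(* Let $N\in\{2,3\}$. For every $c>0$ there exists $\bar T(c)>0$ such that for every $T>\bar T(c)$ there exists a non-constant $T$-periodic solution $\bar\psi_T:\mathbb{R}^N\to\mathbb{C}$ of $$ ic\,\partial_{x_1}\psi+\Delta\psi+(1-|\psi|^2)\psi=0 . $$ Moreover $\bar\psi_T$ is a global minimizer of the functional $I_T^c: H^1_T(\mathbb{R}^N)\to\mathbb{R}$, and $$ I_T^c(\bar\psi_T)<0 . $$
   Context: $T$-periodic means $T$-periodic in each of the variables $x_1,\dots,x_N$. $\mathbb{T}(T)=[0,T]^N$. For $z,w\in\mathbb{C}$ write $z\cdot w=\mathrm{Re}(z)\mathrm{Re}(w)+\mathrm{Im}(z)\mathrm{Im}(w)$. $H^1_T(\mathbb{R}^N)$ is the Sobolev space of complex-valued functions on $\mathbb{R}^N$ that are $T$-periodic in each variable and of class $H^1_{loc}$, regarded as a real Hilbert space with scalar product $\langle\phi,\psi\rangle=\int_{\mathbb{T}(T)}\left(\sum_{k=1}^N(\partial_{x_k}\phi)\cdot(\partial_{x_k}\psi)+\phi\cdot\psi\right)dx$. The action functional is $$ I_T^c(\psi)=\frac12\int_{\mathbb{T}(T)}|\nabla\psi|^2\,dx+\frac14\int_{\mathbb{T}(T)}(1-|\psi|^2)^2\,dx-\frac c2\int_{\mathbb{T}(T)}(i\,\partial_{x_1}\psi)\cdot\psi\,dx . $$ $T$-periodic (weak) solutions of the equation are the critical points of $I_T^c$ in $H^1_T(\mathbb{R}^N)$. *)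

theory Defs
  imports "HOL-Analysis.Analysis"
begin

text \<open>Periodic Sobolev spaces on \<open>\<real>\<^sup>N = real ^ 'n\<close>, \<open>N = CARD('n)\<close>, and the action functional of the
  travelling-wave Gross--Pitaevskii equation
  \<open>i c \<partial>\<^sub>1\<psi> + \<Delta>\<psi> + (1 - \<bar>\<psi>\<bar>\<^sup>2) \<psi> = 0\<close>.  Elements of Sobolev spaces are represented by Borel functions,
  without passing to classes modulo null sets.\<close>

definition pderiv_at :: "'n \<Rightarrow> (real ^ 'n::finite \<Rightarrow> real) \<Rightarrow> real ^ 'n \<Rightarrow> real" where
  "pderiv_at k f x = frechet_derivative f (at x) (axis k 1)"

primrec C_k :: "nat \<Rightarrow> (real ^ 'n::finite \<Rightarrow> real) \<Rightarrow> bool" where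
  "C_k 0 f \<longleftrightarrow> continuous_on UNIV f"
| "C_k (Suc m) f \<longleftrightarrow> (\<forall>x. f differentiable (at x)) \<and> (\<forall>k. C_k m (pderiv_at k f))"

definition test_function :: "(real ^ 'n::finite \<Rightarrow> real) \<Rightarrow> bool" where
  "test_function f \<longleftrightarrow> (\<forall>m. C_k m f) \<and> compact (closure {x. f x \<noteq> 0})"

definition L1_loc :: "(real ^ 'n::finite \<Rightarrow> complex) set" where
  "L1_loc = {u. \<forall>K. compact K \<longrightarrow> set_integrable lborel K u}"

definition L2_loc :: "(real ^ 'n::finite \<Rightarrow> complex) set" where
  "L2_loc = {u \<in> borel_measurable borel.
     \<forall>K. compact K \<longrightarrow> set_integrable lborel K (\<lambda>x. (cmod (u x))\<^sup>2)}"

definition has_weak_pderiv ::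
    "'n \<Rightarrow> (real ^ 'n::finite \<Rightarrow> complex) \<Rightarrow> (real ^ 'n \<Rightarrow> complex) \<Rightarrow> bool" where
  "has_weak_pderiv k u g \<longleftrightarrow> u \<in> L1_loc \<and> g \<in> L1_loc \<and>
     (\<forall>f. test_function f \<longrightarrow>
        (LINT x|lborel. pderiv_at k f x *\<^sub>R u x) = - (LINT x|lborel. f x *\<^sub>R g x))"

text \<open>A weak derivative is unique up to a null set, so the integrals below do not depend on the
  choice made here.\<close>

definition weak_pderiv :: "'n \<Rightarrow> (real ^ 'n::finite \<Rightarrow> complex) \<Rightarrow> real ^ 'n \<Rightarrow> complex" where
  "weak_pderiv k u = (SOME g. has_weak_pderiv k u g)"

definition H1_loc :: "(real ^ 'n::finite \<Rightarrow> complex) set" where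
  "H1_loc = {u \<in> L2_loc. \<forall>k. \<exists>g \<in> L2_loc. has_weak_pderiv k u g}"

definition periodic :: "real \<Rightarrow> (real ^ 'n::finite \<Rightarrow> complex) \<Rightarrow> bool" where
  "periodic T u \<longleftrightarrow> (\<forall>k x. u (x + axis k T) = u x)"

definition H1_per :: "real \<Rightarrow> (real ^ 'n::finite \<Rightarrow> complex) set" where
  "H1_per T = {u \<in> H1_loc. periodic T u}"

definition cell :: "real \<Rightarrow> (real ^ 'n::finite) set" where
  "cell T = cbox 0 (\<chi> k. T)"

text \<open>On \<^typ>\<open>complex\<close>, \<open>z \<bullet> w\<close> is \<open>Re z * Re w + Im z * Im w\<close>.\<close>

definition H1_inner ::
    "real \<Rightarrow> (real ^ 'n::finite \<Rightarrow> complex) \<Rightarrow> (real ^ 'n \<Rightarrow> complex) \<Rightarrow> real" where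
  "H1_inner T u v =
     (LINT x:cell T|lborel. (\<Sum>k\<in>UNIV. weak_pderiv k u x \<bullet> weak_pderiv k v x) + u x \<bullet> v x)"

definition H1_norm :: "real \<Rightarrow> (real ^ 'n::finite \<Rightarrow> complex) \<Rightarrow> real" where
  "H1_norm T u = sqrt (H1_inner T u u)"

text \<open>The index \<open>k\<^sub>1\<close> is the one of the distinguished coordinate \<open>x\<^sub>1\<close>.  All integrands are integrable
  for \<open>u \<in> H1_per T\<close> and \<open>CARD('n) \<le> 4\<close>, since then \<open>H\<^sup>1\<close> embeds locally into \<open>L\<^sup>4\<close>.\<close>

definition action :: "'n \<Rightarrow> real \<Rightarrow> real \<Rightarrow> (real ^ 'n::finite \<Rightarrow> complex) \<Rightarrow> real" where
  "action k\<^sub>1 c T u =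
     1 / 2 * (LINT x:cell T|lborel. (\<Sum>k\<in>UNIV. (cmod (weak_pderiv k u x))\<^sup>2))
   + 1 / 4 * (LINT x:cell T|lborel. (1 - (cmod (u x))\<^sup>2)\<^sup>2)
   - c / 2 * (LINT x:cell T|lborel. (\<i> * weak_pderiv k\<^sub>1 u x) \<bullet> u x)"

text \<open>Vanishing of the Frechet derivative at \<open>u\<close> of a functional on the Hilbert space \<open>H1_per T\<close>.\<close>

definition critical_point ::
    "real \<Rightarrow> ((real ^ 'n::finite \<Rightarrow> complex) \<Rightarrow> real) \<Rightarrow> (real ^ 'n \<Rightarrow> complex) \<Rightarrow> bool" where
  "critical_point T F u \<longleftrightarrow> u \<in> H1_per T \<and>
     (\<forall>e>0. \<exists>d>0. \<forall>v \<in> H1_per T. H1_norm T v < d \<longrightarrow>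
        \<bar>F (\<lambda>x. u x + v x) - F u\<bar> \<le> e * H1_norm T v)"

text \<open>Periodic weak solutions of \<open>i c \<partial>\<^sub>1\<psi> + \<Delta>\<psi> + (1 - \<bar>\<psi>\<bar>\<^sup>2) \<psi> = 0\<close> are by definition the critical points
  of the action, whose Euler--Lagrange equation this is.\<close>

definition periodic_solution :: "'n \<Rightarrow> real \<Rightarrow> real \<Rightarrow> (real ^ 'n::finite \<Rightarrow> complex) \<Rightarrow> bool" where
  "periodic_solution k\<^sub>1 c T u \<longleftrightarrow> critical_point T (action k\<^sub>1 c T) u"

definition global_minimizer ::
    "real \<Rightarrow> ((real ^ 'n::finite \<Rightarrow> complex) \<Rightarrow> real) \<Rightarrow> (real ^ 'n \<Rightarrow> complex) \<Rightarrow> bool" where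
  "global_minimizer T F u \<longleftrightarrow> u \<in> H1_per T \<and> (\<forall>v \<in> H1_per T. F u \<le> F v)"

text \<open>Constancy is meant modulo null sets, as appropriate for elements of a Sobolev space.\<close>

definition nonconstant :: "(real ^ 'n::finite \<Rightarrow> complex) \<Rightarrow> bool" where
  "nonconstant u \<longleftrightarrow> \<not> (\<exists>z. AE x in lborel. u x = z)"

end

theory Submission
  imports Defs "HOL-Computational_Algebra.Polynomial"
begin

text \<open>
  The minimizer is explicit: it is a plane wave \<open>\<rho> exp (- i \<kappa> x\<^sub>1)\<close> in the distinguished coordinate.
  Put \<open>\<mu> = c / 2\<close>. Completing the square in the distinguished derivative \<open>\<partial>\<^sub>1\<close> rewrites the action
  of \<open>w\<close> as the integral over a cell of
  \<open>1/2 \<bar>\<partial>\<^sub>1 w + i \<mu> w\<bar>\<^sup>2 + 1/2 \<Sum> \<bar>\<partial>\<^sub>k w\<bar>\<^sup>2 + 1/4 (1 - \<bar>w\<bar>\<^sup>2)\<^sup>2 - \<mu>\<^sup>2/2 \<bar>w\<bar>\<^sup>2\<close>, the sum being over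
  the other directions. On \<open>T\<close>-periodic functions the operator \<open>\<partial>\<^sub>1 + i \<mu>\<close> has the spectrum
  \<open>i (\<mu> + 2 \<pi> m / T)\<close>, \<open>m\<close> an integer, so that the first term is at least \<open>1/2 d\<^sup>2 \<bar>w\<bar>\<^sup>2\<close> on
  average, where \<open>d\<close> is the distance from \<open>\<mu>\<close> to the multiples of \<open>2 \<pi> / T\<close>. With
  \<open>a = \<mu>\<^sup>2 - d\<^sup>2\<close> what is left is \<open>1/4 (\<bar>w\<bar>\<^sup>2 - 1 - a)\<^sup>2 - a/2 - a\<^sup>2/4\<close>. All these estimates are
  equalities when \<open>w\<close> is the plane wave with \<open>\<rho>\<^sup>2 = 1 + a\<close> whose wave number \<open>\<kappa>\<close> is the multiple
  of \<open>2 \<pi> / T\<close> nearest to \<open>\<mu>\<close>. It is therefore a global minimizer. As soon as \<open>T > 2 \<pi> / c\<close>, half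
  the spacing of these multiples is less than \<open>\<mu>\<close>; then \<open>d < \<mu>\<close>, hence \<open>a > 0\<close> and the action is
  negative, and \<open>\<kappa> \<noteq> 0\<close>, so that the wave is not constant.

  The work lies in making this rigorous for weak derivatives. Everything rests on
  \<open>twisted_translation_formula\<close>, which expresses the increment of \<open>exp (i \<mu> t) u\<close> along a coordinate
  direction as the integral of \<open>exp (i \<mu> t) (\<partial>\<^sub>k u + i \<mu> u)\<close>; it follows from the definition of weak
  derivatives by the fundamental lemma of the calculus of variations. It has two consequences.

  The first is \<open>spectral_inequality\<close>. Sampling \<open>u\<close> at \<open>n\<close> equidistant points of a period turns the
  inequality into one for periodic sequences, which the discrete Fourier transform diagonalises;
  integrating over the starting point and letting \<open>n\<close> tend to infinity gives the continuous inequality.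

  The second is \<open>L4_embedding\<close>, an inequality of Ladyzhenskaya type, and the place where the
  dimension is restricted. It makes the quartic term of the action finite on the whole space, without
  which minimality could not even be compared, and of fourth order in the \<open>H\<^sup>1\<close> norm. Consequently the
  action differs from its first-order expansion at the minimizer by
  \<open>O(\<parallel>v\<parallel>\<^sup>2 + \<parallel>v\<parallel>\<^sup>4)\<close>, while minimality kills the first-order term; so the minimizer is a
  critical point (\<open>critical_point_of_constant_modulus\<close>).
\<close>

section \<open>Test functions\<close>

text \<open>The derivatives of \<open>exp (- 1/t)\<close>, extended by zero to \<open>t \<le> 0\<close>, are all of this form; the
  polynomial factor is what makes the class closed under differentiation.\<close>

definition flat_exp :: "real poly \<Rightarrow> real \<Rightarrow> real" where
  "flat_exp p t = (if t > 0 then poly p (1 / t) * exp (- (1 / t)) else 0)"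

lemma poly_exp_minus_at_top:
  "((\<lambda>s::real. poly p s * exp (- s)) \<longlongrightarrow> 0) at_top"
proof -
  have "((\<lambda>s::real. \<Sum>i\<le>degree p. coeff p i * (s ^ i / exp s)) \<longlongrightarrow> (\<Sum>i\<le>degree p. coeff p i * 0)) at_top"
    by (intro tendsto_intros tendsto_power_div_exp_0)
  moreover have "poly p s * exp (- s) = (\<Sum>i\<le>degree p. coeff p i * (s ^ i / exp s))" for s
    by (simp add: poly_altdef sum_distrib_right exp_minus divide_inverse mult.assoc)
  ultimately show ?thesis by simp
qed

lemma flat_exp_tendsto_0: "(flat_exp p \<longlongrightarrow> 0) (at 0)"
proof (rule filterlim_split_at_real)
  show "(flat_exp p \<longlongrightarrow> 0) (at_left 0)"
  proof (rule Lim_transform_eventually)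
    show "\<forall>\<^sub>F t in at_left 0. 0 = flat_exp p t"
      by (simp add: eventually_at_filter flat_exp_def)
  qed simp
  have "((\<lambda>t. poly p (inverse t) * exp (- inverse t)) \<longlongrightarrow> 0) (at_right 0)"
    by (rule filterlim_compose[OF poly_exp_minus_at_top filterlim_inverse_at_top_right])
  then show "(flat_exp p \<longlongrightarrow> 0) (at_right 0)"
    by (rule Lim_transform_eventually)
       (auto simp: eventually_at_filter flat_exp_def inverse_eq_divide)
qed

lemma flat_exp_has_derivative:
  "(flat_exp p has_real_derivative flat_exp ([:0, 0, 1:] * (p - pderiv p)) t) (at t)"
proof -
  consider "t > 0" | "t < 0" | "t = 0" by linarith
  then show ?thesis
  proof cases
    case 1
    have i: "((\<lambda>s. 1 / s) has_real_derivative - (1 / t)\<^sup>2) (at t)"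
      using 1 by (auto intro!: derivative_eq_intros simp: power2_eq_square)
    have "((\<lambda>s. poly p (1 / s) * exp (- (1 / s))) has_real_derivative
        (poly (pderiv p) (1 / t) * - (1 / t)\<^sup>2) * exp (- (1 / t)) +
        (exp (- (1 / t)) * - (- (1 / t)\<^sup>2)) * poly p (1 / t)) (at t)"
      by (intro DERIV_mult DERIV_chain2[OF poly_DERIV i] DERIV_chain2[OF DERIV_exp] DERIV_minus i)
    also have "(poly (pderiv p) (1 / t) * - (1 / t)\<^sup>2) * exp (- (1 / t)) +
        (exp (- (1 / t)) * - (- (1 / t)\<^sup>2)) * poly p (1 / t) =
        flat_exp ([:0, 0, 1:] * (p - pderiv p)) t"
      using 1 by (simp add: flat_exp_def algebra_simps power2_eq_square)
    finally have "((\<lambda>s. poly p (1 / s) * exp (- (1 / s))) has_real_derivative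
            flat_exp ([:0, 0, 1:] * (p - pderiv p)) t) (at t)" .
    moreover have "\<forall>\<^sub>F s in nhds t. flat_exp p s = poly p (1 / s) * exp (- (1 / s))"
      using eventually_nhds_in_open[of "{0<..}" t] 1
      by (auto elim!: eventually_mono simp: flat_exp_def)
    ultimately show ?thesis by (simp only: DERIV_cong_ev[OF refl _ refl])
  next
    case 2
    have "((\<lambda>s. 0) has_real_derivative flat_exp ([:0, 0, 1:] * (p - pderiv p)) t) (at t)"
      using 2 by (simp add: flat_exp_def)
    moreover have "\<forall>\<^sub>F s in nhds t. flat_exp p s = 0"
      using eventually_nhds_in_open[of "{..<0}" t] 2
      by (auto elim!: eventually_mono simp: flat_exp_def)
    ultimately show ?thesis by (simp only: DERIV_cong_ev[OF refl _ refl])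
  next
    case 3
    have "(flat_exp ([:0, 1:] * p) \<longlongrightarrow> 0) (at 0)" by (rule flat_exp_tendsto_0)
    also have "flat_exp ([:0, 1:] * p) = (\<lambda>h. (flat_exp p (0 + h) - flat_exp p 0) / h)"
      by (simp add: flat_exp_def fun_eq_iff)
    finally have "((\<lambda>h. (flat_exp p (0 + h) - flat_exp p 0) / h) \<longlongrightarrow> 0) (at 0)" .
    moreover have "flat_exp ([:0, 0, 1:] * (p - pderiv p)) 0 = 0" by (simp add: flat_exp_def)
    ultimately show ?thesis
      using 3 by (simp only: DERIV_def)
  qed
qed

text \<open>\<open>C_k\<close> recurses on the order of differentiation, with the partial derivatives in place of the
  function. Inside a class that is closed under partial derivatives the induction on the order is
  immediate, so the bumps below are placed in such a class.\<close>

inductive_set smooth_alg :: "(real ^ 'n::finite \<Rightarrow> real) set" where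
  coord: "(\<lambda>x. flat_exp p (\<alpha> * (x $ k) + \<beta>)) \<in> smooth_alg"
| const: "(\<lambda>x. c) \<in> smooth_alg"
| add: "f \<in> smooth_alg \<Longrightarrow> g \<in> smooth_alg \<Longrightarrow> (\<lambda>x. f x + g x) \<in> smooth_alg"
| mult: "f \<in> smooth_alg \<Longrightarrow> g \<in> smooth_alg \<Longrightarrow> (\<lambda>x. f x * g x) \<in> smooth_alg"

lemma pderiv_atI: "(f has_derivative f') (at x) \<Longrightarrow> pderiv_at k f x = f' (axis k 1)"
  unfolding pderiv_at_def by (metis frechet_derivative_at)

lemma pderiv_atI':
  "(\<And>x. (f has_derivative f' x) (at x)) \<Longrightarrow> pderiv_at k f = (\<lambda>x. f' x (axis k 1))"
  by (rule ext) (rule pderiv_atI)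

lemma smooth_alg_deriv:
  fixes f :: "real ^ 'n::finite \<Rightarrow> real"
  shows "f \<in> smooth_alg \<Longrightarrow> (\<forall>x. f differentiable (at x)) \<and> (\<forall>k. pderiv_at k f \<in> smooth_alg)"
proof (induction rule: smooth_alg.induct)
  case (coord p \<alpha> j \<beta>)
  let ?r = "[:0, 0, 1:] * (p - pderiv p)"
  have D: "((\<lambda>x::real^'n. flat_exp p (\<alpha> * (x $ j) + \<beta>)) has_derivative
      (\<lambda>h. h $ j * \<alpha> * flat_exp ?r (\<alpha> * (x $ j) + \<beta>))) (at x)" for x
  proof -
    have *: "((\<lambda>x::real^'n. \<alpha> * (x $ j) + \<beta>) has_derivative (\<lambda>h. \<alpha> * (h $ j))) (at x)"
      by (auto intro!: derivative_eq_intros bounded_linear_imp_has_derivative bounded_linear_vec_nth)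
    show ?thesis
      by (rule has_derivative_eq_rhs[OF has_derivative_compose[OF * flat_exp_has_derivative[of p "\<alpha> * (x $ j) + \<beta>", unfolded has_field_derivative_def]]])
         (auto simp: fun_eq_iff)
  qed
  have "pderiv_at k (\<lambda>x::real^'n. flat_exp p (\<alpha> * (x $ j) + \<beta>)) =
     (\<lambda>x. (axis k 1 $ j * \<alpha>) * flat_exp ?r (\<alpha> * (x $ j) + \<beta>))" for k
    by (rule pderiv_atI'[OF D])
  then show ?case using D unfolding differentiable_def
    by (auto intro: smooth_alg.intros)
next
  case (const c)
  have "pderiv_at k (\<lambda>x. c) = (\<lambda>x. 0)" for k :: 'n
    by (rule pderiv_atI'[where f'="\<lambda>x h. 0"]) simp
  then show ?case by (auto intro: smooth_alg.intros)
next
  case (add f g)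
  then have D: "((\<lambda>x. f x + g x) has_derivative
      (\<lambda>h. frechet_derivative f (at x) h + frechet_derivative g (at x) h)) (at x)" for x
    by (intro has_derivative_add) (auto simp: frechet_derivative_works)
  have "pderiv_at k (\<lambda>x. f x + g x) = (\<lambda>x. pderiv_at k f x + pderiv_at k g x)" for k
    unfolding pderiv_at_def[of k f] pderiv_at_def[of k g] by (rule pderiv_atI'[OF D])
  then show ?case using add D unfolding differentiable_def
    by (auto intro: smooth_alg.intros)
next
  case (mult f g)
  then have D: "((\<lambda>x. f x * g x) has_derivative
      (\<lambda>h. f x * frechet_derivative g (at x) h + frechet_derivative f (at x) h * g x)) (at x)" for x
    by (intro has_derivative_mult) (auto simp: frechet_derivative_works)
  have "pderiv_at k (\<lambda>x. f x * g x) = (\<lambda>x. f x * pderiv_at k g x + pderiv_at k f x * g x)" for k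
    unfolding pderiv_at_def[of k f] pderiv_at_def[of k g] by (rule pderiv_atI'[OF D])
  moreover have "(\<lambda>x. f x * pderiv_at k g x + pderiv_at k f x * g x) \<in> smooth_alg" for k
    using mult by (intro smooth_alg.add smooth_alg.mult) auto
  ultimately show ?case using D unfolding differentiable_def by auto
qed

lemma C_k_smooth_alg: "f \<in> smooth_alg \<Longrightarrow> C_k m f"
proof (induction m arbitrary: f)
  case 0
  then show ?case
    using smooth_alg_deriv[of f] 
    by (auto intro!: continuous_at_imp_continuous_on differentiable_imp_continuous_within)
next
  case (Suc m)
  then show ?case using smooth_alg_deriv[of f] by simp
qed

text \<open>Increasing \<open>r\<close> drives each factor \<open>exp (- 1 / (r s))\<close> to 1 where \<open>s > 0\<close>, while the support stays
  in the box: this makes the indicator of a box a bounded limit of test functions.\<close>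

definition box_bump :: "real \<Rightarrow> real ^ 'n::finite \<Rightarrow> real ^ 'n \<Rightarrow> real ^ 'n \<Rightarrow> real" where
  "box_bump r a b x = (\<Prod>k\<in>UNIV. flat_exp 1 (r * (x $ k - a $ k)) * flat_exp 1 (r * (b $ k - x $ k)))"

lemma box_bump_nonneg_le_1: "0 \<le> box_bump r a b x" "box_bump r a b x \<le> 1"
  unfolding box_bump_def by (intro prod_nonneg prod_le_1; auto simp: flat_exp_def intro!: mult_le_one)+

lemma box_bump_eq_0: "r \<ge> 0 \<Longrightarrow> x \<notin> box a b \<Longrightarrow> box_bump r a b x = 0"
proof -
  assume r: "r \<ge> 0" and "x \<notin> box a b"
  then obtain k where "x $ k \<le> a $ k \<or> b $ k \<le> x $ k" by (force simp: mem_box_cart not_less)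
  with r have "flat_exp 1 (r * (x $ k - a $ k)) * flat_exp 1 (r * (b $ k - x $ k)) = 0"
    by (auto simp: flat_exp_def zero_less_mult_iff)
  then show ?thesis unfolding box_bump_def by (auto intro!: prod_zero)
qed

lemma box_bump_tendsto: "((\<lambda>r. box_bump r a b x) \<longlongrightarrow> indicator (box a b) x) at_top"
proof (cases "x \<in> box a b")
  case True
  have 1: "((\<lambda>r. flat_exp 1 (r * s)) \<longlongrightarrow> 1) at_top" if s: "s > 0" for s :: real
  proof -
    have "filterlim (\<lambda>r. r * s) at_top at_top"
      using filterlim_tendsto_pos_mult_at_top[OF tendsto_const s filterlim_ident] by (simp add: mult.commute)
    from tendsto_inverse_0_at_top[OF this] have "((\<lambda>r. exp (- inverse (r * s))) \<longlongrightarrow> exp (- 0)) at_top"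
      by (intro tendsto_intros)
    then have "((\<lambda>r. exp (- inverse (r * s))) \<longlongrightarrow> 1) at_top" by simp
    then show ?thesis
    proof (rule Lim_transform_eventually)
      show "\<forall>\<^sub>F r in at_top. exp (- inverse (r * s)) = flat_exp 1 (r * s)"
        using eventually_gt_at_top[of 0]
        by eventually_elim (simp add: s flat_exp_def inverse_eq_divide)
    qed
  qed
  have "((\<lambda>r. box_bump r a b x) \<longlongrightarrow> (\<Prod>k\<in>(UNIV::'a set). 1 * 1)) at_top"
    unfolding box_bump_def using True
    by (intro tendsto_intros 1) (auto simp: mem_box_cart)
  with True show ?thesis by simp
next
  case False
  have "\<forall>\<^sub>F r in at_top. 0 = box_bump r a b x"
    using eventually_ge_at_top[of 0] by eventually_elim (simp add: box_bump_eq_0 False)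
  with False show ?thesis by (auto intro: Lim_transform_eventually)
qed

lemma test_function_box_bump:
  assumes "r \<ge> 0" shows "test_function (box_bump r a b)"
proof -
  have prod: "(\<lambda>x. \<Prod>k\<in>A. f k x) \<in> smooth_alg" if "finite A" "\<And>k. f k \<in> smooth_alg"
    for A :: "'a set" and f :: "'a \<Rightarrow> real^'a \<Rightarrow> real"
    using that by (induction rule: finite_induct) (auto intro: smooth_alg.intros)
  have "box_bump r a b \<in> smooth_alg"
    unfolding box_bump_def[abs_def]
  proof (intro prod smooth_alg.mult)
    fix k
    show "(\<lambda>x. flat_exp 1 (r * (x $ k - a $ k))) \<in> smooth_alg"
      using smooth_alg.coord[of 1 r k "- r * a $ k"] by (simp add: algebra_simps)
    show "(\<lambda>x. flat_exp 1 (r * (b $ k - x $ k))) \<in> smooth_alg"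
      using smooth_alg.coord[of 1 "- r" k "r * b $ k"] by (simp add: algebra_simps)
  qed simp
  moreover have "compact (closure {x. box_bump r a b x \<noteq> 0})"
    using box_bump_eq_0[OF assms] bounded_box
    by (auto intro!: bounded_subset[OF bounded_box[of a b]] simp: compact_closure)
  ultimately show ?thesis
    unfolding test_function_def by (auto intro: C_k_smooth_alg)
qed

section \<open>Translations and locally integrable functions\<close>

lemma lborel_distr_add: "distr lborel borel (\<lambda>x::'a::euclidean_space. x + a) = lborel"
proof -
  have "(\<lambda>x. x + a) = (+) a" by (auto simp: add.commute)
  then show ?thesis using lborel_distr_plus[of a] by simp
qed

lemma nn_integral_lborel_shift:
  fixes f :: "'a::euclidean_space \<Rightarrow> ennreal"
  assumes [measurable]: "f \<in> borel_measurable borel"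
  shows "(\<integral>\<^sup>+x. f (x + a) \<partial>lborel) = (\<integral>\<^sup>+x. f x \<partial>lborel)"
proof -
  have "(\<integral>\<^sup>+x. f x \<partial>lborel) = (\<integral>\<^sup>+x. f x \<partial>distr lborel borel (\<lambda>x. x + a))"
    by (simp only: lborel_distr_add)
  also have "\<dots> = (\<integral>\<^sup>+x. f (x + a) \<partial>lborel)" by (rule nn_integral_distr) auto
  finally show ?thesis by (rule sym)
qed

lemma integral_lborel_shift:
  fixes f :: "'a::euclidean_space \<Rightarrow> 'b::{banach, second_countable_topology}"
  assumes [measurable]: "f \<in> borel_measurable borel"
  shows "(LINT x|lborel. f (x + a)) = (LINT x|lborel. f x)"
proof -
  have "(LINT x|lborel. f x) = (LINT x|distr lborel borel (\<lambda>x. x + a). f x)"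
    by (simp only: lborel_distr_add)
  also have "\<dots> = (LINT x|lborel. f (x + a))" by (rule integral_distr) auto
  finally show ?thesis by (rule sym)
qed

lemma integrable_lborel_shift:
  fixes f :: "'a::euclidean_space \<Rightarrow> 'b::{banach, second_countable_topology}"
  assumes "integrable lborel f"
  shows "integrable lborel (\<lambda>x. f (x + a))"
proof -
  have [measurable]: "f \<in> borel_measurable borel" using assms by auto
  have "integrable (distr lborel borel (\<lambda>x. x + a)) f" using assms lborel_distr_add[of a] by simp
  then show ?thesis by (subst (asm) integrable_distr_eq) simp_all
qed

lemma AE_lborel_shift:
  assumes "AE x in lborel. P (x::'a::euclidean_space)"
  shows "AE x in lborel. P (x + a)"
proof -
  from assms obtain N where N: "N \<in> null_sets lborel" "{x. \<not> P x} \<subseteq> N"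
    by (auto simp: eventually_ae_filter)
  then have [measurable]: "N \<in> sets borel" by auto
  have "AE x in lborel. x \<notin> N" using N AE_not_in by blast
  then have "AE x in distr lborel borel (\<lambda>x. x + a). x \<notin> N" by (simp only: lborel_distr_add)
  then have "AE x in lborel. x + a \<notin> N" by (subst (asm) AE_distr_iff) auto
  then show ?thesis using N by (auto elim!: eventually_mono)
qed

lemma L1_loc_measurable: "u \<in> L1_loc \<Longrightarrow> u \<in> borel_measurable borel"
proof (rule borel_measurable_LIMSEQ_metric[where f="\<lambda>n x. indicator (cball 0 (real n)) x *\<^sub>R u x"])
  fix n :: nat assume "u \<in> L1_loc"
  then have "set_integrable lborel (cball 0 (real n)) u" by (auto simp: L1_loc_def)
  then show "(\<lambda>x. indicator (cball 0 (real n)) x *\<^sub>R u x) \<in> borel_measurable borel"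
    unfolding set_integrable_def by auto
next
  fix x :: "real^'a"
  have "\<forall>\<^sub>F n in sequentially. indicator (cball 0 (real n)) x *\<^sub>R u x = u x"
    using eventually_ge_at_top[of "nat \<lceil>norm x\<rceil>"] by eventually_elim (auto simp: nat_le_iff ceiling_le_iff)
  then show "(\<lambda>n. indicator (cball 0 (real n)) x *\<^sub>R u x) \<longlonglongrightarrow> u x"
    by (rule tendsto_eventually)
qed

lemma L1_loc_integrable:
  assumes "u \<in> L1_loc" "compact K" and [measurable]: "f \<in> borel_measurable borel"
    and "\<And>x. norm (f x) \<le> B" "\<And>x. x \<notin> K \<Longrightarrow> f x = (0::real)"
  shows "integrable lborel (\<lambda>x. f x *\<^sub>R u x)"
proof (rule Bochner_Integration.integrable_bound)
  have "integrable lborel (\<lambda>x. indicator K x *\<^sub>R u x)"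
    using assms(1,2) unfolding L1_loc_def set_integrable_def by auto
  then show "integrable lborel (\<lambda>x. B *\<^sub>R (indicator K x *\<^sub>R u x))"
    by (rule integrable_scaleR_right)
  have [measurable]: "u \<in> borel_measurable borel" using assms(1) by (rule L1_loc_measurable)
  show "(\<lambda>x. f x *\<^sub>R u x) \<in> borel_measurable lborel" by measurable
  have B: "\<bar>f x\<bar> \<le> \<bar>B\<bar>" for x using assms(4)[of x] by simp
  show "AE x in lborel. norm (f x *\<^sub>R u x) \<le> norm (B *\<^sub>R (indicator K x *\<^sub>R u x))"
    using B assms(5) by (auto intro!: AE_I2 mult_right_mono split: split_indicator)
qed

lemma continuous_compact_support_bounded:
  fixes f :: "'a::euclidean_space \<Rightarrow> real"
  assumes "continuous_on UNIV f" "compact K" "\<And>x. x \<notin> K \<Longrightarrow> f x = 0"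
  obtains B where "B \<ge> 0" "\<And>x. \<bar>f x\<bar> \<le> B"
proof -
  have "bounded (f ` K)"
    using assms by (intro compact_imp_bounded compact_continuous_image) (auto intro: continuous_on_subset)
  then obtain B where "\<And>x. x \<in> K \<Longrightarrow> \<bar>f x\<bar> \<le> B" by (auto simp: bounded_iff)
  then have "\<bar>f x\<bar> \<le> max 0 B" for x using assms(3)[of x] by (cases "x \<in> K") fastforce+
  then show ?thesis using that[of "max 0 B"] by auto
qed

text \<open>The compact set is a parameter because the dominating functions for difference quotients are
  built from it.\<close>

definition C1_compact_support :: "'n \<Rightarrow> (real ^ 'n::finite) set \<Rightarrow> (real ^ 'n \<Rightarrow> real) \<Rightarrow> bool" where
  "C1_compact_support k K f \<longleftrightarrow> compact K \<and> (\<forall>x. f differentiable (at x)) \<and>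
     continuous_on UNIV (pderiv_at k f) \<and> (\<forall>x. x \<notin> K \<longrightarrow> f x = 0 \<and> pderiv_at k f x = 0)"

lemma C1_compact_supportD:
  assumes "C1_compact_support k K f"
  shows "compact K" "continuous_on UNIV f" "continuous_on UNIV (pderiv_at k f)"
    "x \<notin> K \<Longrightarrow> f x = 0" "x \<notin> K \<Longrightarrow> pderiv_at k f x = 0"
    "f \<in> borel_measurable borel" "pderiv_at k f \<in> borel_measurable borel"
proof -
  show 1: "continuous_on UNIV f"
    using assms by (auto simp: C1_compact_support_def intro!: continuous_at_imp_continuous_on differentiable_imp_continuous_within)
  show 2: "continuous_on UNIV (pderiv_at k f)" using assms by (auto simp: C1_compact_support_def)
  show "f \<in> borel_measurable borel" "pderiv_at k f \<in> borel_measurable borel"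
    using 1 2 by (auto intro: borel_measurable_continuous_onI)
qed (use assms in \<open>auto simp: C1_compact_support_def\<close>)

lemma C1_compact_support_bounded:
  assumes "C1_compact_support k K f"
  obtains B where "B \<ge> 0" "\<And>x. \<bar>f x\<bar> \<le> B" "\<And>x. \<bar>pderiv_at k f x\<bar> \<le> B"
proof -
  note D = C1_compact_supportD[OF assms]
  obtain B where B: "B \<ge> 0" "\<And>x. \<bar>f x\<bar> \<le> B"
    using continuous_compact_support_bounded[OF D(2,1,4)] by blast
  obtain B' where B': "B' \<ge> 0" "\<And>x. \<bar>pderiv_at k f x\<bar> \<le> B'"
    using continuous_compact_support_bounded[OF D(3,1,5)] by blast
  show ?thesis
    by (rule that[of "max B B'"]) (use B B' in \<open>auto simp: max.coboundedI1 max.coboundedI2\<close>)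
qed

lemma pderiv_at_zero_outside:
  assumes "closed K" "\<And>x. x \<notin> K \<Longrightarrow> f x = 0" "x \<notin> K"
  shows "pderiv_at k f x = 0"
proof (rule pderiv_atI)
  have "((\<lambda>x. 0) has_derivative (\<lambda>h. 0)) (at x)" by simp
  then show "(f has_derivative (\<lambda>h. 0)) (at x)"
    by (rule has_derivative_transform_within_open[of _ _ _ _ "- K"]) (use assms in auto)
qed

lemma test_function_C1:
  assumes "test_function f"
  shows "C1_compact_support k (closure {x. f x \<noteq> 0}) f"
proof -
  have "C_k (Suc 0) f" using assms by (auto simp: test_function_def simp del: C_k.simps)
  moreover have "f x = 0" if "x \<notin> closure {x. f x \<noteq> 0}" for x
    using that closure_subset[of "{x. f x \<noteq> 0}"] by auto
  moreover from this have "pderiv_at k f x = 0" if "x \<notin> closure {x. f x \<noteq> 0}" for x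
    using pderiv_at_zero_outside[OF closed_closure _ that] by blast
  moreover have "compact (closure {x. f x \<noteq> 0})" using assms by (simp add: test_function_def)
  ultimately show ?thesis unfolding C1_compact_support_def C_k.simps by blast
qed

lemma test_function_supp:
  assumes "test_function f"
  obtains K where "\<And>k. C1_compact_support k K f"
  using test_function_C1[OF assms] by blast

lemma pderiv_at_shift: "pderiv_at k (\<lambda>x. f (x + a)) = (\<lambda>x. pderiv_at k f (x + a))"
proof -
  have "((\<lambda>x. f (x + a)) has_derivative D) (at x) \<longleftrightarrow> (f has_derivative D) (at (x + a))" for D x
    by (simp add: has_derivative_at has_derivative_iff_norm[symmetric] algebra_simps)
  then show ?thesis by (simp add: pderiv_at_def frechet_derivative_def fun_eq_iff)
qed

lemma differentiable_shift: 
  fixes f :: "real ^ 'n::finite \<Rightarrow> real"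
  shows "f differentiable (at (x + a)) \<Longrightarrow> (\<lambda>x. f (x + a)) differentiable (at x)"
  by (rule differentiable_compose[of f "\<lambda>x. x + a" x UNIV]) (auto intro!: derivative_intros)

lemma C_k_shift: "C_k m f \<Longrightarrow> C_k m (\<lambda>x. f (x + a))"
proof (induction m arbitrary: f)
  case 0
  then show ?case by (auto intro!: continuous_intros continuous_on_compose2[of UNIV f])
next
  case (Suc m)
  then show ?case by (auto simp: pderiv_at_shift intro!: differentiable_shift)
qed

lemma C1_compact_support_shift:
  assumes "C1_compact_support k K f"
  shows "C1_compact_support k ((\<lambda>x. x - a) ` K) (\<lambda>x. f (x + a))"
proof -
  have "x + a \<notin> K" if "x \<notin> (\<lambda>x. x - a) ` K" for x
    using that by (metis add_diff_cancel image_eqI)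
  then show ?thesis
    using assms unfolding C1_compact_support_def pderiv_at_shift
    by (auto intro!: differentiable_shift compact_continuous_image continuous_intros
      continuous_on_compose2[of UNIV "pderiv_at k f"])
qed

lemma test_function_shift:
  assumes "test_function f" shows "test_function (\<lambda>x. f (x + a))"
proof -
  have "closure {x. f (x + a) \<noteq> 0} \<subseteq> (\<lambda>x. x - a) ` closure {x. f x \<noteq> 0}"
  proof (rule closure_minimal)
    show "closed ((\<lambda>x. x - a) ` closure {x. f x \<noteq> 0})"
      using assms by (intro compact_imp_closed compact_continuous_image continuous_intros) (auto simp: test_function_def)
    show "{x. f (x + a) \<noteq> 0} \<subseteq> (\<lambda>x. x - a) ` closure {x. f x \<noteq> 0}"
      using closure_subset[of "{x. f x \<noteq> 0}"] by (force simp: image_iff algebra_simps)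
  qed
  then have "bounded (closure {x. f (x + a) \<noteq> 0})"
    using assms by (intro bounded_subset[OF _ \<open>_ \<subseteq> _\<close>] compact_imp_bounded compact_continuous_image continuous_intros)
      (auto simp: test_function_def)
  then show ?thesis using assms by (auto simp: test_function_def C_k_shift compact_eq_bounded_closed)
qed

section \<open>The fundamental lemma of the calculus of variations\<close>

text \<open>Dominated convergence along the bumps of the box.\<close>

lemma integral_box_zero:
  fixes w :: "real ^ 'n::finite \<Rightarrow> complex"
  assumes w: "w \<in> L1_loc"
    and zero: "\<And>f. test_function f \<Longrightarrow> (LINT x|lborel. f x *\<^sub>R w x) = 0"
  shows "(LINT x|lborel. indicator (box a b) x *\<^sub>R w x) = 0"
proof -
  have [measurable]: "w \<in> borel_measurable borel" using w by (rule L1_loc_measurable)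
  have [measurable]: "box_bump (real n) a b \<in> borel_measurable borel" for n
  proof -
    obtain K where "C1_compact_support undefined K (box_bump (real n) a b)"
      using test_function_supp[OF test_function_box_bump[of "real n" a b]] by auto
    then show ?thesis by (rule C1_compact_supportD)
  qed
  have "(\<lambda>n. LINT x|lborel. box_bump (real n) a b x *\<^sub>R w x) \<longlonglongrightarrow>
      (LINT x|lborel. indicator (box a b) x *\<^sub>R w x)"
  proof (rule integral_dominated_convergence)
    have "set_integrable lborel (cbox a b) w" using w by (auto simp: L1_loc_def)
    then show "integrable lborel (\<lambda>x. norm (indicator (cbox a b) x *\<^sub>R w x))"
      unfolding set_integrable_def by (rule integrable_norm)
    show "AE x in lborel. (\<lambda>n. box_bump (real n) a b x *\<^sub>R w x) \<longlonglongrightarrow> indicator (box a b) x *\<^sub>R w x"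
      by (intro AE_I2 tendsto_intros filterlim_compose[OF box_bump_tendsto filterlim_real_sequentially])
    show "AE x in lborel. norm (box_bump (real n) a b x *\<^sub>R w x) \<le> norm (indicator (cbox a b) x *\<^sub>R w x)" for n
    proof (intro AE_I2)
      fix x
      show "norm (box_bump (real n) a b x *\<^sub>R w x) \<le> norm (indicator (cbox a b) x *\<^sub>R w x)"
      proof (cases "x \<in> cbox a b")
        case True
        then show ?thesis
          using box_bump_nonneg_le_1[of "real n" a b x] by (simp add: mult_left_le_one_le)
      next
        case False
        then have "x \<notin> box a b" using box_subset_cbox[of a b] by auto
        then show ?thesis using box_bump_eq_0[of "real n" x a b] by simp
      qed
    qed
  qed measurable
  moreover have "(LINT x|lborel. box_bump (real n) a b x *\<^sub>R w x) = 0" for n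
    by (rule zero) (simp add: test_function_box_bump)
  ultimately show ?thesis by (simp add: LIMSEQ_const_iff)
qed

text \<open>Boxes are stable under intersection and generate the Borel sets, so the integral over every
  Borel set vanishes; the total integral is needed to pass to complements.\<close>

lemma AE_zero_if_box_integrals_zero:
  fixes w :: "real ^ 'n::finite \<Rightarrow> complex"
  assumes int: "integrable lborel w"
    and zero: "\<And>a b. (LINT x:box a b|lborel. w x) = 0"
    and total: "(LINT x|lborel. w x) = 0"
  shows "AE x in lborel. w x = 0"
proof (rule sigma_finite_measure.density_zero[OF lborel.sigma_finite_measure_axioms int])
  have subset_Pow_UNIV: "range (\<lambda>(a, b). box a b :: (real^'n) set) \<subseteq> Pow UNIV" by simp
  fix A :: "(real^'n) set" assume "A \<in> sets lborel"
  then have "A \<in> sigma_sets UNIV (range (\<lambda>(a, b). box a b))" by (simp add: borel_eq_box)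
  have "Int_stable (range (\<lambda>(a, b). box a b :: (real^'n) set))"
    by (auto simp: Int_stable_def box_Int_box)
  have sets: "B \<in> sets borel" if "B \<in> sigma_sets UNIV (range (\<lambda>(a, b). box a b :: (real^'n) set))" for B
    using that by (simp add: borel_eq_box)
  have intA: "set_integrable lborel B w" if "B \<in> sets borel" for B
    using int that unfolding set_integrable_def by (auto intro: integrable_mult_indicator)
  show "(LINT x:A|lborel. w x) = 0"
    using \<open>Int_stable _\<close> subset_Pow_UNIV \<open>A \<in> sigma_sets _ _\<close>
  proof (induction A rule: sigma_sets_induct_disjoint)
    case (basic B)
    then show ?case using zero by auto
  next
    case (compl B)
    have "indicator (UNIV - B) x *\<^sub>R w x = w x - indicator B x *\<^sub>R w x" for x
      by (auto split: split_indicator)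
    then show ?case
      using compl total int intA[OF sets[OF compl(1)]] by (simp add: set_lebesgue_integral_def set_integrable_def)
  next
    case (union B)
    then show ?case
      by (subst lebesgue_integral_countable_add)
         (auto intro!: intA sets sets.countable_UN simp: disjoint_family_on_def)
  qed (auto simp: set_lebesgue_integral_def)
qed

text \<open>Cutting \<open>w\<close> off to a large box makes it integrable, and the product of two indicators of boxes is
  again one.\<close>

theorem fundamental_lemma:
  fixes w :: "real ^ 'n::finite \<Rightarrow> complex"
  assumes w: "w \<in> L1_loc"
    and zero: "\<And>f. test_function f \<Longrightarrow> (LINT x|lborel. f x *\<^sub>R w x) = 0"
  shows "AE x in lborel. w x = 0"
proof -
  let ?B = "\<lambda>n. box (- (real n *\<^sub>R One)) (real n *\<^sub>R One) :: (real^'n) set"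
  have "AE x in lborel. indicator (?B n) x *\<^sub>R w x = 0" for n
  proof (rule AE_zero_if_box_integrals_zero)
    have "set_integrable lborel (cbox (- (real n *\<^sub>R One)) (real n *\<^sub>R One)) w"
      using w by (auto simp: L1_loc_def)
    then have "set_integrable lborel (?B n) w"
      by (rule set_integrable_subset) (auto simp: box_subset_cbox)
    then show "integrable lborel (\<lambda>x. indicator (?B n) x *\<^sub>R w x)" by (simp add: set_integrable_def)
    show "(LINT x|lborel. indicator (?B n) x *\<^sub>R w x) = 0"
      by (rule integral_box_zero[OF assms])
    show "(LINT x:box a b|lborel. indicator (?B n) x *\<^sub>R w x) = 0" for a b
      using integral_box_zero[OF assms] unfolding set_lebesgue_integral_def scaleR_scaleR indicator_inter_arith[symmetric] box_Int_box
      by blast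
  qed
  then have "AE x in lborel. \<forall>n. indicator (?B n) x *\<^sub>R w x = 0" by (subst AE_all_countable) blast
  then show ?thesis
  proof eventually_elim
    case (elim x)
    obtain n where "x \<in> ?B n" using UN_box_eq_UNIV by blast
    then show ?case using elim[rule_format, of n] by simp
  qed
qed

section \<open>Weak derivatives along lines\<close>

lemma axis_eq_scaleR: "axis k t = t *\<^sub>R (axis k 1 :: real ^ 'n::finite)"
  by (simp add: vec_eq_iff axis_def)

lemma has_real_derivative_along_axis:
  fixes f :: "real ^ 'n::finite \<Rightarrow> real"
  assumes "\<And>x. f differentiable (at x)"
  shows "((\<lambda>t. f (x - t *\<^sub>R axis k 1)) has_real_derivative - pderiv_at k f (x - t *\<^sub>R axis k 1)) (at t)"
proof -
  let ?y = "x - t *\<^sub>R axis k 1"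
  have "((\<lambda>t. x - t *\<^sub>R axis k 1) has_derivative (\<lambda>h. - (h *\<^sub>R axis k 1))) (at t)"
    by (auto intro!: derivative_eq_intros)
  moreover have f: "(f has_derivative frechet_derivative f (at ?y)) (at ?y)"
    using assms frechet_derivative_works by blast
  ultimately have D: "((\<lambda>t. f (x - t *\<^sub>R axis k 1)) has_derivative
      (\<lambda>h. frechet_derivative f (at ?y) (- (h *\<^sub>R axis k 1)))) (at t)"
    by (rule has_derivative_compose)
  have "frechet_derivative f (at ?y) (- (h *\<^sub>R axis k 1)) = - pderiv_at k f ?y * h" for h
    using has_derivative_linear[OF f] by (simp add: linear_cmul linear_neg pderiv_at_def)
  then show ?thesis unfolding has_field_derivative_def by (intro has_derivative_eq_rhs[OF D] ext)
qed

lemma C1_compact_support_increment: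
  assumes f: "C1_compact_support k K f" and B: "\<And>x. \<bar>pderiv_at k f x\<bar> \<le> B"
  shows "\<bar>f (x - s *\<^sub>R axis k 1) - f x\<bar> \<le> B * \<bar>s\<bar>"
proof -
  have "norm (f (x - s *\<^sub>R axis k 1) - f (x - 0 *\<^sub>R axis k 1)) \<le> B * norm (s - 0)"
    by (rule field_differentiable_bound[of UNIV "\<lambda>t. f (x - t *\<^sub>R axis k 1)"
          "\<lambda>t. - pderiv_at k f (x - t *\<^sub>R axis k 1)"])
       (use f B in \<open>auto intro!: has_real_derivative_along_axis simp: C1_compact_support_def\<close>)
  then show ?thesis by simp
qed

text \<open>The difference quotients are bounded by a bound for the derivative and, for \<open>\<bar>s\<bar> < 1\<close>, vanish
  outside the neighbourhood of radius 1 of the support; so dominated convergence applies although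
  \<open>u\<close> is only locally integrable.\<close>

lemma difference_quotient_tendsto:
  fixes f :: "real ^ 'n::finite \<Rightarrow> real" and u :: "real ^ 'n \<Rightarrow> complex"
  assumes f: "C1_compact_support k K f" and u: "u \<in> L1_loc"
  shows "((\<lambda>s. LINT x|lborel. ((f (x - s *\<^sub>R axis k 1) - f x) / s) *\<^sub>R u x) \<longlongrightarrow>
           (LINT x|lborel. - pderiv_at k f x *\<^sub>R u x)) (at 0)"
proof -
  note fD = C1_compact_supportD[OF f]
  note [measurable] = fD(6,7) L1_loc_measurable[OF u]
  obtain B where B: "B \<ge> 0" "\<And>x. \<bar>pderiv_at k f x\<bar> \<le> B"
    using C1_compact_support_bounded[OF f] by metis
  define K' where "K' = {x + y |x y. x \<in> K \<and> y \<in> cball (0::real^'n) 1}"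
  have K': "compact K'" unfolding K'_def by (intro compact_sums fD) auto
  have supp: "f (x - s *\<^sub>R axis k 1) - f x = 0" if s: "\<bar>s\<bar> \<le> 1" and x: "x \<notin> K'" for x s
  proof -
    have K'I: "a + b \<in> K'" if "a \<in> K" "norm b \<le> 1" for a b
      using that unfolding K'_def by auto
    have "x \<notin> K" using K'I[of x 0] x by auto
    moreover have "x - s *\<^sub>R axis k 1 \<notin> K"
      using K'I[of "x - s *\<^sub>R axis k 1" "s *\<^sub>R axis k 1"] x s by auto
    ultimately show ?thesis using fD(4) by simp
  qed
  have "((\<lambda>s. LINT x|lborel. ((f (x - s *\<^sub>R axis k 1) - f x) / s) *\<^sub>R u x) \<longlongrightarrow>
           (LINT x|lborel. - pderiv_at k f x *\<^sub>R u x)) (at 0 within {-1<..<1})"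
    unfolding tendsto_at_iff_sequentially
  proof (intro allI impI)
    fix X :: "nat \<Rightarrow> real" assume X: "\<forall>i. X i \<in> {-1<..<1} - {0}" "X \<longlonglongrightarrow> 0"
    have Xlim: "filterlim X (at 0) sequentially"
      using X by (auto simp: filterlim_at)
    show "((\<lambda>s. LINT x|lborel. ((f (x - s *\<^sub>R axis k 1) - f x) / s) *\<^sub>R u x) \<circ> X) \<longlonglongrightarrow>
       (LINT x|lborel. - pderiv_at k f x *\<^sub>R u x)"
      unfolding comp_def
    proof (rule integral_dominated_convergence)
      have "integrable lborel (\<lambda>x. indicator K' x *\<^sub>R u x)"
        using u K' by (auto simp: L1_loc_def set_integrable_def)
      then show "integrable lborel (\<lambda>x. B * norm (indicator K' x *\<^sub>R u x))" by (intro integrable_mult_right integrable_norm)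
      show "AE x in lborel. (\<lambda>i. ((f (x - X i *\<^sub>R axis k 1) - f x) / X i) *\<^sub>R u x) \<longlonglongrightarrow> - pderiv_at k f x *\<^sub>R u x"
      proof (intro AE_I2 tendsto_scaleR tendsto_const)
        fix x
        have "((\<lambda>t. f (x - t *\<^sub>R axis k 1)) has_real_derivative - pderiv_at k f (x - 0 *\<^sub>R axis k 1)) (at 0)"
          by (rule has_real_derivative_along_axis) (use f in \<open>auto simp: C1_compact_support_def\<close>)
        then have "((\<lambda>s. (f (x - s *\<^sub>R axis k 1) - f x) / s) \<longlongrightarrow> - pderiv_at k f x) (at 0)"
          by (simp add: DERIV_def)
        then show "(\<lambda>i. (f (x - X i *\<^sub>R axis k 1) - f x) / X i) \<longlonglongrightarrow> - pderiv_at k f x"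
          using Xlim by (rule filterlim_compose)
      qed
      show "AE x in lborel. norm (((f (x - X i *\<^sub>R axis k 1) - f x) / X i) *\<^sub>R u x)
            \<le> B * norm (indicator K' x *\<^sub>R u x)" for i
      proof (intro AE_I2)
        fix x
        have i: "\<bar>X i\<bar> \<le> 1" "X i \<noteq> 0" using X(1)[rule_format, of i] by auto
        show "norm (((f (x - X i *\<^sub>R axis k 1) - f x) / X i) *\<^sub>R u x) \<le> B * norm (indicator K' x *\<^sub>R u x)"
        proof (cases "x \<in> K'")
          case True
          have "\<bar>(f (x - X i *\<^sub>R axis k 1) - f x) / X i\<bar> \<le> B"
            using C1_compact_support_increment[OF f B(2), of x "X i"] i by (simp add: abs_divide divide_le_eq)
          then show ?thesis using True unfolding norm_scaleR by (simp add: mult_right_mono del: abs_divide)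
        qed (use supp[OF i(1)] in simp)
      qed
    qed measurable
  qed
  then show ?thesis by (subst (asm) at_within_open) auto
qed

lemma has_vector_derivativeI_quotient:
  fixes \<phi> :: "real \<Rightarrow> 'a::real_normed_vector"
  assumes "((\<lambda>s. (\<phi> (t + s) - \<phi> t) /\<^sub>R s) \<longlongrightarrow> D) (at 0)"
  shows "(\<phi> has_vector_derivative D) (at t)"
proof -
  have "((\<lambda>s. norm ((\<phi> (t + s) - \<phi> t) /\<^sub>R s - D)) \<longlongrightarrow> 0) (at 0)"
    using assms by (simp add: LIM_zero_iff tendsto_norm_zero_iff)
  moreover have "norm ((\<phi> (t + s) - \<phi> t) /\<^sub>R s - D) = norm (\<phi> (t + s) - \<phi> t - s *\<^sub>R D) / norm s" if "s \<noteq> 0" for s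
  proof -
    have "(\<phi> (t + s) - \<phi> t) /\<^sub>R s - D = (\<phi> (t + s) - \<phi> t - s *\<^sub>R D) /\<^sub>R s"
      using that by (simp add: scaleR_right_diff_distrib)
    then show ?thesis by (simp add: divide_inverse_commute)
  qed
  ultimately have "((\<lambda>s. norm (\<phi> (t + s) - \<phi> t - s *\<^sub>R D) / norm s) \<longlongrightarrow> 0) (at 0)"
    by (elim Lim_transform_eventually) (auto simp: eventually_at_filter)
  then show ?thesis
    by (simp add: has_vector_derivative_def has_derivative_at bounded_linear_scaleR_left)
qed

text \<open>Moving the test function rather than \<open>u\<close> lets the derivative in \<open>t\<close> fall on a smooth function.\<close>

lemma moving_test_function_derivative:
  fixes f :: "real ^ 'n::finite \<Rightarrow> real" and u :: "real ^ 'n \<Rightarrow> complex"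
  assumes f: "test_function f" and u: "u \<in> L1_loc"
  shows "((\<lambda>t. LINT x|lborel. f (x - t *\<^sub>R axis k 1) *\<^sub>R u x) has_vector_derivative
           - (LINT x|lborel. pderiv_at k f (x - t *\<^sub>R axis k 1) *\<^sub>R u x)) (at t)"
proof (rule has_vector_derivativeI_quotient)
  define ft where "ft x = f (x - t *\<^sub>R axis k 1)" for x
  have ft_test: "test_function ft"
    using test_function_shift[OF f, of "- t *\<^sub>R axis k 1"] by (simp add: ft_def[abs_def])
  have pd: "pderiv_at k ft x = pderiv_at k f (x - t *\<^sub>R axis k 1)" for x
    using pderiv_at_shift[of k f "- t *\<^sub>R axis k 1"] by (simp add: ft_def[abs_def])
  obtain K where K: "C1_compact_support k K ft" using test_function_supp[OF ft_test] by metis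
  obtain B where B: "\<And>x. \<bar>ft x\<bar> \<le> B" using C1_compact_support_bounded[OF K] by metis
  have int: "integrable lborel (\<lambda>x. ft (x + a) *\<^sub>R u x)" for a
  proof -
    have C: "C1_compact_support k ((\<lambda>x. x - a) ` K) (\<lambda>x. ft (x + a))"
      by (rule C1_compact_support_shift[OF K])
    show ?thesis
      using C1_compact_supportD[OF C] B by (intro L1_loc_integrable[OF u, of "(\<lambda>x. x - a) ` K"]) auto
  qed
  have quot: "(LINT x|lborel. ((ft (x - s *\<^sub>R axis k 1) - ft x) / s) *\<^sub>R u x) =
    ((LINT x|lborel. f (x - (t + s) *\<^sub>R axis k 1) *\<^sub>R u x) - (LINT x|lborel. f (x - t *\<^sub>R axis k 1) *\<^sub>R u x)) /\<^sub>R s" for s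
  proof -
    have "(LINT x|lborel. ((ft (x - s *\<^sub>R axis k 1) - ft x) / s) *\<^sub>R u x) =
       (LINT x|lborel. inverse s *\<^sub>R (ft (x + - s *\<^sub>R axis k 1) *\<^sub>R u x - ft (x + 0) *\<^sub>R u x))"
      by (intro Bochner_Integration.integral_cong refl)
         (simp add: scaleR_left_diff_distrib scaleR_right_diff_distrib divide_inverse algebra_simps)
    also have "\<dots> = inverse s *\<^sub>R ((LINT x|lborel. ft (x + - s *\<^sub>R axis k 1) *\<^sub>R u x) - (LINT x|lborel. ft (x + 0) *\<^sub>R u x))"
      using int by (simp only: integral_scaleR_right Bochner_Integration.integral_diff)
    finally show ?thesis by (simp add: ft_def algebra_simps)
  qed
  show "((\<lambda>s. ((LINT x|lborel. f (x - (t + s) *\<^sub>R axis k 1) *\<^sub>R u x) - (LINT x|lborel. f (x - t *\<^sub>R axis k 1) *\<^sub>R u x)) /\<^sub>R s)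
     \<longlongrightarrow> - (LINT x|lborel. pderiv_at k f (x - t *\<^sub>R axis k 1) *\<^sub>R u x)) (at 0)"
    using difference_quotient_tendsto[OF K u] by (simp add: quot pd)
qed

lemma cis_has_vector_derivative:
  "((\<lambda>t. cis (\<mu> * t)) has_vector_derivative \<i> * \<mu> * cis (\<mu> * t)) (at t)"
  unfolding cis_conv_exp
  by (auto intro!: derivative_eq_intros has_vector_derivative_real_field simp: algebra_simps)

lemma borel_measurable_lborel_pair [simp]:
  "borel_measurable (lborel \<Otimes>\<^sub>M lborel) = borel_measurable (borel \<Otimes>\<^sub>M borel)"
  by (intro measurable_cong_sets sets_pair_measure_cong) auto

text \<open>This is the integrability needed to exchange the integrals over \<open>t\<close> and \<open>x\<close>. The factor \<open>f\<close> will be either a test function or the indicator of a compact set.\<close>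

lemma moving_window_integrable:
  fixes G :: "real ^ 'n::finite \<Rightarrow> complex"
  assumes G: "G \<in> L1_loc" and K: "compact K" and [measurable]: "f \<in> borel_measurable borel"
    and B: "\<And>x. \<bar>f x\<bar> \<le> B" and f0: "\<And>x. x \<notin> K \<Longrightarrow> f x = (0::real)"
  shows "integrable (lborel \<Otimes>\<^sub>M lborel)
    (\<lambda>(t, x). f x *\<^sub>R (indicator {0..h} t *\<^sub>R (cis (\<mu> * t) * G (x + t *\<^sub>R axis k 1))))"
proof (rule integrableI_bounded)
  have [measurable]: "G \<in> borel_measurable borel" using G by (rule L1_loc_measurable)
  have [measurable]: "cis \<in> borel_measurable borel"
    by (intro borel_measurable_continuous_onI continuous_intros)
  have B0: "B \<ge> 0" using B[of 0] by linarith
  show "(\<lambda>(t, x). f x *\<^sub>R (indicator {0..h} t *\<^sub>R (cis (\<mu> * t) * G (x + t *\<^sub>R axis k 1))))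
      \<in> borel_measurable (lborel \<Otimes>\<^sub>M lborel)"
    by (simp add: split_beta')
  define K' where "K' = {x + y |x y. x \<in> K \<and> y \<in> (\<lambda>t. t *\<^sub>R axis k 1) ` {0..h}}"
  have K': "compact K'" unfolding K'_def
    by (intro compact_sums K compact_continuous_image continuous_intros) auto
  then have [measurable]: "K' \<in> sets borel" by (simp add: borel_compact)
  define N :: "real^'n \<Rightarrow> ennreal" where "N x = indicator K' x * ennreal (norm (G x))" for x
  have [measurable]: "N \<in> borel_measurable borel" unfolding N_def by measurable
  have "(\<integral>\<^sup>+p. norm ((\<lambda>(t, x). f x *\<^sub>R (indicator {0..h} t *\<^sub>R (cis (\<mu> * t) * G (x + t *\<^sub>R axis k 1)))) p) \<partial>(lborel \<Otimes>\<^sub>M lborel))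
    = (\<integral>\<^sup>+t. \<integral>\<^sup>+x. norm (f x *\<^sub>R (indicator {0..h} t *\<^sub>R (cis (\<mu> * t) * G (x + t *\<^sub>R axis k 1)))) \<partial>lborel \<partial>lborel)"
    by (rule trans[OF lborel.nn_integral_fst[symmetric]]) (simp_all add: split_beta')
  also have "\<dots> \<le> (\<integral>\<^sup>+t. \<integral>\<^sup>+x. ennreal B * indicator {0..h} t * N (x + t *\<^sub>R axis k 1) \<partial>lborel \<partial>lborel)"
  proof (intro nn_integral_mono)
    fix t x
    show "ennreal (norm (f x *\<^sub>R (indicator {0..h} t *\<^sub>R (cis (\<mu> * t) * G (x + t *\<^sub>R axis k 1))))) \<le>
       ennreal B * indicator {0..h} t * N (x + t *\<^sub>R axis k 1)"
    proof (cases "t \<in> {0..h} \<and> x \<in> K")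
      case True
      then have "x + t *\<^sub>R axis k 1 \<in> K'"
        unfolding K'_def by (intro CollectI exI[of _ x] exI[of _ "t *\<^sub>R axis k 1"]) auto
      then show ?thesis using True B[of x] B0
        by (auto simp: N_def norm_mult ennreal_mult[symmetric] intro!: ennreal_leI mult_right_mono)
    qed (use f0 in \<open>auto split: split_indicator\<close>)
  qed
  also have "\<dots> = (\<integral>\<^sup>+t. ennreal B * indicator {0..h} t * (\<integral>\<^sup>+x. N x \<partial>lborel) \<partial>lborel)"
    by (simp add: nn_integral_cmult nn_integral_lborel_shift[of N])
  also have "\<dots> = ennreal B * emeasure lborel {0..h} * (\<integral>\<^sup>+x. N x \<partial>lborel)"
    by (simp add: nn_integral_multc nn_integral_cmult)
  also have "\<dots> < \<infinity>"
  proof -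
    have "integrable lborel (\<lambda>x. indicator K' x *\<^sub>R G x)" using G K' by (auto simp: L1_loc_def set_integrable_def)
    then have "(\<integral>\<^sup>+x. norm (indicator K' x *\<^sub>R G x) \<partial>lborel) < \<infinity>" by (simp add: integrable_iff_bounded)
    moreover have "ennreal (norm (indicator K' x *\<^sub>R G x)) = N x" for x
      by (auto simp: N_def split: split_indicator)
    ultimately show ?thesis by (auto simp: ennreal_mult_less_top emeasure_lborel_Icc_eq)
  qed
  finally show "(\<integral>\<^sup>+p. norm ((\<lambda>(t, x). f x *\<^sub>R (indicator {0..h} t *\<^sub>R (cis (\<mu> * t) * G (x + t *\<^sub>R axis k 1)))) p) \<partial>(lborel \<Otimes>\<^sub>M lborel)) < \<infinity>" .
qed

lemma L1_loc_shift:
  fixes u :: "real ^ 'n::finite \<Rightarrow> complex"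
  shows "u \<in> L1_loc \<Longrightarrow> (\<lambda>x. u (x + a)) \<in> L1_loc"
  unfolding L1_loc_def
proof safe
  fix K :: "(real^'n) set" assume u: "\<forall>K. compact K \<longrightarrow> set_integrable lborel K u" and "compact K"
  then have "compact ((\<lambda>x. x + a) ` K)" by (intro compact_continuous_image continuous_intros)
  with u have "integrable lborel (\<lambda>x. indicator ((\<lambda>x. x + a) ` K) x *\<^sub>R u x)" by (simp add: set_integrable_def)
  from integrable_lborel_shift[OF this, of a]
  have "integrable lborel (\<lambda>x. indicator ((\<lambda>x. x + a) ` K) (x + a) *\<^sub>R u (x + a))" .
  moreover have "indicator ((\<lambda>x. x + a) ` K) (x + a) = (indicator K x :: real)" for x
    by (auto simp: indicator_def)
  ultimately show "set_integrable lborel K (\<lambda>x. u (x + a))" by (simp add: set_integrable_def)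
qed

lemma L1_loc_add: "u \<in> L1_loc \<Longrightarrow> v \<in> L1_loc \<Longrightarrow> (\<lambda>x. u x + v x) \<in> L1_loc"
  by (auto simp: L1_loc_def intro!: set_integral_add)

lemma L1_loc_diff: "u \<in> L1_loc \<Longrightarrow> v \<in> L1_loc \<Longrightarrow> (\<lambda>x. u x - v x) \<in> L1_loc"
  by (auto simp: L1_loc_def intro!: set_integral_diff)

lemma L1_loc_cmult: "u \<in> L1_loc \<Longrightarrow> (\<lambda>x. c * u x) \<in> L1_loc"
  by (auto simp: L1_loc_def intro!: set_integrable_mult_right)

text \<open>Tested against \<open>f\<close>, the left-hand side becomes the increment over \<open>[0, h]\<close> of
  \<open>t \<mapsto> exp (i \<mu> t) \<integral> f (x - t e\<^sub>k) u x dx\<close>. By the definition of weak derivatives the derivative of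
  this function is \<open>exp (i \<mu> t) \<integral> f (x - t e\<^sub>k) (g x + i \<mu> u x) dx\<close>, and integrating it over \<open>[0, h]\<close>
  yields the right-hand side tested against \<open>f\<close>. The fundamental lemma removes the test function.\<close>

theorem twisted_translation_formula:
  fixes u g :: "real ^ 'n::finite \<Rightarrow> complex"
  assumes ug: "has_weak_pderiv k u g" and h: "h \<ge> 0"
  shows "AE x in lborel. cis (\<mu> * h) * u (x + h *\<^sub>R axis k 1) - u x =
    (LINT t:{0..h}|lborel. cis (\<mu> * t) * (g (x + t *\<^sub>R axis k 1) + \<i> * \<mu> * u (x + t *\<^sub>R axis k 1)))"
proof -
  have u: "u \<in> L1_loc" and g: "g \<in> L1_loc" using ug by (auto simp: has_weak_pderiv_def)
  define G where "G x = g x + \<i> * \<mu> * u x" for x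
  have G: "G \<in> L1_loc" unfolding G_def[abs_def] by (intro L1_loc_add g L1_loc_cmult u)
  note [measurable] = L1_loc_measurable[OF u] L1_loc_measurable[OF g] L1_loc_measurable[OF G]
  define R where "R x = (LINT t:{0..h}|lborel. cis (\<mu> * t) * G (x + t *\<^sub>R axis k 1))" for x
  define W where "W x = (cis (\<mu> * h) * u (x + h *\<^sub>R axis k 1) - u x) - R x" for x
  have R: "R \<in> L1_loc" unfolding L1_loc_def
  proof safe
    fix K :: "(real^'n) set" assume K: "compact K"
    have "integrable (lborel \<Otimes>\<^sub>M lborel)
      (\<lambda>(t, x). indicator K x *\<^sub>R (indicator {0..h} t *\<^sub>R (cis (\<mu> * t) * G (x + t *\<^sub>R axis k 1))))"
      using K by (intro moving_window_integrable[OF G K, of _ 1]) (auto simp: borel_compact intro!: borel_measurable_indicator split: split_indicator)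
    then have "integrable lborel (\<lambda>x. LINT t|lborel. indicator K x *\<^sub>R (indicator {0..h} t *\<^sub>R (cis (\<mu> * t) * G (x + t *\<^sub>R axis k 1))))"
      by (rule lborel_pair.integrable_snd)
    then show "set_integrable lborel K R"
      by (simp add: set_integrable_def R_def[abs_def] set_lebesgue_integral_def del: scaleR_scaleR)
  qed
  have WL: "W \<in> L1_loc" unfolding W_def[abs_def]
    by (intro L1_loc_diff L1_loc_cmult L1_loc_shift u R)
  have "AE x in lborel. W x = 0"
  proof (rule fundamental_lemma[OF WL])
    fix f :: "real^'n \<Rightarrow> real" assume f: "test_function f"
    obtain K where K: "C1_compact_support k K f" using test_function_supp[OF f] by metis
    obtain B where B: "\<And>x. \<bar>f x\<bar> \<le> B" using C1_compact_support_bounded[OF K] by metis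
    note KD = C1_compact_supportD[OF K]
    note [measurable] = KD(6)
    have fint: "integrable lborel (\<lambda>x. f x *\<^sub>R v x)" if "v \<in> L1_loc" for v
      using KD B by (intro L1_loc_integrable[OF that, of K]) auto
    define \<phi> where "\<phi> t = (LINT x|lborel. f (x - t *\<^sub>R axis k 1) *\<^sub>R u x)" for t
    define \<psi> where "\<psi> t = (LINT x|lborel. f x *\<^sub>R (cis (\<mu> * t) * G (x + t *\<^sub>R axis k 1)))" for t
    have shift: "(LINT x|lborel. f (x - t *\<^sub>R axis k 1) *\<^sub>R v x) = (LINT x|lborel. f x *\<^sub>R v (x + t *\<^sub>R axis k 1))"
      if [measurable]: "v \<in> borel_measurable borel" for v :: "real^'n \<Rightarrow> complex" and t
      using integral_lborel_shift[of "\<lambda>x. f (x - t *\<^sub>R axis k 1) *\<^sub>R v x" "t *\<^sub>R axis k 1"] by simp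
    have der: "((\<lambda>t. cis (\<mu> * t) * \<phi> t) has_vector_derivative \<psi> t) (at t)" for t
    proof -
      have 1: "(\<phi> has_vector_derivative (LINT x|lborel. f (x - t *\<^sub>R axis k 1) *\<^sub>R g x)) (at t)"
      proof -
        have "test_function (\<lambda>x. f (x - t *\<^sub>R axis k 1))"
          using test_function_shift[OF f, of "- t *\<^sub>R axis k 1"] by simp
        then have "(LINT x|lborel. pderiv_at k (\<lambda>x. f (x - t *\<^sub>R axis k 1)) x *\<^sub>R u x) =
            - (LINT x|lborel. f (x - t *\<^sub>R axis k 1) *\<^sub>R g x)"
          using ug unfolding has_weak_pderiv_def by blast
        then have "- (LINT x|lborel. pderiv_at k f (x - t *\<^sub>R axis k 1) *\<^sub>R u x) = (LINT x|lborel. f (x - t *\<^sub>R axis k 1) *\<^sub>R g x)"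
          using pderiv_at_shift[of k f "- t *\<^sub>R axis k 1"] by simp
        then show ?thesis using moving_test_function_derivative[OF f u, of k t] by (simp add: \<phi>_def[abs_def])
      qed
      have "\<psi> t = cis (\<mu> * t) * (LINT x|lborel. f x *\<^sub>R G (x + t *\<^sub>R axis k 1))"
        unfolding \<psi>_def by (subst integral_mult_right_zero[symmetric]) (simp add: mult_scaleR_right)
      also have "(LINT x|lborel. f x *\<^sub>R G (x + t *\<^sub>R axis k 1)) =
        (LINT x|lborel. f x *\<^sub>R g (x + t *\<^sub>R axis k 1)) + (LINT x|lborel. \<i> * \<mu> * (f x *\<^sub>R u (x + t *\<^sub>R axis k 1)))"
        using fint[OF L1_loc_shift[OF g]] fint[OF L1_loc_cmult[OF L1_loc_shift[OF u]]]
        by (subst Bochner_Integration.integral_add[symmetric]) (auto simp: G_def scaleR_add_right mult_scaleR_right)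
      also have "\<dots> = (LINT x|lborel. f (x - t *\<^sub>R axis k 1) *\<^sub>R g x) + \<i> * \<mu> * \<phi> t"
        unfolding \<phi>_def by (simp add: shift del: mult_scaleR_right)
      finally show ?thesis using has_vector_derivative_mult[OF cis_has_vector_derivative[of \<mu> t] 1] by (simp add: algebra_simps)
    qed
    have hi1: "(\<psi> has_integral (cis (\<mu> * h) * \<phi> h - cis (\<mu> * 0) * \<phi> 0)) {0..h}"
      by (intro fundamental_theorem_of_calculus h has_vector_derivative_at_within[OF der])
    have prod: "integrable (lborel \<Otimes>\<^sub>M lborel)
      (\<lambda>(t, x). f x *\<^sub>R (indicator {0..h} t *\<^sub>R (cis (\<mu> * t) * G (x + t *\<^sub>R axis k 1))))"
      using KD B by (intro moving_window_integrable[OF G KD(1), of _ B]) auto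
    have \<psi>: "(LINT x|lborel. f x *\<^sub>R (indicator {0..h} t *\<^sub>R (cis (\<mu> * t) * G (x + t *\<^sub>R axis k 1)))) = indicator {0..h} t *\<^sub>R \<psi> t" for t
      unfolding \<psi>_def by (subst integral_scaleR_right[symmetric]) (simp add: mult.commute)
    have "set_integrable lborel {0..h} \<psi>"
      using lborel_pair.integrable_fst[OF prod] by (simp only: \<psi> set_integrable_def)
    from set_borel_integral_eq_integral[OF this]
    have hi2: "(\<psi> has_integral (LINT t:{0..h}|lborel. \<psi> t)) {0..h}" by (metis integrable_integral)
    have "cis (\<mu> * h) * \<phi> h - \<phi> 0 = (LINT t:{0..h}|lborel. \<psi> t)"
      using has_integral_unique[OF hi1 hi2] by simp
    also have "\<dots> = (LINT t|lborel. LINT x|lborel. f x *\<^sub>R (indicator {0..h} t *\<^sub>R (cis (\<mu> * t) * G (x + t *\<^sub>R axis k 1))))"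
      by (simp only: \<psi> set_lebesgue_integral_def)
    also have "\<dots> = (LINT x|lborel. LINT t|lborel. f x *\<^sub>R (indicator {0..h} t *\<^sub>R (cis (\<mu> * t) * G (x + t *\<^sub>R axis k 1))))"
      by (rule lborel_pair.Fubini_integral[OF prod, symmetric])
    also have "\<dots> = (LINT x|lborel. f x *\<^sub>R R x)"
      by (simp add: R_def set_lebesgue_integral_def del: scaleR_scaleR)
    finally have eq: "cis (\<mu> * h) * \<phi> h - \<phi> 0 = (LINT x|lborel. f x *\<^sub>R R x)" .
    have "(LINT x|lborel. f x *\<^sub>R W x) =
       (LINT x|lborel. cis (\<mu> * h) * (f x *\<^sub>R u (x + h *\<^sub>R axis k 1)) - f x *\<^sub>R u x - f x *\<^sub>R R x)"
      by (simp add: W_def scaleR_diff_right)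
    also have "\<dots> = cis (\<mu> * h) * \<phi> h - \<phi> 0 - (LINT x|lborel. f x *\<^sub>R R x)"
      using fint[OF L1_loc_shift[OF u]] fint[OF u] fint[OF R] by (simp add: \<phi>_def shift del: mult_scaleR_right)
    finally show "(LINT x|lborel. f x *\<^sub>R W x) = 0" using eq by simp
  qed
  then show ?thesis by (simp add: W_def R_def G_def)
qed

section \<open>Calculus of weak derivatives\<close>

lemma set_integrable_dominated:
  fixes u :: "'a::euclidean_space \<Rightarrow> 'b::{banach, second_countable_topology}"
  assumes f: "set_integrable lborel A f" and [measurable]: "A \<in> sets borel" "u \<in> borel_measurable borel"
    and le: "\<And>x. norm (u x) \<le> (f x :: real)"
  shows "set_integrable lborel A u"
proof (rule set_integrable_bound[OF f])
  show "set_borel_measurable lborel A u" unfolding set_borel_measurable_def by measurable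
  show "AE x in lborel. x \<in> A \<longrightarrow> norm (u x) \<le> norm (f x)"
    using le by (intro AE_I2 impI) (metis abs_ge_self order_trans real_norm_def)
qed

lemma set_integrable_compact_const:
  fixes K :: "'a::euclidean_space set"
  assumes "compact K"
  shows "set_integrable lborel K (\<lambda>x. c::real)"
  using assms emeasure_bounded_finite[OF compact_imp_bounded[OF assms]] unfolding set_integrable_def
  by (auto intro!: integrable_mult_left integrable_real_indicator borel_compact)

lemma L2_locD:
  assumes "u \<in> L2_loc"
  shows "u \<in> borel_measurable borel" "compact K \<Longrightarrow> set_integrable lborel K (\<lambda>x. (cmod (u x))\<^sup>2)"
  using assms by (simp_all add: L2_loc_def)

lemma L2_loc_finite:
  assumes "u \<in> L2_loc" "compact K"
  shows "(\<integral>\<^sup>+x\<in>K. ennreal ((norm (u x))\<^sup>2) \<partial>lborel) < \<infinity>"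
proof -
  have "(\<integral>\<^sup>+x. norm (indicator K x *\<^sub>R (norm (u x))\<^sup>2) \<partial>lborel) < \<infinity>"
    using L2_locD(2)[OF assms] by (simp add: set_integrable_def integrable_iff_bounded)
  also have "(\<lambda>x. ennreal (norm (indicator K x *\<^sub>R (norm (u x))\<^sup>2))) = (\<lambda>x. ennreal ((norm (u x))\<^sup>2) * indicator K x)"
    by (auto split: split_indicator)
  finally show ?thesis .
qed

lemma L2_loc_imp_L1_loc:
  assumes u: "u \<in> L2_loc"
  shows "u \<in> L1_loc"
  unfolding L1_loc_def
proof safe
  fix K :: "(real^'a) set" assume K: "compact K"
  show "set_integrable lborel K u"
  proof (rule set_integrable_dominated)
    show "set_integrable lborel K (\<lambda>x. 1 + (cmod (u x))\<^sup>2)"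
      by (intro set_integral_add set_integrable_compact_const K L2_locD[OF u])
    fix x
    have "0 \<le> (norm (u x) - 1)\<^sup>2" by simp
    then have "2 * norm (u x) \<le> (norm (u x))\<^sup>2 + 1" by (simp add: power2_diff)
    then show "norm (u x) \<le> 1 + (norm (u x))\<^sup>2" using norm_ge_zero[of "u x"] by linarith
  qed (use L2_locD[OF u] K in \<open>auto intro: borel_compact\<close>)
qed

lemma L2_loc_cong_AE:
  assumes u: "u \<in> L2_loc" and vu: "AE x in lborel. v x = u x" and [measurable]: "v \<in> borel_measurable borel"
  shows "v \<in> L2_loc"
proof -
  have "set_integrable lborel K (\<lambda>x. (cmod (v x))\<^sup>2)" if K: "compact K" for K
  proof -
    have [measurable]: "K \<in> sets borel" using K by (rule borel_compact)
    show ?thesis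
      using L2_locD(2)[OF u K] unfolding set_integrable_def
      by (rule integrable_cong_AE_imp) (use vu in \<open>auto elim!: eventually_mono\<close>)
  qed
  then show ?thesis by (simp add: L2_loc_def)
qed

lemma L2_loc_cmult: "u \<in> L2_loc \<Longrightarrow> (\<lambda>x. c * u x) \<in> L2_loc"
  by (auto simp: L2_loc_def norm_mult power_mult_distrib intro!: set_integrable_mult_right borel_measurable_times)

lemma L2_loc_add:
  assumes u: "u \<in> L2_loc" and v: "v \<in> L2_loc"
  shows "(\<lambda>x. u x + v x) \<in> L2_loc"
proof -
  note [measurable] = L2_locD(1)[OF u] L2_locD(1)[OF v]
  have "set_integrable lborel K (\<lambda>x. (cmod (u x + v x))\<^sup>2)" if K: "compact K" for K
  proof (rule set_integrable_dominated)
    show "set_integrable lborel K (\<lambda>x. 2 * (cmod (u x))\<^sup>2 + 2 * (cmod (v x))\<^sup>2)"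
      by (intro set_integral_add set_integrable_mult_right L2_locD[OF u] L2_locD[OF v] K)
    fix x
    have "(cmod (u x + v x))\<^sup>2 \<le> (cmod (u x) + cmod (v x))\<^sup>2" by (intro power_mono norm_triangle_ineq) simp
    also have "\<dots> \<le> 2 * (cmod (u x))\<^sup>2 + 2 * (cmod (v x))\<^sup>2"
      using zero_le_power2[of "cmod (u x) - cmod (v x)"] by (simp add: power2_sum power2_diff)
    finally show "norm ((cmod (u x + v x))\<^sup>2) \<le> 2 * (cmod (u x))\<^sup>2 + 2 * (cmod (v x))\<^sup>2" by simp
  qed (use K in \<open>auto intro: borel_compact\<close>)
  then show ?thesis by (simp add: L2_loc_def)
qed

lemma test_function_integrable:
  assumes "test_function f" "u \<in> L1_loc"
  shows "integrable lborel (\<lambda>x. f x *\<^sub>R u x)" "integrable lborel (\<lambda>x. pderiv_at k f x *\<^sub>R u x)"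
proof -
  obtain K where K: "C1_compact_support k K f" using test_function_supp[OF assms(1)] by metis
  obtain B where "\<And>x. \<bar>f x\<bar> \<le> B" "\<And>x. \<bar>pderiv_at k f x\<bar> \<le> B" using C1_compact_support_bounded[OF K] by metis
  then show "integrable lborel (\<lambda>x. f x *\<^sub>R u x)" "integrable lborel (\<lambda>x. pderiv_at k f x *\<^sub>R u x)"
    using C1_compact_supportD[OF K] by (auto intro!: L1_loc_integrable[OF assms(2), of K])
qed

lemma has_weak_pderiv_add:
  assumes "has_weak_pderiv k u g" "has_weak_pderiv k v h"
  shows "has_weak_pderiv k (\<lambda>x. u x + v x) (\<lambda>x. g x + h x)"
proof -
  have L: "u \<in> L1_loc" "g \<in> L1_loc" "v \<in> L1_loc" "h \<in> L1_loc"
    using assms by (auto simp: has_weak_pderiv_def)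
  have "(LINT x|lborel. pderiv_at k f x *\<^sub>R (u x + v x)) = - (LINT x|lborel. f x *\<^sub>R (g x + h x))"
    if f: "test_function f" for f
    using assms f test_function_integrable(2)[OF f L(1), of k] test_function_integrable(2)[OF f L(3), of k]
      test_function_integrable(1)[OF f L(2)] test_function_integrable(1)[OF f L(4)]
    by (simp add: scaleR_add_right has_weak_pderiv_def)
  then show ?thesis by (simp add: has_weak_pderiv_def L L1_loc_add)
qed

lemma has_weak_pderiv_cmult:
  assumes "has_weak_pderiv k u g"
  shows "has_weak_pderiv k (\<lambda>x. c * u x) (\<lambda>x. c * g x)"
  unfolding has_weak_pderiv_def
proof (intro conjI allI impI)
  show "(\<lambda>x. c * u x) \<in> L1_loc" "(\<lambda>x. c * g x) \<in> L1_loc"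
    using assms by (auto simp: has_weak_pderiv_def L1_loc_cmult)
  fix f :: "real^'a \<Rightarrow> real" assume f: "test_function f"
  have "(LINT x|lborel. pderiv_at k f x *\<^sub>R (c * u x)) = c * (LINT x|lborel. pderiv_at k f x *\<^sub>R u x)"
    by (subst integral_mult_right_zero[symmetric]) simp
  also have "\<dots> = - (c * (LINT x|lborel. f x *\<^sub>R g x))"
    using assms f by (simp add: has_weak_pderiv_def)
  also have "c * (LINT x|lborel. f x *\<^sub>R g x) = (LINT x|lborel. f x *\<^sub>R (c * g x))"
    by (subst integral_mult_right_zero[symmetric]) simp
  finally show "(LINT x|lborel. pderiv_at k f x *\<^sub>R (c * u x)) = - (LINT x|lborel. f x *\<^sub>R (c * g x))" .
qed

lemma has_weak_pderiv_unique:
  assumes "has_weak_pderiv k u g" "has_weak_pderiv k u h"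
  shows "AE x in lborel. g x = h x"
proof -
  have "(\<lambda>x. g x - h x) \<in> L1_loc" using assms by (auto simp: has_weak_pderiv_def intro: L1_loc_diff)
  moreover have "(LINT x|lborel. f x *\<^sub>R (g x - h x)) = 0" if f: "test_function f" for f
  proof -
    have "(LINT x|lborel. f x *\<^sub>R (g x - h x)) = (LINT x|lborel. f x *\<^sub>R g x) - (LINT x|lborel. f x *\<^sub>R h x)"
      using assms f by (auto simp: has_weak_pderiv_def scaleR_diff_right test_function_integrable)
    also have "\<dots> = 0"
      using assms f unfolding has_weak_pderiv_def by (metis add.inverse_inverse cancel_comm_monoid_add_class.diff_cancel)
    finally show ?thesis .
  qed
  ultimately have "AE x in lborel. g x - h x = 0" by (rule fundamental_lemma)
  then show ?thesis by simp
qed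

lemma has_weak_pderiv_cong_AE:
  assumes g: "has_weak_pderiv k u g" and gh: "AE x in lborel. h x = g x" and [measurable]: "h \<in> borel_measurable borel"
  shows "has_weak_pderiv k u h"
proof -
  have gL: "g \<in> L1_loc" using g by (simp add: has_weak_pderiv_def)
  note [measurable] = L1_loc_measurable[OF gL]
  have "h \<in> L1_loc" unfolding L1_loc_def
  proof safe
    fix K :: "(real^'a) set" assume K: "compact K"
    then have [measurable]: "K \<in> sets borel" by (simp add: borel_compact)
    have "integrable lborel (\<lambda>x. indicator K x *\<^sub>R g x)" using K gL by (auto simp: L1_loc_def set_integrable_def)
    then show "set_integrable lborel K h" unfolding set_integrable_def
      by (rule integrable_cong_AE_imp) (use gh in \<open>auto elim!: eventually_mono\<close>)
  qed
  moreover have "(LINT x|lborel. f x *\<^sub>R h x) = (LINT x|lborel. f x *\<^sub>R g x)" if f: "test_function f" for f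
  proof (rule integral_cong_AE)
    obtain K where "C1_compact_support k K f" using test_function_supp[OF f] by metis
    note [measurable] = C1_compact_supportD(6)[OF this]
    show "(\<lambda>x. f x *\<^sub>R h x) \<in> borel_measurable lborel" "(\<lambda>x. f x *\<^sub>R g x) \<in> borel_measurable lborel" by measurable
    show "AE x in lborel. f x *\<^sub>R h x = f x *\<^sub>R g x" using gh by eventually_elim simp
  qed
  ultimately show ?thesis using g by (simp add: has_weak_pderiv_def)
qed

lemma has_weak_pderiv_shift:
  assumes u: "has_weak_pderiv k u g"
  shows "has_weak_pderiv k (\<lambda>x. u (x + a)) (\<lambda>x. g (x + a))"
  unfolding has_weak_pderiv_def
proof (intro conjI allI impI)
  have L: "u \<in> L1_loc" "g \<in> L1_loc" using u by (auto simp: has_weak_pderiv_def)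
  note [measurable] = L[THEN L1_loc_measurable]
  show "(\<lambda>x. u (x + a)) \<in> L1_loc" "(\<lambda>x. g (x + a)) \<in> L1_loc" by (intro L1_loc_shift L)+
  fix f :: "real^'a \<Rightarrow> real" assume f: "test_function f"
  obtain K where "C1_compact_support k K f" using test_function_supp[OF f] by metis
  note [measurable] = C1_compact_supportD(6,7)[OF this]
  define f' where "f' x = f (x + - a)" for x
  have f': "test_function f'" unfolding f'_def[abs_def] by (rule test_function_shift[OF f])
  have pf': "pderiv_at k f' x = pderiv_at k f (x + - a)" for x
    unfolding f'_def[abs_def] pderiv_at_shift ..
  have "(LINT x|lborel. pderiv_at k f x *\<^sub>R u (x + a)) = (LINT x|lborel. pderiv_at k f' x *\<^sub>R u x)"
    using integral_lborel_shift[of "\<lambda>x. pderiv_at k f (x - a) *\<^sub>R u x" a] by (simp add: pf')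
  also have "\<dots> = - (LINT x|lborel. f' x *\<^sub>R g x)" using u f' by (simp add: has_weak_pderiv_def)
  also have "(LINT x|lborel. f' x *\<^sub>R g x) = (LINT x|lborel. f x *\<^sub>R g (x + a))"
    using integral_lborel_shift[of "\<lambda>x. f (x - a) *\<^sub>R g x" a] by (simp add: f'_def)
  finally show "(LINT x|lborel. pderiv_at k f x *\<^sub>R u (x + a)) = - (LINT x|lborel. f x *\<^sub>R g (x + a))" .
qed

lemma continuous_L2_loc:
  assumes "continuous_on UNIV (u :: real ^ 'n::finite \<Rightarrow> complex)"
  shows "u \<in> L2_loc"
  using assms unfolding L2_loc_def
  by (auto intro!: borel_measurable_continuous_onI borel_integrable_compact[unfolded set_integrable_def[symmetric]] continuous_intros
       intro: continuous_on_subset)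

text \<open>For such \<open>u\<close> the function \<open>t \<mapsto> \<integral> f (x - t e\<^sub>k) u x dx\<close> is a multiple of \<open>cis (\<alpha> t)\<close>. Its
  derivative at 0, computed in two ways, gives the weak derivative.\<close>

lemma has_weak_pderiv_character:
  fixes u :: "real ^ 'n::finite \<Rightarrow> complex"
  assumes u: "u \<in> L1_loc" and char: "\<And>x s. u (x + s *\<^sub>R axis k 1) = cis (\<alpha> * s) * u x"
  shows "has_weak_pderiv k u (\<lambda>x. \<i> * \<alpha> * u x)"
  unfolding has_weak_pderiv_def
proof (intro conjI allI impI u L1_loc_cmult)
  note [measurable] = L1_loc_measurable[OF u]
  fix f :: "real^'n \<Rightarrow> real" assume f: "test_function f"
  obtain K where "C1_compact_support k K f" using test_function_supp[OF f] by metis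
  note [measurable] = C1_compact_supportD(6)[OF this]
  define I where "I = (LINT x|lborel. f x *\<^sub>R u x)"
  have pull: "(LINT x|lborel. f x *\<^sub>R (c * u x)) = c * I" for c
    unfolding I_def by (subst integral_mult_right_zero[symmetric]) simp
  have "(LINT x|lborel. f (x - t *\<^sub>R axis k 1) *\<^sub>R u x) = cis (\<alpha> * t) * I" for t
    using integral_lborel_shift[of "\<lambda>x. f (x - t *\<^sub>R axis k 1) *\<^sub>R u x" "t *\<^sub>R axis k 1"]
    by (simp add: char pull del: mult_scaleR_right)
  then have "((\<lambda>t. cis (\<alpha> * t) * I) has_vector_derivative - (LINT x|lborel. pderiv_at k f x *\<^sub>R u x)) (at 0)"
    using moving_test_function_derivative[OF f u, of k 0] by simp
  moreover have "((\<lambda>t. cis (\<alpha> * t) * I) has_vector_derivative \<i> * \<alpha> * I) (at 0)"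
    using has_vector_derivative_mult_left[OF cis_has_vector_derivative[of \<alpha> 0], of I] by simp
  ultimately have "- (LINT x|lborel. pderiv_at k f x *\<^sub>R u x) = \<i> * \<alpha> * I"
    by (rule vector_derivative_unique_at)
  then show "(LINT x|lborel. pderiv_at k f x *\<^sub>R u x) = - (LINT x|lborel. f x *\<^sub>R (\<i> * \<alpha> * u x))"
    unfolding pull by (metis minus_minus)
qed

section \<open>Periodic functions\<close>

definition lattice_vector :: "real \<Rightarrow> ('n \<Rightarrow> int) \<Rightarrow> real ^ 'n::finite" where
  "lattice_vector T z = (\<Sum>l\<in>UNIV. (T * of_int (z l)) *\<^sub>R axis l 1)"

lemma periodic_multiple:
  fixes u :: "real ^ 'n::finite \<Rightarrow> 'a"
  assumes "\<And>k x. u (x + axis k T) = u x"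
  shows "u (x + (T * of_int n) *\<^sub>R axis k 1) = u x"
proof -
  have nat: "u (x + (T * real n) *\<^sub>R axis k 1) = u x" for n x
  proof (induction n)
    case (Suc n)
    have "x + (T * real (Suc n)) *\<^sub>R axis k 1 = (x + (T * real n) *\<^sub>R axis k 1) + axis k T"
      by (simp add: axis_eq_scaleR[of k T] algebra_simps)
    then show ?case using assms Suc by metis
  qed simp
  show ?thesis
  proof (cases n rule: int_cases2)
    case (nonneg m) then show ?thesis using nat[of x m] by simp
  next
    case (nonpos m) then show ?thesis using nat[of "x + (T * of_int n) *\<^sub>R axis k 1" m] by simp
  qed
qed

lemma periodic_lattice:
  fixes u :: "real ^ 'n::finite \<Rightarrow> 'a"
  assumes "\<And>k x. u (x + axis k T) = u x"
  shows "u (x + lattice_vector T z) = u x"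
proof -
  have S: "u (x + (\<Sum>l\<in>A. (T * of_int (z l)) *\<^sub>R axis l 1)) = u x" if "finite A" for A
    using that
  proof (induction A)
    case (insert a A)
    have eq: "x + (\<Sum>l\<in>insert a A. (T * of_int (z l)) *\<^sub>R axis l 1) =
      (x + (\<Sum>l\<in>A. (T * of_int (z l)) *\<^sub>R axis l 1)) + (T * of_int (z a)) *\<^sub>R axis a 1"
      using insert by (simp add: add_ac)
    show ?case unfolding eq using insert.IH periodic_multiple[of u T _ "z a" a, OF assms] by simp
  qed simp
  show ?thesis unfolding lattice_vector_def by (rule S[OF finite])
qed

text \<open>Reduction modulo the lattice to the half-open cell.\<close>

definition wrap :: "real \<Rightarrow> real ^ 'n::finite \<Rightarrow> real ^ 'n" where
  "wrap T x = x + lattice_vector T (\<lambda>l. - \<lfloor>x $ l / T\<rfloor>)"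

lemma wrap_measurable [measurable]: "(wrap T :: real ^ 'n::finite \<Rightarrow> _) \<in> borel_measurable borel"
proof -
  have [measurable]: "(\<lambda>x::real^'n. x $ l) \<in> borel_measurable borel" for l
    by (intro borel_measurable_continuous_onI continuous_intros)
  show ?thesis unfolding wrap_def[abs_def] lattice_vector_def by measurable
qed

lemma wrap_periodic:
  assumes "T \<noteq> 0" shows "wrap T (x + axis k T) = wrap T x"
proof -
  have "wrap T (x + axis k T) $ l = wrap T x $ l" for l
    using assms by (auto simp: wrap_def lattice_vector_def axis_def sum_component if_distrib sum.delta add_divide_distrib algebra_simps cong: if_cong)
  then show ?thesis by (simp add: vec_eq_iff)
qed

lemma weak_pderiv_properties:
  fixes u :: "real ^ 'n::finite \<Rightarrow> complex"
  assumes "has_weak_pderiv k u g"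
  shows "has_weak_pderiv k u (weak_pderiv k u)" "AE x in lborel. weak_pderiv k u x = g x"
    "weak_pderiv k u \<in> borel_measurable borel"
proof -
  show 1: "has_weak_pderiv k u (weak_pderiv k u)"
    unfolding weak_pderiv_def by (rule someI[of "has_weak_pderiv k u", OF assms])
  show "AE x in lborel. weak_pderiv k u x = g x" by (rule has_weak_pderiv_unique[OF 1 assms])
  show "weak_pderiv k u \<in> borel_measurable borel"
    using 1 by (auto simp: has_weak_pderiv_def intro: L1_loc_measurable)
qed

text \<open>Translating \<open>u\<close> by a period does not change it, so by uniqueness its weak derivative is invariant
  under each of the countably many lattice translations up to a null set. Composition with \<open>wrap\<close> turns
  this into periodicity everywhere, which the integrals over lines below require.\<close>

lemma periodic_representative:
  fixes u :: "real ^ 'n::finite \<Rightarrow> complex"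
  assumes T: "T \<noteq> 0" and per: "periodic T u" and g: "has_weak_pderiv k u g" "g \<in> L2_loc"
  obtains h where "has_weak_pderiv k u h" "h \<in> L2_loc" "periodic T h"
proof -
  define h where "h x = g (wrap T x)" for x
  note [measurable] = L2_locD(1)[OF g(2)]
  have "AE x in lborel. g (x + lattice_vector T z) = g x" for z
  proof (rule has_weak_pderiv_unique[OF _ g(1)])
    have "(\<lambda>x. u (x + lattice_vector T z)) = u"
      using periodic_lattice[of u T _ z] per by (auto simp: periodic_def)
    then show "has_weak_pderiv k u (\<lambda>x. g (x + lattice_vector T z))"
      using has_weak_pderiv_shift[OF g(1), of "lattice_vector T z"] by simp
  qed
  then have "AE x in lborel. \<forall>z. g (x + lattice_vector T z) = g x" by (subst AE_all_countable) blast
  then have hg: "AE x in lborel. h x = g x"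
    by eventually_elim (simp add: h_def wrap_def)
  have [measurable]: "h \<in> borel_measurable borel" unfolding h_def[abs_def] by measurable
  show ?thesis
  proof
    show "has_weak_pderiv k u h" by (rule has_weak_pderiv_cong_AE[OF g(1) hg]) simp
    show "h \<in> L2_loc" by (rule L2_loc_cong_AE[OF g(2) hg]) simp
    show "periodic T h" by (simp add: periodic_def h_def wrap_periodic[OF T])
  qed
qed

text \<open>All estimates are made for representatives of the weak derivatives that are periodic everywhere;
  the arbitrary choice made by \<open>weak_pderiv\<close> agrees with them almost everywhere.\<close>

definition gradient :: "real \<Rightarrow> (real ^ 'n::finite \<Rightarrow> complex) \<Rightarrow> ('n \<Rightarrow> real ^ 'n \<Rightarrow> complex) \<Rightarrow> bool" where
  "gradient T u g \<longleftrightarrow> u \<in> L2_loc \<and> periodic T u \<and>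
     (\<forall>k. has_weak_pderiv k u (g k) \<and> g k \<in> L2_loc \<and> periodic T (g k))"

lemma gradient_imp_H1_per: "gradient T u g \<Longrightarrow> u \<in> H1_per T"
proof -
  assume "gradient T u g"
  then have "u \<in> L2_loc" "periodic T u" "\<And>k. g k \<in> L2_loc \<and> has_weak_pderiv k u (g k)"
    by (simp_all add: gradient_def)
  then show ?thesis unfolding H1_per_def H1_loc_def by blast
qed

lemma H1_per_gradient:
  assumes "T \<noteq> 0" "u \<in> H1_per T"
  obtains g where "gradient T u g"
proof -
  have "\<exists>h. has_weak_pderiv k u h \<and> h \<in> L2_loc \<and> periodic T h" for k
  proof -
    obtain g where "g \<in> L2_loc" "has_weak_pderiv k u g" using assms by (auto simp: H1_per_def H1_loc_def)
    then show ?thesis using periodic_representative[OF assms(1), of u k g] assms(2) by (auto simp: H1_per_def)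
  qed
  then obtain g where "\<And>k. has_weak_pderiv k u (g k) \<and> g k \<in> L2_loc \<and> periodic T (g k)" by metis
  then show ?thesis using that[of g] assms(2) by (auto simp: gradient_def H1_per_def H1_loc_def)
qed

lemma gradient_add_cmult:
  assumes u: "gradient T u g" and v: "gradient T v h"
  shows "gradient T (\<lambda>x. u x + c * v x) (\<lambda>k x. g k x + c * h k x)"
  using assms unfolding gradient_def
  by (auto intro!: L2_loc_add L2_loc_cmult has_weak_pderiv_add has_weak_pderiv_cmult simp: periodic_def)

section \<open>Integrals over lines and cells of periodic functions\<close>

text \<open>The part of the window that sticks out of the period is moved back by one period. The general
  Euclidean space covers both the real line and a coordinate direction of a cell.\<close>

lemma periodic_window_shift:
  fixes P :: "'a::euclidean_space \<Rightarrow> ennreal"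
  assumes [measurable]: "P \<in> borel_measurable borel"
    and per: "\<And>x. P (x + T *\<^sub>R b) = P x" and b: "b \<bullet> b = 1" and s: "0 \<le> s" "s \<le> T"
  shows "(\<integral>\<^sup>+x. P (x + s *\<^sub>R b) * indicator {0..<T} (x \<bullet> b) \<partial>lborel) = (\<integral>\<^sup>+x. P x * indicator {0..<T} (x \<bullet> b) \<partial>lborel)"
proof -
  define J where "J \<alpha> \<beta> = (\<integral>\<^sup>+x. P x * indicator {\<alpha>..<\<beta>} (x \<bullet> b) \<partial>lborel)" for \<alpha> \<beta> :: real
  have add: "J \<alpha> \<gamma> = J \<alpha> \<beta> + J \<beta> \<gamma>" if "\<alpha> \<le> \<beta>" "\<beta> \<le> \<gamma>" for \<alpha> \<beta> \<gamma>
    unfolding J_def using that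
    by (subst nn_integral_add[symmetric]) (auto intro!: nn_integral_cong split: split_indicator)
  have "(\<integral>\<^sup>+x. P (x + s *\<^sub>R b) * indicator {0..<T} (x \<bullet> b) \<partial>lborel) =
      (\<integral>\<^sup>+x. P (x + s *\<^sub>R b) * indicator {s..<T + s} ((x + s *\<^sub>R b) \<bullet> b) \<partial>lborel)"
    by (intro nn_integral_cong) (auto simp: inner_add_left b split: split_indicator)
  also have "\<dots> = J s (T + s)"
    unfolding J_def by (rule nn_integral_lborel_shift[of "\<lambda>x. P x * indicator {s..<T + s} (x \<bullet> b)"]) measurable
  also have "\<dots> = J s T + J T (T + s)" using s by (intro add) auto
  also have "J T (T + s) = (\<integral>\<^sup>+x. P (x + T *\<^sub>R b) * indicator {T..<T + s} ((x + T *\<^sub>R b) \<bullet> b) \<partial>lborel)"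
    unfolding J_def
    by (rule nn_integral_lborel_shift[of "\<lambda>x. P x * indicator {T..<T + s} (x \<bullet> b)", symmetric]) measurable
  also have "\<dots> = J 0 s"
    unfolding J_def by (intro nn_integral_cong) (auto simp: per inner_add_left b split: split_indicator)
  also have "J s T + J 0 s = J 0 T" using add[of 0 s T] s by (simp add: add.commute)
  finally show ?thesis by (simp add: J_def)
qed

lemma AE_lborel_inner_neq: "b \<noteq> 0 \<Longrightarrow> AE x in lborel. x \<bullet> b \<noteq> (c::real)"
proof -
  assume "b \<noteq> 0"
  then have "negligible {x. b \<bullet> x = c}" by (intro negligible_hyperplane) simp
  then have "{x. b \<bullet> x = c} \<in> null_sets lborel"
    by (simp add: null_sets_completion_iff negligible_iff_null_sets closed_hyperplane borel_closed)
  then show ?thesis by (auto intro!: AE_I'[of "{x. b \<bullet> x = c}"] simp: inner_commute)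
qed

definition per_fun :: "real \<Rightarrow> (real ^ 'n::finite \<Rightarrow> ennreal) \<Rightarrow> bool" where
  "per_fun T F \<longleftrightarrow> F \<in> borel_measurable borel \<and> (\<forall>k x. F (x + axis k T) = F x)"

lemma per_funD: "per_fun T F \<Longrightarrow> F \<in> borel_measurable borel" "per_fun T F \<Longrightarrow> F (x + axis k T) = F x"
  by (auto simp: per_fun_def)

lemma per_fun_mod:
  assumes F: "per_fun T F" and T: "T > 0"
  obtains r where "0 \<le> r" "r \<le> T" "\<And>x. F (x + s *\<^sub>R axis k 1) = F (x + r *\<^sub>R axis k 1)"
proof
  define n where "n = \<lfloor>s / T\<rfloor>"
  have n: "of_int n \<le> s / T" "s / T < of_int n + 1" unfolding n_def by linarith+
  show "0 \<le> s - T * of_int n" "s - T * of_int n \<le> T"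
    using n T by (simp_all add: field_simps)
  show "F (x + s *\<^sub>R axis k 1) = F (x + (s - T * of_int n) *\<^sub>R axis k 1)" for x
    using periodic_multiple[of F T "x + (s - T * of_int n) *\<^sub>R axis k 1" n k] per_funD(2)[OF F]
    by (simp add: algebra_simps)
qed

lemma cell_sets [measurable]: "cell T \<in> sets borel"
  by (simp add: cell_def)

lemma compact_cell: "compact (cell T)"
  by (simp add: cell_def)

abbreviation cell_int :: "real \<Rightarrow> (real ^ 'n::finite \<Rightarrow> ennreal) \<Rightarrow> ennreal" where
  "cell_int T F \<equiv> \<integral>\<^sup>+x\<in>cell T. F x \<partial>lborel"

lemma nn_integral_cell_shift:
  fixes F :: "real ^ 'n::finite \<Rightarrow> ennreal"
  assumes F: "per_fun T F" and T: "T > 0"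
  shows "cell_int T (\<lambda>x. F (x + s *\<^sub>R axis k 1)) = cell_int T F"
proof -
  obtain r where r: "0 \<le> r" "r \<le> T" "\<And>x. F (x + s *\<^sub>R axis k 1) = F (x + r *\<^sub>R axis k 1)"
    using per_fun_mod[OF F T] by metis
  note [measurable] = per_funD(1)[OF F]
  define Q where "Q = (\<Inter>l\<in>- {k}. {x::real^'n. 0 \<le> x $ l} \<inter> {x. x $ l \<le> T})"
  have [measurable]: "Q \<in> sets borel" unfolding Q_def
    by (intro borel_closed closed_INT ballI closed_Int closed_Collect_le continuous_intros)
  have Qshift: "x + a *\<^sub>R axis k 1 \<in> Q \<longleftrightarrow> x \<in> Q" for x a
    by (auto simp: Q_def axis_def)
  have inner_neq: "AE x::real^'n in lborel. x \<bullet> axis k 1 \<noteq> T"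
    by (rule AE_lborel_inner_neq) (simp add: axis_eq_0_iff)
  have cell: "AE x in lborel. indicator (cell T) x = (indicator Q x * indicator {0..<T} (x \<bullet> axis k 1) :: ennreal)"
    using inner_neq
  proof eventually_elim
    case (elim x)
    then have "x $ k \<noteq> T" by (simp add: inner_axis)
    have "x \<in> cell T \<longleftrightarrow> (\<forall>l. 0 \<le> x $ l \<and> x $ l \<le> T)" by (simp add: cell_def mem_box_cart)
    also have "\<dots> \<longleftrightarrow> x \<in> Q \<and> 0 \<le> x $ k \<and> x $ k \<le> T" by (auto simp: Q_def)
    finally show ?case using \<open>x $ k \<noteq> T\<close> by (auto simp: inner_axis split: split_indicator)
  qed
  have "cell_int T (\<lambda>x. F (x + r *\<^sub>R axis k 1)) =
     (\<integral>\<^sup>+x. (F (x + r *\<^sub>R axis k 1) * indicator Q (x + r *\<^sub>R axis k 1)) * indicator {0..<T} (x \<bullet> axis k 1) \<partial>lborel)"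
    by (rule nn_integral_cong_AE, use cell in eventually_elim) (auto simp: Qshift indicator_def)
  also have "\<dots> = (\<integral>\<^sup>+x. (F x * indicator Q x) * indicator {0..<T} (x \<bullet> axis k 1) \<partial>lborel)"
  proof (rule periodic_window_shift[of "\<lambda>x. F x * indicator Q x"])
    show "F (x + T *\<^sub>R axis k 1) * indicator Q (x + T *\<^sub>R axis k 1) = F x * indicator Q x" for x
      using per_funD(2)[OF F, of x k] by (simp add: axis_eq_scaleR[of k T] Qshift indicator_def)
  qed (use r in \<open>auto simp: inner_axis_axis\<close>)
  also have "\<dots> = cell_int T F"
    by (rule nn_integral_cong_AE, use cell in eventually_elim) (auto simp: mult.assoc)
  finally show ?thesis by (simp add: r(3))
qed

text \<open>Integrating over translates instead of over a coordinate keeps every function on the same space.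
  For periodic \<open>F\<close> the result is invariant in the direction \<open>k\<close>, and this invariance takes the place of
  slicing the cell into coordinate subspaces.\<close>

definition line_int :: "real \<Rightarrow> 'n \<Rightarrow> (real ^ 'n::finite \<Rightarrow> ennreal) \<Rightarrow> real ^ 'n \<Rightarrow> ennreal" where
  "line_int T k F x = (\<integral>\<^sup>+t\<in>{0..T}. F (x + t *\<^sub>R axis k 1) \<partial>lborel)"

lemma line_int_measurable [measurable]:
  assumes [measurable]: "F \<in> borel_measurable borel"
  shows "line_int T k F \<in> borel_measurable borel"
  unfolding line_int_def[abs_def] by measurable

lemma line_int_invariant:
  fixes F :: "real ^ 'n::finite \<Rightarrow> ennreal"
  assumes F: "per_fun T F" and T: "T > 0"
  shows "line_int T k F (x + s *\<^sub>R axis k 1) = line_int T k F x"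
proof -
  obtain r where r: "0 \<le> r" "r \<le> T" "\<And>x. F (x + s *\<^sub>R axis k 1) = F (x + r *\<^sub>R axis k 1)"
    using per_fun_mod[OF F T] by metis
  note [measurable] = per_funD(1)[OF F]
  define P where "P t = F (x + t *\<^sub>R axis k 1)" for t
  have [measurable]: "P \<in> borel_measurable borel" unfolding P_def by measurable
  have shift: "F (x + s *\<^sub>R axis k 1 + t *\<^sub>R axis k 1) = P (t + r)" for t
    using r(3)[of "x + t *\<^sub>R axis k 1"] by (simp add: P_def algebra_simps)
  have nn: "(\<integral>\<^sup>+t\<in>{0..T}. H t \<partial>lborel) = (\<integral>\<^sup>+t. H t * indicator {0..<T} (t \<bullet> 1) \<partial>lborel)" for H :: "real \<Rightarrow> ennreal"
    by (rule nn_integral_cong_AE, use AE_lborel_singleton[of T] in eventually_elim) (auto split: split_indicator)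
  have "line_int T k F (x + s *\<^sub>R axis k 1) = (\<integral>\<^sup>+t. P (t + r *\<^sub>R 1) * indicator {0..<T} (t \<bullet> 1) \<partial>lborel)"
    unfolding line_int_def nn shift by simp
  also have "\<dots> = (\<integral>\<^sup>+t. P t * indicator {0..<T} (t \<bullet> 1) \<partial>lborel)"
  proof (rule periodic_window_shift)
    show "P (t + T *\<^sub>R 1) = P t" for t
      using per_funD(2)[OF F, of "x + t *\<^sub>R axis k 1" k]
      by (simp add: P_def axis_eq_scaleR[of k T] algebra_simps)
  qed (use r in auto)
  also have "\<dots> = line_int T k F x" unfolding line_int_def nn P_def ..
  finally show ?thesis .
qed

lemma per_fun_line_int: "per_fun T F \<Longrightarrow> per_fun T (line_int T k F)"
proof -
  assume F: "per_fun T F"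
  have "F (x + axis l T + t *\<^sub>R axis k 1) = F (x + t *\<^sub>R axis k 1)" for l x t
    using per_funD(2)[OF F, of "x + t *\<^sub>R axis k 1" l] by (simp add: add_ac)
  then show ?thesis using per_funD(1)[OF F] by (auto simp: per_fun_def line_int_def)
qed

lemma nn_integral_cell_line_int:
  fixes F :: "real ^ 'n::finite \<Rightarrow> ennreal"
  assumes F: "per_fun T F" and T: "T > 0"
  shows "cell_int T (\<lambda>x. line_int T k F x) = ennreal T * cell_int T F"
proof -
  note [measurable] = per_funD(1)[OF F]
  have "cell_int T (\<lambda>x. line_int T k F x) =
     (\<integral>\<^sup>+x. \<integral>\<^sup>+t. F (x + t *\<^sub>R axis k 1) * indicator {0..T} t * indicator (cell T) x \<partial>lborel \<partial>lborel)"
    by (simp add: line_int_def nn_integral_multc)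
  also have "\<dots> = (\<integral>\<^sup>+t. \<integral>\<^sup>+x. F (x + t *\<^sub>R axis k 1) * indicator {0..T} t * indicator (cell T) x \<partial>lborel \<partial>lborel)"
    by (rule lborel_pair.Fubini'[symmetric]) simp
  also have "\<dots> = (\<integral>\<^sup>+t. cell_int T (\<lambda>x. F (x + t *\<^sub>R axis k 1)) * indicator {0..T} t \<partial>lborel)"
    by (intro nn_integral_cong, subst nn_integral_multc[symmetric]) (auto simp: mult_ac)
  also have "\<dots> = cell_int T F * emeasure lborel {0..T}"
    by (simp add: nn_integral_cell_shift[OF F T] nn_integral_cmult)
  finally show ?thesis using T by (simp add: mult.commute)
qed

lemma line_int_mult_invariant:
  assumes [measurable]: "F \<in> borel_measurable borel" and G: "\<And>x s. G (x + s *\<^sub>R axis k 1) = G x"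
  shows "line_int T k (\<lambda>x. G x * F x) x = G x * line_int T k F x"
  unfolding line_int_def G by (simp add: nn_integral_cmult mult.assoc)

lemma line_int_invariant_other:
  assumes "\<And>x s. F (x + s *\<^sub>R axis k 1) = F x"
  shows "line_int T j F (x + s *\<^sub>R axis k 1) = line_int T j F x"
proof -
  have "F (x + s *\<^sub>R axis k 1 + t *\<^sub>R axis j 1) = F (x + t *\<^sub>R axis j 1)" for t
    using assms[of "x + t *\<^sub>R axis j 1" s] by (simp add: add_ac)
  then show ?thesis by (simp add: line_int_def)
qed

lemma line_int_commute:
  assumes [measurable]: "F \<in> borel_measurable borel"
  shows "line_int T j (line_int T k F) = line_int T k (line_int T j F)"
proof
  fix x
  have "line_int T j (line_int T k F) x = (\<integral>\<^sup>+t. \<integral>\<^sup>+s. F (x + t *\<^sub>R axis j 1 + s *\<^sub>R axis k 1) * indicator {0..T} s * indicator {0..T} t \<partial>lborel \<partial>lborel)"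
    by (simp add: line_int_def nn_integral_multc)
  also have "\<dots> = (\<integral>\<^sup>+s. \<integral>\<^sup>+t. F (x + t *\<^sub>R axis j 1 + s *\<^sub>R axis k 1) * indicator {0..T} s * indicator {0..T} t \<partial>lborel \<partial>lborel)"
    by (rule lborel_pair.Fubini'[symmetric]) simp
  also have "\<dots> = (\<integral>\<^sup>+s. (\<integral>\<^sup>+t. F (x + s *\<^sub>R axis k 1 + t *\<^sub>R axis j 1) * indicator {0..T} t \<partial>lborel) * indicator {0..T} s \<partial>lborel)"
    by (intro nn_integral_cong, subst nn_integral_multc[symmetric]) (auto simp: mult_ac add_ac)
  also have "\<dots> = line_int T k (line_int T j F) x" by (simp add: line_int_def)
  finally show "line_int T j (line_int T k F) x = line_int T k (line_int T j F) x" .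
qed

text \<open>Tonelli, applied to the indicator of a null set that contains the exceptional points.\<close>

lemma AE_lborel_lines:
  assumes "AE x in lborel. P (x :: real ^ 'n::finite)"
  shows "AE x in lborel. AE t in lborel. P (x + t *\<^sub>R axis k 1)"
proof -
  from assms obtain N where N: "N \<in> null_sets lborel" "{x. \<not> P x} \<subseteq> N"
    by (auto simp: eventually_ae_filter)
  then have [measurable]: "N \<in> sets borel" by auto
  have "(\<integral>\<^sup>+x. \<integral>\<^sup>+t. indicator N (x + t *\<^sub>R axis k 1) \<partial>lborel \<partial>lborel) =
     (\<integral>\<^sup>+t. \<integral>\<^sup>+x. indicator N (x + t *\<^sub>R axis k 1) \<partial>lborel \<partial>(lborel::real measure))"
    by (rule lborel_pair.Fubini'[symmetric]) simp
  also have "\<dots> = (\<integral>\<^sup>+t. \<integral>\<^sup>+x. indicator N x \<partial>lborel \<partial>(lborel::real measure))"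
    by (subst nn_integral_lborel_shift) auto
  also have "\<dots> = 0" using N by (simp add: null_setsD1)
  finally have "AE x in lborel. (\<integral>\<^sup>+t. indicator N (x + t *\<^sub>R axis k 1) \<partial>lborel) = 0"
    by (subst (asm) nn_integral_0_iff_AE) auto
  then show ?thesis
  proof eventually_elim
    case (elim x)
    then have "AE t in lborel. indicator N (x + t *\<^sub>R axis k 1) = (0::ennreal)"
      by (subst (asm) nn_integral_0_iff_AE) auto
    then show ?case using N(2) by (auto elim!: eventually_mono split: split_indicator_asm)
  qed
qed

lemma line_int_mono_AE:
  assumes "AE x in lborel. F x \<le> G x"
  shows "AE x in lborel. line_int T k F x \<le> line_int T k G x"
  using AE_lborel_lines[OF assms, of k]
  unfolding line_int_def by eventually_elim (auto intro!: nn_integral_mono_AE elim!: eventually_mono mult_right_mono)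

lemma nn_integral_cell_const: "T > 0 \<Longrightarrow> (\<integral>\<^sup>+x\<in>(cell T :: (real^'n::finite) set). c \<partial>lborel) = c * ennreal (T ^ CARD('n))"
proof -
  assume T: "T > 0"
  have "emeasure lborel (cell T :: (real^'n) set) = ennreal (T ^ CARD('n))"
  proof -
    have "emeasure lborel (cell T :: (real^'n) set) = ennreal (\<Prod>b\<in>(Basis::(real^'n) set). ((\<chi> k. T) - 0) \<bullet> b)"
      using T unfolding cell_def
      by (subst emeasure_lborel_cbox_eq) (auto simp: Basis_vec_def inner_axis)
    also have "(\<Prod>b\<in>(Basis::(real^'n) set). ((\<chi> k. T) - 0) \<bullet> b) = (\<Prod>b\<in>(Basis::(real^'n) set). T)"
      by (intro prod.cong) (auto simp: Basis_vec_def inner_axis)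
    finally show ?thesis by simp
  qed
  then show ?thesis by (simp add: nn_integral_cmult_indicator)
qed

section \<open>The spectral inequality\<close>

lemma sum_cis_orthogonal:
  assumes "j < n" "l < n"
  shows "(\<Sum>m<n. cis (2 * pi * real m * (real l - real j) / real n)) = (if j = l then of_nat n else 0)"
proof (cases "j = l")
  case False
  define w where "w = cis (2 * pi * (real l - real j) / real n)"
  have "w \<noteq> 1"
  proof
    assume "w = 1"
    then have "cos (2 * pi * (real l - real j) / real n) = 1" by (simp add: w_def complex_eq_iff)
    then obtain p :: int where "2 * pi * (real l - real j) / real n = of_int p * 2 * pi"
      by (auto simp: cos_one_2pi_int)
    then have "(2 * pi) * (real l - real j) = (2 * pi) * (of_int p * real n)"
      using assms by (simp add: field_simps)
    then have "real l - real j = of_int p * real n" by (subst (asm) mult_cancel_left) simp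
    then have p: "int l - int j = p * int n"
      by (metis of_int_diff of_int_eq_iff of_int_mult of_int_of_nat_eq)
    moreover have "p \<noteq> 0" using p False by auto
    then have "\<bar>p\<bar> * int n \<ge> int n" using assms by (simp add: mult_le_cancel_right1)
    moreover have "\<bar>int l - int j\<bar> < int n" using assms by linarith
    ultimately show False by (simp add: abs_mult)
  qed
  have "w ^ n = cis (real n * (2 * pi * (real l - real j) / real n))"
    unfolding w_def by (rule Complex.DeMoivre)
  also have "real n * (2 * pi * (real l - real j) / real n) = 2 * pi * of_int (int l - int j)"
    using assms by simp
  also have "cis \<dots> = 1" by (rule cis_multiple_2pi) simp
  finally have "(\<Sum>m<n. w ^ m) = 0" using geometric_sum[OF \<open>w \<noteq> 1\<close>, of n] by simp
  moreover have "w ^ m = cis (2 * pi * real m * (real l - real j) / real n)" for m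
    unfolding w_def Complex.DeMoivre by (rule arg_cong[where f=cis]) (simp add: mult_ac)
  ultimately show ?thesis using False by simp
qed simp

lemma discrete_parseval:
  fixes b :: "nat \<Rightarrow> complex"
  shows "(\<Sum>m<n. (cmod (\<Sum>j<n. b j * cis (- (2 * pi * real m * real j / real n))))\<^sup>2) = real n * (\<Sum>j<n. (cmod (b j))\<^sup>2)"
proof -
  have "complex_of_real (\<Sum>m<n. (cmod (\<Sum>j<n. b j * cis (- (2 * pi * real m * real j / real n))))\<^sup>2)
    = (\<Sum>m<n. \<Sum>j<n. \<Sum>l<n. b j * cnj (b l) * cis (2 * pi * real m * (real l - real j) / real n))"
  proof -
    have cis: "cis (2 * pi * real m * (real l - real j) / real n) =
        cis (- (2 * pi * real m * real j / real n)) * cis (2 * pi * real m * real l / real n)" for m j l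
      unfolding cis_mult by (rule arg_cong[where f=cis]) (simp add: diff_divide_distrib right_diff_distrib)
    show ?thesis
      unfolding of_real_sum complex_norm_square cnj_sum sum_product
      by (intro sum.cong refl) (simp add: cis cis_cnj)
  qed
  also have "\<dots> = (\<Sum>j<n. \<Sum>l<n. b j * cnj (b l) * (\<Sum>m<n. cis (2 * pi * real m * (real l - real j) / real n)))"
    unfolding sum_distrib_left by (rule trans[OF sum.swap], rule sum.cong[OF refl], rule sum.swap)
  also have "\<dots> = (\<Sum>j<n. \<Sum>l<n. if j = l then of_nat n * (b j * cnj (b j)) else 0)"
    by (intro sum.cong refl) (simp add: sum_cis_orthogonal)
  also have "\<dots> = complex_of_real (real n * (\<Sum>j<n. (cmod (b j))\<^sup>2))"
    by (simp add: sum.delta sum_distrib_left del: of_real_power flip: complex_norm_square)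
  finally show ?thesis by (simp only: of_real_eq_iff)
qed

text \<open>The discrete Fourier transform diagonalises the shift: it multiplies the \<open>m\<close>-th coefficient of \<open>b\<close>
  by \<open>z cis (2 \<pi> m / n) - 1\<close>.\<close>

lemma discrete_spectral_inequality:
  fixes b :: "nat \<Rightarrow> complex"
  assumes n: "n > 0" and per: "b n = b 0" and \<delta>: "\<delta> \<ge> 0" "\<And>m. m < n \<Longrightarrow> \<delta> \<le> cmod (z * cis (2 * pi * real m / real n) - 1)"
  shows "\<delta>\<^sup>2 * (\<Sum>j<n. (cmod (b j))\<^sup>2) \<le> (\<Sum>j<n. (cmod (z * b (Suc j) - b j))\<^sup>2)"
proof -
  define e where "e m j = cis (- (2 * pi * real m * real j / real n))" for m j :: nat
  define B where "B m = (\<Sum>j<n. b j * e m j)" for m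
  have e_Suc: "e m j = cis (2 * pi * real m / real n) * e m (Suc j)" for m j
  proof -
    have "2 * pi * real m / real n + - (2 * pi * real m * real (Suc j) / real n) = - (2 * pi * real m * real j / real n)"
      using n by (simp add: field_simps)
    then show ?thesis unfolding e_def cis_mult by (simp only:)
  qed
  have shift: "(\<Sum>j<n. (z * b (Suc j) - b j) * e m j) = (z * cis (2 * pi * real m / real n) - 1) * B m" for m
  proof -
    have "e m n = 1"
    proof -
      have "- (2 * pi * real m * real n / real n) = 2 * pi * of_int (- int m)" using n by simp
      then show ?thesis unfolding e_def by (metis cis_multiple_2pi Ints_of_int)
    qed
    moreover have "e m 0 = 1" by (simp add: e_def)
    ultimately have "(\<Sum>j<n. b (Suc j) * e m (Suc j)) = B m"
      using sum.lessThan_Suc_shift[of "\<lambda>j. b j * e m j" n] sum.lessThan_Suc[of "\<lambda>j. b j * e m j" n]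
      by (simp add: B_def per)
    moreover have "(\<Sum>j<n. (z * b (Suc j) - b j) * e m j) =
        z * cis (2 * pi * real m / real n) * (\<Sum>j<n. b (Suc j) * e m (Suc j)) - B m"
      unfolding B_def sum_distrib_left sum_subtractf[symmetric]
    proof (intro sum.cong refl)
      fix j
      show "(z * b (Suc j) - b j) * e m j =
          z * cis (2 * pi * real m / real n) * (b (Suc j) * e m (Suc j)) - b j * e m j"
        unfolding e_Suc[of m j] by (simp add: algebra_simps)
    qed
    ultimately show ?thesis by (simp add: algebra_simps)
  qed
  have "real n * (\<delta>\<^sup>2 * (\<Sum>j<n. (cmod (b j))\<^sup>2)) = (\<Sum>m<n. \<delta>\<^sup>2 * (cmod (B m))\<^sup>2)"
    using discrete_parseval[where b=b and n=n] by (simp add: B_def e_def sum_distrib_left[symmetric])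
  also have "\<dots> \<le> (\<Sum>m<n. (cmod (\<Sum>j<n. (z * b (Suc j) - b j) * e m j))\<^sup>2)"
    unfolding shift norm_mult power_mult_distrib
    by (intro sum_mono mult_right_mono power_mono \<delta>) auto
  also have "\<dots> = real n * (\<Sum>j<n. (cmod (z * b (Suc j) - b j))\<^sup>2)"
    unfolding e_def by (rule discrete_parseval)
  finally show ?thesis using n by simp
qed

lemma cmod_cis_minus_1: "cmod (cis \<alpha> - 1) = 2 * \<bar>sin (\<alpha> / 2)\<bar>"
proof -
  have "(cmod (cis \<alpha> - 1))\<^sup>2 = (cos \<alpha> - 1)\<^sup>2 + (sin \<alpha>)\<^sup>2" by (simp add: cmod_power2)
  also have "\<dots> = 2 - 2 * cos (2 * (\<alpha> / 2))"
    using sin_cos_squared_add[of \<alpha>] by (simp add: power2_eq_square algebra_simps)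
  also have "\<dots> = (2 * \<bar>sin (\<alpha> / 2)\<bar>)\<^sup>2" unfolding cos_double_sin by (simp add: power_mult_distrib)
  finally show ?thesis by (rule power2_eq_imp_eq) auto
qed

text \<open>The chord from 1 to \<open>cis \<alpha>\<close> has the length \<open>2 sin (\<delta> / 2)\<close>, where \<open>\<delta> \<le> \<pi>\<close> is the distance of \<open>\<alpha>\<close>
  from the nearest multiple of \<open>2 \<pi>\<close>; on this range the sine is monotone.\<close>

lemma cmod_cis_minus_1_ge:
  assumes d: "d \<ge> 0" "\<And>p::int. d \<le> \<bar>\<alpha> - 2 * pi * p\<bar>"
  shows "2 * sin (d / 2) \<le> cmod (cis \<alpha> - 1)"
proof -
  define p where "p = round (\<alpha> / (2 * pi))"
  define \<beta> where "\<beta> = \<bar>\<alpha> - 2 * pi * p\<bar> / 2"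
  have "\<bar>of_int p - \<alpha> / (2 * pi)\<bar> \<le> 1 / 2" unfolding p_def by (rule of_int_round_abs_le)
  then have "\<bar>\<alpha> - 2 * pi * p\<bar> \<le> pi" by (simp add: field_simps abs_le_iff)
  then have \<beta>: "\<beta> \<le> pi / 2" "d / 2 \<le> \<beta>" using d(2)[of p] by (simp_all add: \<beta>_def)
  have "2 * sin (d / 2) \<le> 2 * sin \<beta>"
    using \<beta> d(1) by (intro mult_left_mono sin_monotone_2pi_le) (auto simp: pi_ge_zero intro: order_trans[of "- (pi / 2)" 0])
  also have "sin \<beta> = \<bar>sin ((\<alpha> - 2 * pi * p) / 2)\<bar>"
  proof -
    have "\<beta> = (\<alpha> - 2 * pi * p) / 2 \<or> \<beta> = - ((\<alpha> - 2 * pi * p) / 2)" unfolding \<beta>_def by linarith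
    then have "\<bar>sin \<beta>\<bar> = \<bar>sin ((\<alpha> - 2 * pi * p) / 2)\<bar>" by (metis abs_minus sin_minus)
    moreover have "sin \<beta> \<ge> 0" using \<beta> d(1) pi_ge_zero by (intro sin_ge_zero) auto
    ultimately show ?thesis by simp
  qed
  also have "2 * \<bar>sin ((\<alpha> - 2 * pi * p) / 2)\<bar> = cmod (cis (\<alpha> - 2 * pi * p) - 1)" by (rule cmod_cis_minus_1[symmetric])
  also have "cis (\<alpha> - 2 * pi * p) = cis \<alpha>"
    by (simp add: cis_divide[symmetric] cis_multiple_2pi)
  finally show ?thesis .
qed

lemma set_integral_norm_square_le:
  fixes f :: "real \<Rightarrow> complex"
  assumes [measurable]: "f \<in> borel_measurable borel" and h: "h \<ge> 0"
  shows "ennreal ((norm (LINT t:{0..h}|lborel. f t))\<^sup>2) \<le> ennreal h * (\<integral>\<^sup>+t\<in>{0..h}. ennreal ((norm (f t))\<^sup>2) \<partial>lborel)"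
proof -
  have "ennreal (norm (LINT t:{0..h}|lborel. f t)) \<le> (\<integral>\<^sup>+t. norm (indicator {0..h} t *\<^sub>R f t) \<partial>lborel)"
  proof (cases "set_integrable lborel {0..h} f")
    case True
    then show ?thesis unfolding set_lebesgue_integral_def set_integrable_def
      by (rule integral_norm_bound_ennreal)
  qed (simp add: set_lebesgue_integral_def set_integrable_def not_integrable_integral_eq)
  also have "\<dots> = (\<integral>\<^sup>+t. indicator {0..h} t * (ennreal (norm (f t)) * indicator {0..h} t) \<partial>lborel)"
    by (intro nn_integral_cong) (auto split: split_indicator)
  finally have "(ennreal (norm (LINT t:{0..h}|lborel. f t)))\<^sup>2 \<le>
      (\<integral>\<^sup>+t. indicator {0..h} t * (ennreal (norm (f t)) * indicator {0..h} t) \<partial>lborel)\<^sup>2"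
    by (rule power_mono) simp
  also have "\<dots> \<le> (\<integral>\<^sup>+t. (indicator {0..h} t)\<^sup>2 \<partial>lborel) * (\<integral>\<^sup>+t. (ennreal (norm (f t)) * indicator {0..h} t)\<^sup>2 \<partial>lborel)"
    by (rule Cauchy_Schwarz_nn_integral) measurable
  also have "(\<integral>\<^sup>+t. (indicator {0..h} t)\<^sup>2 \<partial>lborel) = (\<integral>\<^sup>+t. indicator {0..h} t \<partial>lborel)"
    by (intro nn_integral_cong) (auto split: split_indicator)
  also have "\<dots> = ennreal h" using h by simp
  also have "(\<integral>\<^sup>+t. (ennreal (norm (f t)) * indicator {0..h} t)\<^sup>2 \<partial>lborel) = (\<integral>\<^sup>+t\<in>{0..h}. ennreal ((norm (f t))\<^sup>2) \<partial>lborel)"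
    by (intro nn_integral_cong) (auto simp: ennreal_power split: split_indicator)
  finally show ?thesis by (simp add: ennreal_power)
qed

lemma gradientD:
  assumes "gradient T u g"
  shows "u \<in> L2_loc" "g k \<in> L2_loc" "has_weak_pderiv k u (g k)"
    "u \<in> borel_measurable borel" "g k \<in> borel_measurable borel"
    "u (x + axis l T) = u x" "g k (x + axis l T) = g k x"
  using assms by (auto simp: gradient_def periodic_def L2_loc_def)

lemma per_fun_norm_square:
  assumes "u \<in> borel_measurable borel" "\<And>x k. u (x + axis k T) = u x"
  shows "per_fun T (\<lambda>x. ennreal ((norm (u x))\<^sup>2))"
  using assms by (auto simp: per_fun_def)

text \<open>Cauchy--Schwarz in the translation formula, followed by the invariance under translations of the
  integral of a periodic function over a cell.\<close>

lemma twisted_increment_bound: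
  fixes u :: "real ^ 'n::finite \<Rightarrow> complex"
  assumes g: "gradient T u g" and T: "T > 0" and h: "h \<ge> 0"
  shows "cell_int T (\<lambda>x. ennreal ((norm (cis (\<mu> * h) * u (x + h *\<^sub>R axis k 1) - u x))\<^sup>2))
    \<le> ennreal (h\<^sup>2) * cell_int T (\<lambda>x. ennreal ((norm (g k x + \<i> * \<mu> * u x))\<^sup>2))"
proof -
  note gD = gradientD[OF g]
  note [measurable] = gD(4) gD(5)[of k]
  define G where "G x = g k x + \<i> * \<mu> * u x" for x
  have [measurable]: "G \<in> borel_measurable borel" unfolding G_def by measurable
  have [measurable]: "cis \<in> borel_measurable borel"
    by (intro borel_measurable_continuous_onI continuous_intros)
  define F where "F x = ennreal ((norm (G x))\<^sup>2)" for x
  have F: "per_fun T F" unfolding F_def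
    by (rule per_fun_norm_square) (simp_all add: G_def gD)
  note [measurable] = per_funD(1)[OF F]
  have "AE x in lborel. ennreal ((norm (cis (\<mu> * h) * u (x + h *\<^sub>R axis k 1) - u x))\<^sup>2)
      \<le> ennreal h * (\<integral>\<^sup>+t\<in>{0..h}. F (x + t *\<^sub>R axis k 1) \<partial>lborel)"
    using twisted_translation_formula[OF gD(3)[of k] h, of \<mu>]
  proof eventually_elim
    case (elim x)
    have "ennreal ((norm (LINT t:{0..h}|lborel. cis (\<mu> * t) * G (x + t *\<^sub>R axis k 1)))\<^sup>2)
      \<le> ennreal h * (\<integral>\<^sup>+t\<in>{0..h}. ennreal ((norm (cis (\<mu> * t) * G (x + t *\<^sub>R axis k 1)))\<^sup>2) \<partial>lborel)"
      by (rule set_integral_norm_square_le[OF _ h]) measurable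
    then show ?case unfolding elim by (simp add: G_def F_def norm_mult)
  qed
  then have "cell_int T (\<lambda>x. ennreal ((norm (cis (\<mu> * h) * u (x + h *\<^sub>R axis k 1) - u x))\<^sup>2))
     \<le> cell_int T (\<lambda>x. ennreal h * (\<integral>\<^sup>+t\<in>{0..h}. F (x + t *\<^sub>R axis k 1) \<partial>lborel))"
    by (intro nn_integral_mono_AE) (auto elim!: eventually_mono mult_right_mono)
  also have "\<dots> = ennreal h * (\<integral>\<^sup>+x. \<integral>\<^sup>+t. F (x + t *\<^sub>R axis k 1) * indicator {0..h} t * indicator (cell T) x \<partial>lborel \<partial>lborel)"
    by (simp add: nn_integral_multc nn_integral_cmult mult.assoc[of "ennreal h"])
  also have "(\<integral>\<^sup>+x. \<integral>\<^sup>+t. F (x + t *\<^sub>R axis k 1) * indicator {0..h} t * indicator (cell T) x \<partial>lborel \<partial>lborel)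
     = (\<integral>\<^sup>+t. \<integral>\<^sup>+x. F (x + t *\<^sub>R axis k 1) * indicator {0..h} t * indicator (cell T) x \<partial>lborel \<partial>lborel)"
    by (rule lborel_pair.Fubini'[symmetric]) simp
  also have "\<dots> = (\<integral>\<^sup>+t. cell_int T (\<lambda>x. F (x + t *\<^sub>R axis k 1)) * indicator {0..h} t \<partial>lborel)"
    by (intro nn_integral_cong, subst nn_integral_multc[symmetric]) (auto simp: mult_ac)
  also have "\<dots> = cell_int T F * ennreal h"
    using h by (simp add: nn_integral_cell_shift[OF F T] nn_integral_cmult)
  finally show ?thesis
    using h by (simp add: F_def G_def mult_ac power2_eq_square ennreal_mult)
qed

lemma nn_integral_cell_norm_square_finite:
  "u \<in> L2_loc \<Longrightarrow> cell_int T (\<lambda>x. ennreal ((norm (u x))\<^sup>2)) < \<infinity>"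
  by (rule L2_loc_finite[OF _ compact_cell])

text \<open>For every \<open>x\<close> the values \<open>u (x + j h e\<^sub>k)\<close> form a sequence of period \<open>n\<close>, to which the discrete
  inequality applies. Integrated over the cell, the \<open>n\<close> summands on either side
  become equal.\<close>

lemma spectral_inequality_step:
  fixes u :: "real ^ 'n::finite \<Rightarrow> complex"
  assumes g: "gradient T u g" and T: "T > 0" and d: "d \<ge> 0" "\<And>m::int. d \<le> \<bar>\<mu> + 2 * pi * m / T\<bar>" and n: "n > 0"
    and small: "d * T / real n \<le> pi"
  defines "h \<equiv> T / real n"
  shows "ennreal ((2 * sin (d * h / 2))\<^sup>2) * cell_int T (\<lambda>x. ennreal ((norm (u x))\<^sup>2))
    \<le> ennreal (h\<^sup>2) * cell_int T (\<lambda>x. ennreal ((norm (g k x + \<i> * \<mu> * u x))\<^sup>2))"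
proof -
  note gD = gradientD[OF g]
  note [measurable] = gD(4) gD(5)[of k]
  have h: "h > 0" "real n * h = T" using T n by (simp_all add: h_def)
  define \<delta> where "\<delta> = 2 * sin (d * h / 2)"
  have "0 \<le> d * h" using d(1) h(1) by (intro mult_nonneg_nonneg) auto
  moreover have "d * h \<le> pi" using small by (simp add: h_def)
  ultimately have \<delta>0: "\<delta> \<ge> 0" unfolding \<delta>_def by (intro mult_nonneg_nonneg sin_ge_zero) auto
  have \<delta>: "\<delta> \<le> cmod (cis (\<mu> * h) * cis (2 * pi * real m / real n) - 1)" for m
  proof -
    have "\<delta> \<le> cmod (cis (\<mu> * h + 2 * pi * real m / real n) - 1)" unfolding \<delta>_def
    proof (rule cmod_cis_minus_1_ge)
      fix p :: int
      have "\<mu> * h + 2 * pi * real m / real n - 2 * pi * of_int p = (\<mu> + 2 * pi * of_int (int m - p * int n) / T) * h"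
        using T n by (simp add: h_def field_simps)
      then show "d * h \<le> \<bar>\<mu> * h + 2 * pi * real m / real n - 2 * pi * of_int p\<bar>"
        using d(2)[of "int m - p * int n"] h(1) by (simp add: abs_mult)
    qed (use d h in simp)
    then show ?thesis by (simp add: cis_mult)
  qed
  define U where "U x = ennreal ((norm (u x))\<^sup>2)" for x
  define D where "D x = ennreal ((norm (cis (\<mu> * h) * u (x + h *\<^sub>R axis k 1) - u x))\<^sup>2)" for x
  have U: "per_fun T U" unfolding U_def by (rule per_fun_norm_square) (simp_all add: gD)
  have D: "per_fun T D" unfolding D_def
  proof (rule per_fun_norm_square)
    show "cis (\<mu> * h) * u (x + axis l T + h *\<^sub>R axis k 1) - u (x + axis l T) = cis (\<mu> * h) * u (x + h *\<^sub>R axis k 1) - u x" for x l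
      using gD(6)[of "x + h *\<^sub>R axis k 1" l] gD(6)[of x l] by (simp add: add_ac)
  qed measurable
  note [measurable] = per_funD(1)[OF U] per_funD(1)[OF D]
  have pt: "ennreal (\<delta>\<^sup>2) * (\<Sum>j<n. U (x + (real j * h) *\<^sub>R axis k 1)) \<le> (\<Sum>j<n. D (x + (real j * h) *\<^sub>R axis k 1))" for x
  proof -
    define b where "b j = u (x + (real j * h) *\<^sub>R axis k 1)" for j
    have "b n = b 0" using gD(6)[of x k] by (simp add: b_def h axis_eq_scaleR[of k T])
    from discrete_spectral_inequality[OF n this \<delta>0 \<delta>]
    have "ennreal (\<delta>\<^sup>2 * (\<Sum>j<n. (cmod (b j))\<^sup>2)) \<le> ennreal (\<Sum>j<n. (cmod (cis (\<mu> * h) * b (Suc j) - b j))\<^sup>2)"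
      by (intro ennreal_leI) auto
    moreover have "ennreal (\<delta>\<^sup>2 * (\<Sum>j<n. (cmod (b j))\<^sup>2)) = ennreal (\<delta>\<^sup>2) * (\<Sum>j<n. U (x + (real j * h) *\<^sub>R axis k 1))"
      by (simp add: U_def b_def ennreal_mult sum_nonneg sum_ennreal)
    moreover have "ennreal (\<Sum>j<n. (cmod (cis (\<mu> * h) * b (Suc j) - b j))\<^sup>2) = (\<Sum>j<n. D (x + (real j * h) *\<^sub>R axis k 1))"
    proof -
      have "x + (real (Suc j) * h) *\<^sub>R axis k 1 = (x + (real j * h) *\<^sub>R axis k 1) + h *\<^sub>R axis k 1" for j
        by (simp add: algebra_simps)
      then show ?thesis unfolding D_def b_def by (simp add: sum_nonneg add.assoc flip: sum_ennreal)
    qed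
    ultimately show ?thesis by simp
  qed
  have sum: "cell_int T (\<lambda>x. (\<Sum>j<n. F (x + (real j * h) *\<^sub>R axis k 1))) = of_nat n * cell_int T F"
    if F: "per_fun T F" for F :: "real^'n \<Rightarrow> ennreal"
  proof -
    note [measurable] = per_funD(1)[OF F]
    have "cell_int T (\<lambda>x. (\<Sum>j<n. F (x + (real j * h) *\<^sub>R axis k 1)))
      = (\<Sum>j<n. \<integral>\<^sup>+x\<in>cell T. F (x + (real j * h) *\<^sub>R axis k 1) \<partial>lborel)"
      unfolding sum_distrib_right by (rule nn_integral_sum) measurable
    then show ?thesis by (simp add: nn_integral_cell_shift[OF F T])
  qed
  have "of_nat n * (ennreal (\<delta>\<^sup>2) * cell_int T U) =
     ennreal (\<delta>\<^sup>2) * cell_int T (\<lambda>x. (\<Sum>j<n. U (x + (real j * h) *\<^sub>R axis k 1)))"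
    unfolding sum[OF U] by (rule mult.left_commute)
  also have "\<dots> = cell_int T (\<lambda>x. ennreal (\<delta>\<^sup>2) * (\<Sum>j<n. U (x + (real j * h) *\<^sub>R axis k 1)))"
    unfolding mult.assoc by (rule nn_integral_cmult[symmetric]) measurable
  also have "\<dots> \<le> cell_int T (\<lambda>x. (\<Sum>j<n. D (x + (real j * h) *\<^sub>R axis k 1)))"
    by (intro nn_integral_mono mult_right_mono pt) simp
  also have "\<dots> = of_nat n * cell_int T D"
    by (rule sum[OF D])
  finally have "ennreal (\<delta>\<^sup>2) * cell_int T U \<le> cell_int T D"
    using n by (simp add: ennreal_mult_le_mult_iff)
  also have "\<dots> \<le> ennreal (h\<^sup>2) * cell_int T (\<lambda>x. ennreal ((norm (g k x + \<i> * \<mu> * u x))\<^sup>2))"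
    unfolding D_def using h by (intro twisted_increment_bound[OF g T]) simp
  finally show ?thesis by (simp add: U_def \<delta>_def)
qed

text \<open>As the step tends to zero, \<open>2 sin (d h / 2) / h\<close> tends to \<open>d\<close>.\<close>

theorem spectral_inequality:
  fixes u :: "real ^ 'n::finite \<Rightarrow> complex"
  assumes g: "gradient T u g" and T: "T > 0" and d: "d \<ge> 0" "\<And>m::int. d \<le> \<bar>\<mu> + 2 * pi * m / T\<bar>"
  shows "ennreal (d\<^sup>2) * cell_int T (\<lambda>x. ennreal ((norm (u x))\<^sup>2))
    \<le> cell_int T (\<lambda>x. ennreal ((norm (g k x + \<i> * \<mu> * u x))\<^sup>2))"
proof -
  note gD = gradientD[OF g]
  have G: "(\<lambda>x. g k x + \<i> * \<mu> * u x) \<in> L2_loc" by (intro L2_loc_add L2_loc_cmult gD)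
  obtain U where U: "cell_int T (\<lambda>x. ennreal ((norm (u x))\<^sup>2)) = ennreal U" "U \<ge> 0"
    using nn_integral_cell_norm_square_finite[OF gD(1), of T] by (cases "cell_int T (\<lambda>x. ennreal ((norm (u x))\<^sup>2))") auto
  obtain V where V: "cell_int T (\<lambda>x. ennreal ((norm (g k x + \<i> * \<mu> * u x))\<^sup>2)) = ennreal V" "V \<ge> 0"
    using nn_integral_cell_norm_square_finite[OF G, of T] by (cases "cell_int T (\<lambda>x. ennreal ((norm (g k x + \<i> * \<mu> * u x))\<^sup>2))") auto
  \<comment> \<open>Half of the step \<open>T / n\<close>, because the chord bound involves half angles.\<close>
  define s where "s n = T / (2 * real n)" for n :: nat
  have lim_s: "filterlim s (at 0) sequentially"
    unfolding filterlim_at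
  proof
    show "\<forall>\<^sub>F n in sequentially. s n \<in> UNIV \<and> s n \<noteq> 0"
      using eventually_gt_at_top[of 0] by eventually_elim (use T in \<open>simp add: s_def\<close>)
    show "s \<longlonglongrightarrow> 0" unfolding s_def by (auto intro!: tendsto_divide_0[OF tendsto_const] filterlim_tendsto_pos_mult_at_top filterlim_real_sequentially filterlim_at_top_imp_at_infinity)
  qed
  have "((\<lambda>y. sin (d * y)) has_real_derivative d) (at 0)" by (auto intro!: derivative_eq_intros)
  then have "((\<lambda>y. sin (d * y) / y) \<longlongrightarrow> d) (at 0)" by (simp add: DERIV_def)
  from filterlim_compose[OF this lim_s]
  have "(\<lambda>n. (sin (d * s n) / s n)\<^sup>2 * U) \<longlonglongrightarrow> d\<^sup>2 * U" by (intro tendsto_intros)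
  moreover have "\<forall>\<^sub>F n in sequentially. (sin (d * s n) / s n)\<^sup>2 * U \<le> V"
    using eventually_gt_at_top[of 0] eventually_ge_at_top[of "nat \<lceil>d * T / pi\<rceil>"]
  proof eventually_elim
    case (elim n)
    have "d * T / pi \<le> real n" using elim(2) by linarith
    then have small: "d * T / real n \<le> pi" using elim(1) by (simp add: field_simps)
    have sn: "s n > 0" "T / real n = 2 * s n" using T elim(1) by (simp_all add: s_def)
    have "ennreal ((2 * sin (d * s n))\<^sup>2 * U) \<le> ennreal ((2 * s n)\<^sup>2 * V)"
      using spectral_inequality_step[OF g T d elim(1) small, of k] U V by (simp add: sn ennreal_mult)
    then have "(2 * sin (d * s n))\<^sup>2 * U \<le> (2 * s n)\<^sup>2 * V"
      using U V by (subst (asm) ennreal_le_iff) auto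
    then show ?case using sn(1) by (simp add: power_divide field_simps power_mult_distrib)
  qed
  ultimately have "d\<^sup>2 * U \<le> V" by (intro tendsto_upperbound) auto
  then show ?thesis using U V by (simp add: ennreal_mult[symmetric] ennreal_leI)
qed

section \<open>Square integrals of primitives\<close>

lemma integrable_inner_pair:
  fixes F :: "real \<Rightarrow> complex"
  assumes F: "integrable lborel F"
  shows "integrable (lborel \<Otimes>\<^sub>M lborel) (\<lambda>(s, t). F s \<bullet> F t)"
proof (rule integrableI_bounded)
  have [measurable]: "F \<in> borel_measurable borel" using F by auto
  show "(\<lambda>(s, t). F s \<bullet> F t) \<in> borel_measurable (lborel \<Otimes>\<^sub>M lborel)" by (simp add: split_beta')
  have "(\<integral>\<^sup>+p. norm (case p of (s, t) \<Rightarrow> F s \<bullet> F t) \<partial>(lborel \<Otimes>\<^sub>M lborel)) =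
     (\<integral>\<^sup>+s. \<integral>\<^sup>+t. norm (F s \<bullet> F t) \<partial>lborel \<partial>lborel)"
    by (rule trans[OF lborel.nn_integral_fst[symmetric]]) (simp_all add: split_beta')
  also have "\<dots> \<le> (\<integral>\<^sup>+s. \<integral>\<^sup>+t. ennreal (norm (F s)) * ennreal (norm (F t)) \<partial>lborel \<partial>lborel)"
    by (intro nn_integral_mono) (auto simp: ennreal_mult[symmetric] intro!: ennreal_leI Cauchy_Schwarz_ineq2)
  also have "\<dots> = (\<integral>\<^sup>+s. norm (F s) \<partial>lborel) * (\<integral>\<^sup>+s. norm (F s) \<partial>lborel)"
    by (simp add: nn_integral_cmult nn_integral_multc)
  also have "\<dots> < \<infinity>" using F by (simp add: integrable_iff_bounded ennreal_mult_less_top)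
  finally show "(\<integral>\<^sup>+p. norm (case p of (s, t) \<Rightarrow> F s \<bullet> F t) \<partial>(lborel \<Otimes>\<^sub>M lborel)) < \<infinity>" .
qed

text \<open>The square of an integral is a double integral, to which the two triangles \<open>s \<le> t\<close> and \<open>t \<le> s\<close>
  contribute equally. This is the product rule for the squared modulus of a primitive.\<close>

lemma norm_square_integral_eq:
  fixes F :: "real \<Rightarrow> complex"
  assumes F: "integrable lborel F"
  shows "integrable lborel (\<lambda>t. (LINT s|lborel. indicator {..t} s *\<^sub>R F s) \<bullet> F t)"
    and "(norm (LINT t|lborel. F t))\<^sup>2 = 2 * (LINT t|lborel. (LINT s|lborel. indicator {..t} s *\<^sub>R F s) \<bullet> F t)"
proof -
  have [measurable]: "F \<in> borel_measurable borel" using F by auto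
  define L where "L s t = (if s \<le> t then F s \<bullet> F t else 0)" for s t :: real
  have L_eq: "L s t = indicator {..t} s * (F s \<bullet> F t)" for s t
    by (simp add: L_def)
  have L: "integrable (lborel \<Otimes>\<^sub>M lborel) (\<lambda>(s, t). L s t)"
  proof (rule Bochner_Integration.integrable_bound[OF integrable_inner_pair[OF F]])
    show "(\<lambda>(s, t). L s t) \<in> borel_measurable (lborel \<Otimes>\<^sub>M lborel)"
      by (simp add: L_def split_beta')
  qed (auto simp: L_def indicator_def)
  have Fi: "integrable lborel (\<lambda>s. indicator A s *\<^sub>R F s)" if "A \<in> sets borel" for A
    using F that by (intro integrable_mult_indicator) auto
  have sec: "(LINT s|lborel. F s \<bullet> F t) = (LINT s|lborel. L s t) + (LINT s|lborel. L t s)" for t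
  proof -
    have 1: "integrable lborel (\<lambda>s. L s t)"
      using integrable_inner_left[OF Fi[of "{..t}"], of "F t"] by (simp add: L_eq)
    have 2: "integrable lborel (\<lambda>s. L t s)"
      using integrable_inner_left[OF Fi[of "{t..}"], of "F t"]
      by (simp add: L_eq inner_commute indicator_def atLeast_def atMost_def)
    have "(LINT s|lborel. F s \<bullet> F t) = (LINT s|lborel. L s t + L t s)"
    proof (rule integral_cong_AE)
      show "(\<lambda>s. F s \<bullet> F t) \<in> borel_measurable lborel" by measurable
      show "(\<lambda>s. L s t + L t s) \<in> borel_measurable lborel" using 1 2 by auto
      show "AE s in lborel. F s \<bullet> F t = L s t + L t s"
        using AE_lborel_singleton[of t]
        by eventually_elim (auto simp: L_def inner_commute split: split_indicator)
    qed
    then show ?thesis using 1 2 by simp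
  qed
  have I1: "integrable lborel (\<lambda>t. LINT s|lborel. L s t)" by (rule lborel_pair.integrable_snd[OF L])
  have I2: "integrable lborel (\<lambda>t. LINT s|lborel. L t s)" by (rule lborel_pair.integrable_fst[OF L])
  have Leq: "(LINT s|lborel. L s t) = (LINT s|lborel. indicator {..t} s *\<^sub>R F s) \<bullet> F t" for t
    using Fi[of "{..t}"] by (subst integral_inner_left[symmetric]) (auto simp: L_eq)
  show "integrable lborel (\<lambda>t. (LINT s|lborel. indicator {..t} s *\<^sub>R F s) \<bullet> F t)"
    using I1 unfolding Leq .
  have "(norm (LINT t|lborel. F t))\<^sup>2 = (LINT t|lborel. F t) \<bullet> (LINT t|lborel. F t)"
    by (simp add: power2_norm_eq_inner)
  also have "\<dots> = (LINT t|lborel. LINT s|lborel. F s \<bullet> F t)"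
    using F by simp
  also have "\<dots> = (LINT t|lborel. LINT s|lborel. L s t) + (LINT t|lborel. LINT s|lborel. L t s)"
    using I1 I2 by (simp add: sec)
  also have "(LINT t|lborel. LINT s|lborel. L t s) = (LINT t|lborel. LINT s|lborel. L s t)"
    by (rule lborel_pair.Fubini_integral[OF L, symmetric])
  finally show "(norm (LINT t|lborel. F t))\<^sup>2 = 2 * (LINT t|lborel. (LINT s|lborel. indicator {..t} s *\<^sub>R F s) \<bullet> F t)"
    unfolding Leq by simp
qed

text \<open>The squared modulus of the primitive \<open>G\<close> has the derivative \<open>2 G \<bullet> f\<close>.\<close>

lemma primitive_square_bound:
  fixes f :: "real \<Rightarrow> complex" and a :: complex
  assumes f: "set_integrable lborel {0..T} f" and h: "0 \<le> h" "h \<le> T"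
  defines "G \<equiv> \<lambda>t. a + (LINT s:{0..t}|lborel. f s)"
  shows "ennreal ((norm a)\<^sup>2) \<le> ennreal ((norm (G h))\<^sup>2) + 2 * (\<integral>\<^sup>+t\<in>{0..T}. ennreal (norm (G t) * norm (f t)) \<partial>lborel)"
proof -
  define F where "F t = indicator {0..h} t *\<^sub>R f t" for t
  have F: "integrable lborel F" using set_integrable_subset[OF f, of "{0..h}"] h
    by (auto simp: F_def[abs_def] set_integrable_def)
  define H where "H t = (LINT s|lborel. indicator {..t} s *\<^sub>R F s)" for t
  have GH: "G t \<bullet> F t = a \<bullet> F t + H t \<bullet> F t" for t
  proof (cases "t \<in> {0..h}")
    case True
    then have "indicator {..t} s *\<^sub>R F s = indicator {0..t} s *\<^sub>R f s" for s
      by (auto simp: F_def split: split_indicator)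
    then show ?thesis by (simp add: G_def H_def set_lebesgue_integral_def inner_add_left)
  qed (simp add: F_def)
  have G: "G h = a + (LINT t|lborel. F t)" by (simp add: G_def F_def set_lebesgue_integral_def)
  have HI: "integrable lborel (\<lambda>t. H t \<bullet> F t)"
    and sq: "(norm (LINT t|lborel. F t))\<^sup>2 = 2 * (LINT t|lborel. H t \<bullet> F t)"
    unfolding H_def by (rule norm_square_integral_eq[OF F])+
  have exp: "(norm (G h))\<^sup>2 = (norm a)\<^sup>2 + 2 * ((LINT t|lborel. a \<bullet> F t) + (LINT t|lborel. H t \<bullet> F t))"
  proof -
    have "(norm (G h))\<^sup>2 = (norm a)\<^sup>2 + 2 * (a \<bullet> (LINT t|lborel. F t)) + (norm (LINT t|lborel. F t))\<^sup>2"
      unfolding G by (simp add: power2_norm_eq_inner inner_add_left inner_add_right inner_commute)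
    then show ?thesis using F by (simp add: sq)
  qed
  have aF: "integrable lborel (\<lambda>t. a \<bullet> F t)" using F by simp
  have "ennreal \<bar>(LINT t|lborel. a \<bullet> F t) + (LINT t|lborel. H t \<bullet> F t)\<bar> \<le> (\<integral>\<^sup>+t\<in>{0..T}. ennreal (norm (G t) * norm (f t)) \<partial>lborel)"
  proof -
    have "(LINT t|lborel. a \<bullet> F t) + (LINT t|lborel. H t \<bullet> F t) = (LINT t|lborel. G t \<bullet> F t)"
      using aF HI unfolding GH by simp
    also have "ennreal \<bar>\<dots>\<bar> \<le> (\<integral>\<^sup>+t. ennreal (norm (G t \<bullet> F t)) \<partial>lborel)"
      using aF HI integral_norm_bound_ennreal[of lborel "\<lambda>t. G t \<bullet> F t"] unfolding GH by simp
    also have "\<dots> \<le> (\<integral>\<^sup>+t\<in>{0..T}. ennreal (norm (G t) * norm (f t)) \<partial>lborel)"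
      using h by (intro nn_integral_mono) (auto simp: F_def Cauchy_Schwarz_ineq2 ennreal_leI split: split_indicator)
    finally show ?thesis .
  qed
  moreover have "ennreal ((norm a)\<^sup>2) \<le> ennreal ((norm (G h))\<^sup>2) + 2 * ennreal \<bar>(LINT t|lborel. a \<bullet> F t) + (LINT t|lborel. H t \<bullet> F t)\<bar>"
  proof -
    define S where "S = (LINT t|lborel. a \<bullet> F t) + (LINT t|lborel. H t \<bullet> F t)"
    have "(norm a)\<^sup>2 \<le> (norm (G h))\<^sup>2 + 2 * \<bar>S\<bar>" using exp unfolding S_def[symmetric] by linarith
    then have "ennreal ((norm a)\<^sup>2) \<le> ennreal ((norm (G h))\<^sup>2 + 2 * \<bar>S\<bar>)" by (rule ennreal_leI)
    also have "\<dots> = ennreal ((norm (G h))\<^sup>2) + 2 * ennreal \<bar>S\<bar>" by (simp add: ennreal_mult)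
    finally show ?thesis unfolding S_def .
  qed
  ultimately show ?thesis by (meson add_left_mono mult_left_mono order_trans zero_le)
qed

text \<open>Average the previous bound over \<open>h\<close>. The function \<open>w\<close>, equal to the primitive only almost
  everywhere, will be a Sobolev function restricted to a line.\<close>

lemma primitive_square_average_bound:
  fixes f w :: "real \<Rightarrow> complex"
  assumes f: "set_integrable lborel {0..T} f" and T: "T > 0"
    and w: "AE t in lborel. t \<in> {0..T} \<longrightarrow> w t = a + (LINT s:{0..t}|lborel. f s)" and [measurable]: "w \<in> borel_measurable borel"
      "f \<in> borel_measurable borel"
  shows "ennreal T * ennreal ((norm a)\<^sup>2) \<le> (\<integral>\<^sup>+t\<in>{0..T}. ennreal ((norm (w t))\<^sup>2 + 2 * T * (norm (w t) * norm (f t))) \<partial>lborel)"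
proof -
  define G where "G t = a + (LINT s:{0..t}|lborel. f s)" for t
  have c: "(\<integral>\<^sup>+t\<in>{0..T}. ennreal (norm (G t) * norm (f t)) \<partial>lborel) = (\<integral>\<^sup>+t\<in>{0..T}. ennreal (norm (w t) * norm (f t)) \<partial>lborel)"
    by (rule nn_integral_cong_AE, use w in eventually_elim) (auto simp: G_def split: split_indicator)
  define C where "C = 2 * (\<integral>\<^sup>+t\<in>{0..T}. ennreal (norm (w t) * norm (f t)) \<partial>lborel)"
  have "ennreal T * ennreal ((norm a)\<^sup>2) = (\<integral>\<^sup>+t\<in>{0..T}. ennreal ((norm a)\<^sup>2) \<partial>lborel)"
    using T by (simp add: nn_integral_cmult_indicator) (simp add: mult.commute)
  also have "\<dots> \<le> (\<integral>\<^sup>+t\<in>{0..T}. (ennreal ((norm (w t))\<^sup>2) + C) \<partial>lborel)"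
  proof (rule nn_integral_mono_AE, use w in eventually_elim)
    case (elim t)
    have "ennreal ((norm a)\<^sup>2) \<le> ennreal ((norm (w t))\<^sup>2) + C" if "t \<in> {0..T}"
      using primitive_square_bound[OF f, of t a] that elim unfolding C_def c[symmetric] G_def by auto
    then show ?case by (auto split: split_indicator)
  qed
  also have "\<dots> = (\<integral>\<^sup>+t\<in>{0..T}. ennreal ((norm (w t))\<^sup>2) \<partial>lborel) + C * ennreal T"
    using T by (simp add: distrib_right nn_integral_add nn_integral_cmult_indicator)
  also have "C * ennreal T = (\<integral>\<^sup>+t\<in>{0..T}. ennreal (2 * T * (norm (w t) * norm (f t))) \<partial>lborel)"
    using T unfolding C_def by (simp add: ennreal_mult mult.assoc nn_integral_cmult) (simp add: mult_ac)
  also have "(\<integral>\<^sup>+t\<in>{0..T}. ennreal ((norm (w t))\<^sup>2) \<partial>lborel) + \<dots> =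
     (\<integral>\<^sup>+t\<in>{0..T}. ennreal ((norm (w t))\<^sup>2 + 2 * T * (norm (w t) * norm (f t))) \<partial>lborel)"
    using T by (subst nn_integral_add[symmetric]) (auto intro!: nn_integral_cong split: split_indicator)
  finally show ?thesis .
qed

text \<open>Integrability over the product of \<open>[0, T]\<close> with balls of integer radius, and Fubini.\<close>

lemma AE_line_integrable:
  fixes g :: "real ^ 'n::finite \<Rightarrow> complex"
  assumes g: "g \<in> L1_loc"
  shows "AE x in lborel. set_integrable lborel {0..T} (\<lambda>t. g (x + t *\<^sub>R axis k 1))"
proof -
  have "AE x in lborel. integrable lborel (\<lambda>t. indicator (cball 0 (real n)) x *\<^sub>R (indicator {0..T} t *\<^sub>R (cis (0 * t) * g (x + t *\<^sub>R axis k 1))))" for n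
  proof (rule lborel_pair.AE_integrable_snd)
    show "integrable (lborel \<Otimes>\<^sub>M lborel) (\<lambda>(t, x). indicator (cball 0 (real n)) x *\<^sub>R (indicator {0..T} t *\<^sub>R (cis (0 * t) * g (x + t *\<^sub>R axis k 1))))"
      by (rule moving_window_integrable[OF g, of "cball 0 (real n)" _ 1])
         (auto intro!: borel_measurable_indicator split: split_indicator)
  qed
  then have "AE x in lborel. \<forall>n. integrable lborel (\<lambda>t. indicator (cball 0 (real n)) x *\<^sub>R (indicator {0..T} t *\<^sub>R (cis (0 * t) * g (x + t *\<^sub>R axis k 1))))"
    by (subst AE_all_countable) blast
  then show ?thesis
  proof eventually_elim
    case (elim x)
    obtain n :: nat where "norm x \<le> real n" using real_arch_simple by blast
    then show ?case using elim[rule_format, of n] by (simp add: set_integrable_def)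
  qed
qed

text \<open>The translation formula holds for every \<open>h\<close> outside a null set of points that depends on \<open>h\<close>. By
  Fubini it also holds on almost every line for almost every \<open>h\<close>.\<close>

lemma AE_line_primitive:
  fixes u g :: "real ^ 'n::finite \<Rightarrow> complex"
  assumes ug: "has_weak_pderiv k u g"
  shows "AE x in lborel. AE h in lborel. h \<ge> 0 \<longrightarrow> u (x + h *\<^sub>R axis k 1) = u x + (LINT t:{0..h}|lborel. g (x + t *\<^sub>R axis k 1))"
proof -
  have [measurable]: "u \<in> borel_measurable borel" "g \<in> borel_measurable borel"
    using ug by (auto simp: has_weak_pderiv_def intro: L1_loc_measurable)
  define R where "R h x = (LINT t|lborel. (if 0 \<le> t \<and> t \<le> h then g (x + t *\<^sub>R axis k 1) else 0))" for h x
  have R: "R h x = (LINT t:{0..h}|lborel. g (x + t *\<^sub>R axis k 1))" for h x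
    unfolding R_def set_lebesgue_integral_def by (intro Bochner_Integration.integral_cong) (auto simp: indicator_def)
  have [measurable]: "(\<lambda>p. R (fst p) (snd p)) \<in> borel_measurable (borel \<Otimes>\<^sub>M borel)"
    unfolding R_def by measurable
  define Q where "Q h x \<longleftrightarrow> (h \<ge> 0 \<longrightarrow> u (x + h *\<^sub>R axis k 1) = u x + R h x)" for h x
  have "Measurable.pred (borel \<Otimes>\<^sub>M borel) (\<lambda>p. Q (fst p) (snd p))" unfolding Q_def by measurable
  moreover have "sets (lborel \<Otimes>\<^sub>M lborel) = sets (borel \<Otimes>\<^sub>M (borel :: (real^'n) measure) :: (real \<times> (real^'n)) measure)"
    by (intro sets_pair_measure_cong) auto
  ultimately have sets: "{p \<in> space (lborel \<Otimes>\<^sub>M lborel). Q (fst p) (snd p)} \<in> sets (lborel \<Otimes>\<^sub>M lborel)"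
    by (simp add: pred_def space_pair_measure)
  have "AE h in lborel. AE x in lborel. Q h x"
  proof (rule AE_I2)
    fix h :: real
    show "AE x in lborel. Q h x"
    proof (cases "h \<ge> 0")
      case True
      from twisted_translation_formula[OF ug this, of 0] show ?thesis
        by (auto simp: Q_def R algebra_simps elim!: eventually_mono)
    qed (simp add: Q_def)
  qed
  then have "AE x in lborel. AE h in lborel. Q h x"
    unfolding lborel_pair.AE_commute[OF sets] .
  then show ?thesis unfolding Q_def R .
qed

section \<open>The embedding into the fourth power Lebesgue space\<close>

text \<open>The function whose line integrals in the direction of the derivative \<open>g\<close> dominate \<open>T\<close> times
  the squared modulus of \<open>v\<close>.\<close>

definition line_density :: "real \<Rightarrow> (real ^ 'n::finite \<Rightarrow> complex) \<Rightarrow> (real ^ 'n \<Rightarrow> complex) \<Rightarrow> real ^ 'n \<Rightarrow> ennreal" where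
  "line_density T v g x = ennreal ((norm (v x))\<^sup>2 + 2 * T * (norm (v x) * norm (g x)))"

text \<open>The basic estimate of Ladyzhenskaya type: the squared modulus lies below a function that does not
  depend on the coordinate \<open>k\<close>.\<close>

lemma line_square_bound:
  fixes v :: "real ^ 'n::finite \<Rightarrow> complex"
  assumes g: "gradient T v g" and T: "T > 0"
  shows "AE x in lborel. ennreal T * ennreal ((norm (v x))\<^sup>2) \<le> line_int T k (line_density T v (g k)) x"
proof -
  note gD = gradientD[OF g]
  note [measurable] = gD(4) gD(5)[of k]
  have "g k \<in> L1_loc" using gD(3)[of k] by (simp add: has_weak_pderiv_def)
  from AE_line_integrable[OF this, of T k] AE_line_primitive[OF gD(3)[of k]]
  show ?thesis
  proof eventually_elim
    case (elim x)
    show ?case unfolding line_int_def line_density_def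
      by (rule primitive_square_average_bound[OF elim(1) T]) (use elim(2) in \<open>auto elim!: eventually_mono\<close>)
  qed
qed

lemma per_fun_line_density:
  assumes "gradient T v g" shows "per_fun T (line_density T v (g k))"
  using gradientD[OF assms] unfolding per_fun_def line_density_def[abs_def] by simp

lemma per_fun_mult: "per_fun T F \<Longrightarrow> per_fun T G \<Longrightarrow> per_fun T (\<lambda>x. F x * G x)"
  by (auto simp: per_fun_def)

text \<open>The iterated line integral is an integral over the product of two real lines, where
  Cauchy--Schwarz is available.\<close>

lemma line_int_twice_Cauchy_Schwarz:
  fixes f g :: "real ^ 'n::finite \<Rightarrow> ennreal"
  assumes [measurable]: "f \<in> borel_measurable borel" "g \<in> borel_measurable borel"
  shows "(line_int T j (line_int T i (\<lambda>x. f x * g x)) x)\<^sup>2 \<le>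
    line_int T j (line_int T i (\<lambda>x. (f x)\<^sup>2)) x * line_int T j (line_int T i (\<lambda>x. (g x)\<^sup>2)) x"
proof -
  define I where "I p = (indicator {0..T} (fst p) * indicator {0..T} (snd p) :: ennreal)" for p :: "real \<times> real"
  define Y where "Y p = x + fst p *\<^sub>R axis j 1 + snd p *\<^sub>R axis i 1" for p :: "real \<times> real"
  have [measurable]: "I \<in> borel_measurable (borel \<Otimes>\<^sub>M borel)" unfolding I_def by measurable
  have [measurable]: "Y \<in> borel_measurable (borel \<Otimes>\<^sub>M borel)" unfolding Y_def by measurable
  have II: "I p * I p = I p" for p by (auto simp: I_def split: split_indicator)
  have eq: "line_int T j (line_int T i F) x = (\<integral>\<^sup>+p. F (Y p) * I p \<partial>(lborel \<Otimes>\<^sub>M lborel))"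
    if [measurable]: "F \<in> borel_measurable borel" for F
  proof -
    have "line_int T j (line_int T i F) x = (\<integral>\<^sup>+t. \<integral>\<^sup>+s. F (Y (t, s)) * I (t, s) \<partial>lborel \<partial>lborel)"
      unfolding line_int_def
      by (intro nn_integral_cong, subst nn_integral_multc[symmetric]) (auto simp: Y_def I_def mult_ac)
    also have "\<dots> = (\<integral>\<^sup>+p. F (Y p) * I p \<partial>(lborel \<Otimes>\<^sub>M lborel))"
      by (rule lborel.nn_integral_fst) simp
    finally show ?thesis .
  qed
  have "(line_int T j (line_int T i (\<lambda>x. f x * g x)) x)\<^sup>2 = (\<integral>\<^sup>+p. (f (Y p) * I p) * (g (Y p) * I p) \<partial>(lborel \<Otimes>\<^sub>M lborel))\<^sup>2"
  proof -
    have "(f (Y p) * I p) * (g (Y p) * I p) = f (Y p) * g (Y p) * I p" for p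
    proof -
      have "(f (Y p) * I p) * (g (Y p) * I p) = f (Y p) * g (Y p) * (I p * I p)" by (simp only: mult_ac)
      then show ?thesis by (simp only: II)
    qed
    then show ?thesis by (simp add: eq)
  qed
  also have "\<dots> \<le> (\<integral>\<^sup>+p. (f (Y p) * I p)\<^sup>2 \<partial>(lborel \<Otimes>\<^sub>M lborel)) * (\<integral>\<^sup>+p. (g (Y p) * I p)\<^sup>2 \<partial>(lborel \<Otimes>\<^sub>M lborel))"
    by (rule Cauchy_Schwarz_nn_integral) simp_all
  also have "\<dots> = line_int T j (line_int T i (\<lambda>x. (f x)\<^sup>2)) x * line_int T j (line_int T i (\<lambda>x. (g x)\<^sup>2)) x"
    by (simp add: eq power_mult_distrib power2_eq_square[of "I _"] II)
  finally show ?thesis .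
qed

text \<open>Insert a line integral in direction \<open>i\<close>, which costs a factor \<open>T\<close>; the factor that is invariant in
  this direction can be pulled out of it. Then do the same in direction \<open>j\<close>.\<close>

lemma nn_integral_mult_two_directions:
  fixes F G :: "real ^ 'n::finite \<Rightarrow> ennreal"
  assumes F: "per_fun T F" and G: "per_fun T G" and T: "T > 0"
  shows "ennreal T * (ennreal T * cell_int T (\<lambda>x. line_int T i F x * line_int T j G x)) =
    cell_int T (\<lambda>x. line_int T j (line_int T i F) x * line_int T j (line_int T i G) x)"
proof -
  define M where "M = line_int T i F"
  define N where "N = line_int T j G"
  have M: "per_fun T M" "M (x + s *\<^sub>R axis i 1) = M x" for x s
    using F T by (auto simp: M_def per_fun_line_int line_int_invariant)
  have N: "per_fun T N" "N (x + s *\<^sub>R axis j 1) = N x" for x s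
    using G T by (auto simp: N_def per_fun_line_int line_int_invariant)
  have LN: "line_int T i N (x + s *\<^sub>R axis j 1) = line_int T i N x" for x s
    by (rule line_int_invariant_other[OF N(2)])
  have "ennreal T * cell_int T (\<lambda>x. M x * N x) = cell_int T (\<lambda>x. line_int T i (\<lambda>x. M x * N x) x)"
    by (rule nn_integral_cell_line_int[symmetric, OF per_fun_mult[OF M(1) N(1)] T])
  also have "\<dots> = cell_int T (\<lambda>x. M x * line_int T i N x)"
    by (subst line_int_mult_invariant[OF per_funD(1)[OF N(1)] M(2)]) (rule refl)
  finally have 1: "ennreal T * cell_int T (\<lambda>x. M x * N x) = cell_int T (\<lambda>x. line_int T i N x * M x)"
    by (simp add: mult.commute)
  have "ennreal T * cell_int T (\<lambda>x. line_int T i N x * M x) = cell_int T (\<lambda>x. line_int T j (\<lambda>x. line_int T i N x * M x) x)"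
    by (rule nn_integral_cell_line_int[symmetric, OF per_fun_mult[OF per_fun_line_int[OF N(1)] M(1)] T])
  also have "\<dots> = cell_int T (\<lambda>x. line_int T i N x * line_int T j M x)"
    by (subst line_int_mult_invariant[OF per_funD(1)[OF M(1)] LN]) (rule refl)
  also have "\<dots> = cell_int T (\<lambda>x. line_int T j M x * line_int T i N x)"
    by (simp only: mult.commute)
  finally have 2: "ennreal T * cell_int T (\<lambda>x. line_int T i N x * M x) =
    cell_int T (\<lambda>x. line_int T j M x * line_int T i N x)" .
  have LNG: "line_int T j (line_int T i G) = line_int T i N"
    unfolding N_def by (rule line_int_commute[OF per_funD(1)[OF G]])
  have "ennreal T * (ennreal T * cell_int T (\<lambda>x. M x * N x)) =
     cell_int T (\<lambda>x. line_int T j M x * line_int T j (line_int T i G) x)"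
    unfolding 1 2 LNG ..
  then show ?thesis unfolding M_def N_def .
qed

text \<open>The fourth power lies below the product of two line integrals, in directions \<open>i\<close> and \<open>j\<close>. Its integral
  decouples into integrals over slices spanned by these directions, of \<open>\<bar>v\<bar> (\<bar>v\<bar> + 2 T \<bar>g\<bar>)\<close>.
  Cauchy--Schwarz separates the first factor, whose square has slice integrals at most \<open>K\<close>, from the
  second one, which is square integrable.\<close>

lemma L4_bound_from_slices:
  fixes v :: "real ^ 'n::finite \<Rightarrow> complex"
  assumes g: "gradient T v g" and T: "T > 0"
    and K: "AE x in lborel. line_int T j (line_int T i (\<lambda>x. ennreal ((norm (v x))\<^sup>2))) x \<le> K"
  shows "ennreal (T\<^sup>2) * cell_int T (\<lambda>x. ennreal ((norm (v x))^4))
    \<le> K * (cell_int T (\<lambda>x. ennreal ((norm (v x) + 2 * T * norm (g i x))\<^sup>2))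
         + cell_int T (\<lambda>x. ennreal ((norm (v x) + 2 * T * norm (g j x))\<^sup>2)))"
proof -
  note gD = gradientD[OF g]
  note [measurable] = gD(4,5)
  define V where "V x = ennreal ((norm (v x))\<^sup>2)" for x
  define q where "q k = line_density T v (g k)" for k
  define p where "p k x = ennreal (norm (v x) + 2 * T * norm (g k x))" for k x
  define P where "P k x = (p k x)\<^sup>2" for k x
  have q: "per_fun T (q k)" for k unfolding q_def by (rule per_fun_line_density[OF g])
  have V: "per_fun T V" unfolding V_def by (rule per_fun_norm_square) (simp_all add: gD)
  have p: "per_fun T (p k)" for k using gD by (simp add: per_fun_def p_def[abs_def])
  note [measurable] = per_funD(1)[OF p]
  have P: "per_fun T (P k)" for k
    unfolding per_fun_def P_def[abs_def] by (simp add: per_funD(2)[OF p])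
  note [measurable] = per_funD(1)[OF q] per_funD(1)[OF V] per_funD(1)[OF P]
  have qp: "q k x = ennreal (norm (v x)) * p k x" for k x
    using T by (simp add: q_def p_def line_density_def ennreal_mult[symmetric] power2_eq_square algebra_simps)
  define B where "B k = line_int T j (line_int T i (q k))" for k
  have [measurable]: "B k \<in> borel_measurable borel" for k unfolding B_def by measurable
  have B2: "AE x in lborel. (B k x)\<^sup>2 \<le> K * line_int T j (line_int T i (P k)) x" for k
    using K
  proof eventually_elim
    case (elim x)
    have "(B k x)\<^sup>2 \<le> line_int T j (line_int T i (\<lambda>x. (ennreal (norm (v x)))\<^sup>2)) x * line_int T j (line_int T i (\<lambda>x. (p k x)\<^sup>2)) x"
      unfolding B_def qp[abs_def] by (rule line_int_twice_Cauchy_Schwarz) measurable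
    also have "\<dots> \<le> K * line_int T j (line_int T i (P k)) x"
      using elim by (intro mult_mono) (auto simp: ennreal_power P_def[abs_def])
    finally show ?case .
  qed
  have int_L: "cell_int T (\<lambda>x. line_int T j (line_int T i (P k)) x) = ennreal (T\<^sup>2) * cell_int T (\<lambda>x. P k x)" for k
    using T by (simp add: nn_integral_cell_line_int[OF per_fun_line_int[OF P] T] nn_integral_cell_line_int[OF P T] power2_eq_square ennreal_mult mult.assoc)
  have "ennreal (T\<^sup>2) * cell_int T (\<lambda>x. ennreal ((norm (v x))^4)) = cell_int T (\<lambda>x. (ennreal T * V x) * (ennreal T * V x))"
  proof -
    have "(ennreal T * V x) * (ennreal T * V x) = ennreal (T\<^sup>2) * ennreal ((norm (v x))^4)" for x
      using T by (simp add: V_def ennreal_mult[symmetric] power2_eq_square power4_eq_xxxx mult_ac)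
    then show ?thesis by (simp add: nn_integral_cmult mult.assoc)
  qed
  also have "\<dots> \<le> cell_int T (\<lambda>x. line_int T i (q i) x * line_int T j (q j) x)"
  proof (rule nn_integral_mono_AE)
    from line_square_bound[OF g T, of i] line_square_bound[OF g T, of j]
    show "AE x in lborel. (ennreal T * V x) * (ennreal T * V x) * indicator (cell T) x
      \<le> line_int T i (q i) x * line_int T j (q j) x * indicator (cell T) x"
      unfolding q_def V_def by eventually_elim (intro mult_mono, auto)
  qed
  finally have "ennreal (T\<^sup>2) * (ennreal (T\<^sup>2) * cell_int T (\<lambda>x. ennreal ((norm (v x))^4))) \<le>
      ennreal (T\<^sup>2) * cell_int T (\<lambda>x. line_int T i (q i) x * line_int T j (q j) x)"
    by (rule mult_left_mono) simp
  also have "\<dots> = cell_int T (\<lambda>x. B i x * B j x)"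
    using T unfolding B_def nn_integral_mult_two_directions[OF q q T, symmetric]
    by (simp add: power2_eq_square ennreal_mult mult.assoc)
  also have "\<dots> \<le> cell_int T (\<lambda>x. (K * line_int T j (line_int T i (P i)) x + K * line_int T j (line_int T i (P j)) x))"
  proof (rule nn_integral_mono_AE)
    from B2[of i] B2[of j]
    show "AE x in lborel. B i x * B j x * indicator (cell T) x \<le>
      (K * line_int T j (line_int T i (P i)) x + K * line_int T j (line_int T i (P j)) x) * indicator (cell T) x"
    proof eventually_elim
      case (elim x)
      have "B i x * B j x \<le> 2 * B i x * B j x"
        using mult_right_mono[of 1 2 "B i x * B j x"] by (simp add: mult.assoc)
      also have "\<dots> \<le> (B i x)\<^sup>2 + (B j x)\<^sup>2" by (rule sum_of_squares_ge_ennreal)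
      also have "\<dots> \<le> K * line_int T j (line_int T i (P i)) x + K * line_int T j (line_int T i (P j)) x"
        using elim by (rule add_mono)
      finally show ?case by (rule mult_right_mono) simp
    qed
  qed
  also have "\<dots> = K * (ennreal (T\<^sup>2) * cell_int T (\<lambda>x. P i x)) + K * (ennreal (T\<^sup>2) * cell_int T (\<lambda>x. P j x))"
    unfolding int_L[symmetric] by (simp add: distrib_right nn_integral_add nn_integral_cmult mult.assoc)
  also have "\<dots> = ennreal (T\<^sup>2) * (K * (cell_int T (\<lambda>x. P i x) + cell_int T (\<lambda>x. P j x)))"
    by (simp add: distrib_left mult_ac)
  finally have "ennreal (T\<^sup>2) * cell_int T (\<lambda>x. ennreal ((norm (v x))^4)) \<le> K * (cell_int T (\<lambda>x. P i x) + cell_int T (\<lambda>x. P j x))"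
    using T by (subst (asm) ennreal_mult_le_mult_iff) auto
  moreover have "P k x = ennreal ((norm (v x) + 2 * T * norm (g k x))\<^sup>2)" for k x
    using T by (simp add: P_def p_def ennreal_power del: ennreal_plus)
  ultimately show ?thesis by simp
qed

text \<open>Invariance in all coordinate directions forces \<open>G\<close> to be constant.\<close>

lemma cell_integral_of_invariant:
  fixes G :: "real ^ 'n::finite \<Rightarrow> ennreal"
  assumes T: "T > 0" and inv: "\<And>k x s. G (x + s *\<^sub>R axis k 1) = G x"
  shows "(\<integral>\<^sup>+y\<in>cell T. G y \<partial>lborel) = ennreal (T ^ CARD('n)) * G x"
proof -
  have shift: "G (y + (\<Sum>k\<in>A. z k *\<^sub>R axis k 1)) = G y" if "finite A" for A y and z :: "'n \<Rightarrow> real"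
    using that
  proof (induction A)
    case (insert a A)
    have eq: "y + (\<Sum>k\<in>insert a A. z k *\<^sub>R axis k 1) = (y + (\<Sum>k\<in>A. z k *\<^sub>R axis k 1)) + z a *\<^sub>R axis a 1"
      using insert by (simp add: add_ac)
    show ?case unfolding eq using insert.IH inv[of "y + (\<Sum>k\<in>A. z k *\<^sub>R axis k 1)" "z a" a] by simp
  qed simp
  have const: "G y = G 0" for y
    using shift[of UNIV 0 "\<lambda>k. y $ k", OF finite] basis_expansion[of y]
    by (simp add: scalar_mult_eq_scaleR)
  have "(\<integral>\<^sup>+y\<in>cell T. G y \<partial>lborel) = (\<integral>\<^sup>+y\<in>(cell T :: (real^'n) set). G x \<partial>lborel)"
    using const by (intro nn_integral_cong) metis
  then show ?thesis by (simp only: nn_integral_cell_const[OF T] mult.commute)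
qed

definition H1_energy :: "real \<Rightarrow> (real ^ 'n::finite \<Rightarrow> complex) \<Rightarrow> ('n \<Rightarrow> real ^ 'n \<Rightarrow> complex) \<Rightarrow> ennreal" where
  "H1_energy T v g = cell_int T (\<lambda>x. ennreal ((\<Sum>k\<in>UNIV. (norm (g k x))\<^sup>2) + (norm (v x))\<^sup>2))"

lemma line_density_le_energy:
  fixes v :: "real ^ 'n::finite \<Rightarrow> complex"
  assumes g: "gradient T v g" and T: "T > 0"
  shows "cell_int T (\<lambda>x. line_density T v (g k) x) \<le> ennreal (1 + T) * H1_energy T v g"
    and "cell_int T (\<lambda>x. ennreal ((norm (v x))\<^sup>2)) \<le> H1_energy T v g"
    and "cell_int T (\<lambda>x. ennreal ((norm (v x) + 2 * T * norm (g k x))\<^sup>2)) \<le> ennreal (2 + 8 * T\<^sup>2) * H1_energy T v g"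
proof -
  note gD = gradientD[OF g]
  note [measurable] = gD(4,5)
  define E where "E x = (\<Sum>k\<in>UNIV. (norm (g k x))\<^sup>2) + (norm (v x))\<^sup>2" for x
  have [measurable]: "E \<in> borel_measurable borel" unfolding E_def by measurable
  have E: "(norm (g k x))\<^sup>2 + (norm (v x))\<^sup>2 \<le> E x" for k x
    unfolding E_def by (intro add_right_mono member_le_sum) auto
  have bound: "cell_int T (\<lambda>x. ennreal (f x)) \<le> ennreal C * H1_energy T v g"
    if "C \<ge> 0" "\<And>x. f x \<le> C * E x" for f C
  proof -
    have "cell_int T (\<lambda>x. ennreal (f x)) \<le> (\<integral>\<^sup>+x. ennreal C * (ennreal (E x) * indicator (cell T) x) \<partial>lborel)"
    proof (rule nn_integral_mono)
      fix x
      have "ennreal (f x) \<le> ennreal C * ennreal (E x)"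
        using that by (simp add: ennreal_leI flip: ennreal_mult')
      then show "ennreal (f x) * indicator (cell T) x \<le> ennreal C * (ennreal (E x) * indicator (cell T) x)"
        by (auto split: split_indicator)
    qed
    also have "\<dots> = ennreal C * H1_energy T v g"
      unfolding H1_energy_def E_def[symmetric] by (rule nn_integral_cmult) measurable
    finally show ?thesis .
  qed
  have v: "(norm (v x))\<^sup>2 \<le> E x" and gk: "(norm (g k x))\<^sup>2 \<le> E x" for x
    using E[of k x] zero_le_power2[of "norm (v x)"] zero_le_power2[of "norm (g k x)"] by linarith+
  show "cell_int T (\<lambda>x. ennreal ((norm (v x))\<^sup>2)) \<le> H1_energy T v g"
    using bound[of 1 "\<lambda>x. (norm (v x))\<^sup>2"] v by simp
  show "cell_int T (\<lambda>x. line_density T v (g k) x) \<le> ennreal (1 + T) * H1_energy T v g"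
    unfolding line_density_def
  proof (rule bound)
    fix x
    have "2 * (norm (v x) * norm (g k x)) \<le> (norm (g k x))\<^sup>2 + (norm (v x))\<^sup>2"
      using zero_le_power2[of "norm (v x) - norm (g k x)"] by (simp add: power2_diff)
    also have "\<dots> \<le> E x" by (rule E)
    finally have "T * (2 * (norm (v x) * norm (g k x))) \<le> T * E x" using T by (intro mult_left_mono) auto
    then show "(norm (v x))\<^sup>2 + 2 * T * (norm (v x) * norm (g k x)) \<le> (1 + T) * E x"
      using v[of x] by (simp add: algebra_simps)
  qed (use T in simp)
  show "cell_int T (\<lambda>x. ennreal ((norm (v x) + 2 * T * norm (g k x))\<^sup>2)) \<le> ennreal (2 + 8 * T\<^sup>2) * H1_energy T v g"
  proof (rule bound)
    fix x
    have "(norm (v x) + 2 * T * norm (g k x))\<^sup>2 \<le> 2 * (norm (v x))\<^sup>2 + 2 * (2 * T * norm (g k x))\<^sup>2"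
      using zero_le_power2[of "norm (v x) - 2 * T * norm (g k x)"] by (simp add: power2_sum power2_diff)
    also have "\<dots> = 2 * (norm (v x))\<^sup>2 + 8 * T\<^sup>2 * (norm (g k x))\<^sup>2" by (simp add: power_mult_distrib)
    also have "\<dots> \<le> 2 * E x + 8 * T\<^sup>2 * E x"
      using v[of x] gk[of x] by (intro add_mono mult_left_mono) auto
    finally show "(norm (v x) + 2 * T * norm (g k x))\<^sup>2 \<le> (2 + 8 * T\<^sup>2) * E x" by (simp add: algebra_simps)
  qed simp
qed

text \<open>Bounding the squared modulus by line integrals in the direction \<open>k\<close> turns the slice integral into
  an integral over all directions. In dimension two \<open>k\<close> repeats \<open>i\<close> or \<open>j\<close>; the repeated integration then
  contributes only a factor \<open>T\<close>, and this is why a power of \<open>T\<close> depending on the dimension appears.\<close>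

lemma slice_bound:
  fixes v :: "real ^ 'n::finite \<Rightarrow> complex"
  assumes g: "gradient T v g" and T: "T > 0" and dim: "UNIV = {i, j, k :: 'n}"
  shows "AE x in lborel. line_int T j (line_int T i (\<lambda>x. ennreal ((norm (v x))\<^sup>2))) x
    \<le> ennreal (T\<^sup>2 * (1 + T) / T ^ CARD('n)) * H1_energy T v g"
proof -
  define V where "V x = ennreal ((norm (v x))\<^sup>2)" for x
  define q where "q = line_density T v (g k)"
  define W where "W = line_int T j (line_int T i (line_int T k q))"
  have V: "per_fun T V" unfolding V_def by (rule per_fun_norm_square) (simp_all add: gradientD[OF g])
  have q: "per_fun T q" unfolding q_def by (rule per_fun_line_density[OF g])
  note [measurable] = per_funD(1)[OF V] per_funD(1)[OF q]
  have W: "W (x + s *\<^sub>R axis l 1) = W x" for l x s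
  proof -
    have "l = i \<or> l = j \<or> l = k" using dim by auto
    moreover have "W (x + s *\<^sub>R axis k 1) = W x"
      unfolding W_def by (intro line_int_invariant_other line_int_invariant[OF q T])
    moreover have "W (x + s *\<^sub>R axis i 1) = W x"
      unfolding W_def by (rule line_int_invariant_other[OF line_int_invariant[OF per_fun_line_int[OF q] T]])
    moreover have "W (x + s *\<^sub>R axis j 1) = W x"
      unfolding W_def by (rule line_int_invariant[OF per_fun_line_int[OF per_fun_line_int[OF q]] T])
    ultimately show ?thesis by metis
  qed
  have intW: "cell_int T W = ennreal (T ^ 3) * cell_int T q"
    using T unfolding W_def
    by (simp add: nn_integral_cell_line_int[OF per_fun_line_int[OF per_fun_line_int[OF q]] T]
      nn_integral_cell_line_int[OF per_fun_line_int[OF q] T] nn_integral_cell_line_int[OF q T] power3_eq_cube ennreal_mult mult.assoc)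
  have pull: "line_int T l (\<lambda>x. ennreal T * F x) = (\<lambda>x. ennreal T * line_int T l F x)"
    if [measurable]: "F \<in> borel_measurable borel" for F l
    by (rule ext, rule line_int_mult_invariant) auto
  have "AE x in lborel. ennreal T * V x \<le> line_int T k q x"
    unfolding V_def q_def by (rule line_square_bound[OF g T])
  then have "AE x in lborel. line_int T j (line_int T i (\<lambda>x. ennreal T * V x)) x \<le> W x"
    unfolding W_def by (intro line_int_mono_AE)
  then have "AE x in lborel. ennreal T * line_int T j (line_int T i V) x \<le> W x"
    by (simp add: pull)
  then show ?thesis
  proof eventually_elim
    case (elim x)
    define A where "A = T ^ CARD('n) * T"
    have A: "A > 0" using T by (simp add: A_def)
    have "ennreal A * line_int T j (line_int T i V) x \<le> ennreal (T ^ CARD('n)) * W x"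
      using mult_left_mono[OF elim, of "ennreal (T ^ CARD('n))"] T by (simp add: A_def ennreal_mult mult.assoc)
    also have "\<dots> = ennreal (T ^ 3) * cell_int T q"
      unfolding intW[symmetric] by (rule cell_integral_of_invariant[OF T W, symmetric])
    also have "\<dots> \<le> ennreal (T ^ 3) * (ennreal (1 + T) * H1_energy T v g)"
      unfolding q_def by (intro mult_left_mono line_density_le_energy[OF g T]) simp
    also have "\<dots> = ennreal A * (ennreal (T\<^sup>2 * (1 + T) / T ^ CARD('n)) * H1_energy T v g)"
      using T by (simp add: A_def mult.assoc[symmetric] ennreal_mult[symmetric] power3_eq_cube power2_eq_square del: ennreal_plus)
    finally show ?case using A unfolding V_def[abs_def] by (subst (asm) ennreal_mult_le_mult_iff) auto
  qed
qed

text \<open>In dimension at most three, slices spanned by two directions leave at most one further direction,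
  and \<open>slice_bound\<close> takes care of it.\<close>

theorem L4_embedding:
  assumes dim: "CARD('n::finite) \<in> {2, 3}" and T: "T > 0"
  shows "\<exists>C\<ge>0. \<forall>(v :: real ^ 'n \<Rightarrow> complex) g. gradient T v g \<longrightarrow>
     cell_int T (\<lambda>x. ennreal ((norm (v x))^4)) \<le> ennreal C * (H1_energy T v g)\<^sup>2"
proof -
  have "\<exists>i j k :: 'n. UNIV = {i, j, k}"
  proof (cases "CARD('n) = 2")
    case True
    then obtain i j :: 'n where "UNIV = {i, j}" by (auto simp: card_2_iff)
    then have "UNIV = {i, j, j}" by simp
    then show ?thesis by blast
  next
    case False
    then have "CARD('n) = 3" using dim by simp
    then show ?thesis by (auto simp: card_3_iff)
  qed
  then obtain i j k :: 'n where ijk: "UNIV = {i, j, k}" by blast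
  define K where "K = T\<^sup>2 * (1 + T) / T ^ CARD('n)"
  define C where "C = K * (4 + 16 * T\<^sup>2) / T\<^sup>2"
  have K: "K > 0" using T by (simp add: K_def)
  have "C \<ge> 0" using K T by (simp add: C_def)
  moreover have "cell_int T (\<lambda>x. ennreal ((norm (v x))^4)) \<le> ennreal C * (H1_energy T v g)\<^sup>2"
    if g: "gradient T v g" for v :: "real ^ 'n \<Rightarrow> complex" and g
  proof -
  have ij: "AE x in lborel. line_int T j (line_int T i (\<lambda>x. ennreal ((norm (v x))\<^sup>2))) x \<le> ennreal K * H1_energy T v g"
    unfolding K_def by (rule slice_bound[OF g T ijk])
  let ?E = "H1_energy T v g"
  have "ennreal (T\<^sup>2) * cell_int T (\<lambda>x. ennreal ((norm (v x))^4)) \<le>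
      ennreal K * ?E * (ennreal (2 + 8 * T\<^sup>2) * ?E + ennreal (2 + 8 * T\<^sup>2) * ?E)"
    by (rule order_trans[OF L4_bound_from_slices[OF g T ij]])
       (intro mult_left_mono add_mono line_density_le_energy[OF g T], simp)
  also have "\<dots> = ennreal (T\<^sup>2) * (ennreal C * ?E\<^sup>2)"
  proof -
    define A where "A = ennreal (2 + 8 * T\<^sup>2)"
    have "A + A = ennreal (4 + 16 * T\<^sup>2)"
      unfolding A_def by (subst ennreal_plus[symmetric]) auto
    then have "A * ?E + A * ?E = ennreal (4 + 16 * T\<^sup>2) * ?E" by (simp only: distrib_right[symmetric])
    then have "ennreal K * ?E * (A * ?E + A * ?E) = (ennreal K * ennreal (4 + 16 * T\<^sup>2)) * ?E\<^sup>2"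
      by (simp only: power2_eq_square mult_ac)
    then have "ennreal K * ?E * (ennreal (2 + 8 * T\<^sup>2) * ?E + ennreal (2 + 8 * T\<^sup>2) * ?E) =
      (ennreal K * ennreal (4 + 16 * T\<^sup>2)) * ?E\<^sup>2" unfolding A_def .
    also have "ennreal K * ennreal (4 + 16 * T\<^sup>2) = ennreal (T\<^sup>2) * ennreal C"
      using T K by (simp add: C_def ennreal_mult[symmetric] del: ennreal_plus)
    finally show ?thesis by (simp add: mult.assoc)
  qed
  finally show ?thesis
    using T by (subst (asm) ennreal_mult_le_mult_iff) auto
  qed
  ultimately show ?thesis by blast
qed

section \<open>The action in terms of periodic gradients\<close>

lemma cell_integrableI:
  fixes f :: "real ^ 'n::finite \<Rightarrow> real"
  assumes [measurable]: "f \<in> borel_measurable borel" and "\<And>x. f x \<ge> 0"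
    and fin: "cell_int T (\<lambda>x. ennreal (f x)) < \<infinity>"
  shows "set_integrable lborel (cell T) f"
  unfolding set_integrable_def
proof (rule integrableI_bounded)
  have "ennreal (norm (indicator (cell T) x *\<^sub>R f x)) = ennreal (f x) * indicator (cell T) x" for x
    using assms(2)[of x] by (auto split: split_indicator)
  then show "(\<integral>\<^sup>+x. ennreal (norm (indicator (cell T) x *\<^sub>R f x)) \<partial>lborel) < \<infinity>" using fin by simp
qed measurable

lemma cell_nn_integral_eq:
  fixes f :: "real ^ 'n::finite \<Rightarrow> real"
  assumes f: "set_integrable lborel (cell T) f" and nonneg: "\<And>x. f x \<ge> 0"
  shows "cell_int T (\<lambda>x. ennreal (f x)) = ennreal (LINT x:cell T|lborel. f x)"
proof -
  have "cell_int T (\<lambda>x. ennreal (f x)) = (\<integral>\<^sup>+x. ennreal (indicator (cell T) x *\<^sub>R f x) \<partial>lborel)"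
    by (intro nn_integral_cong) (auto split: split_indicator)
  also have "\<dots> = ennreal (LINT x|lborel. indicator (cell T) x *\<^sub>R f x)"
    using f nonneg unfolding set_integrable_def by (intro nn_integral_eq_integral) auto
  finally show ?thesis by (simp add: set_lebesgue_integral_def)
qed

lemma cell_integrable_square:
  "u \<in> L2_loc \<Longrightarrow> set_integrable lborel (cell T) (\<lambda>x. (cmod (u x))\<^sup>2)"
  by (rule L2_locD(2)[OF _ compact_cell])

lemma cell_integrable_inner:
  assumes u: "u \<in> L2_loc" and v: "v \<in> L2_loc"
  shows "set_integrable lborel (cell T) (\<lambda>x. u x \<bullet> v x)"
proof (rule set_integrable_dominated[OF _ cell_sets])
  show "set_integrable lborel (cell T) (\<lambda>x. (cmod (u x))\<^sup>2 + (cmod (v x))\<^sup>2)"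
    by (intro set_integral_add cell_integrable_square u v)
  show "(\<lambda>x. u x \<bullet> v x) \<in> borel_measurable borel" using L2_locD(1)[OF u] L2_locD(1)[OF v] by measurable
  fix x
  have "\<bar>u x \<bullet> v x\<bar> \<le> cmod (u x) * cmod (v x)" by (rule Cauchy_Schwarz_ineq2)
  moreover have "0 \<le> (cmod (u x) - cmod (v x))\<^sup>2" by simp
  moreover have "0 \<le> cmod (u x) * cmod (v x)" by simp
  ultimately show "norm (u x \<bullet> v x) \<le> (cmod (u x))\<^sup>2 + (cmod (v x))\<^sup>2"
    by (simp only: power2_diff real_norm_def)
qed

lemma set_integrable_finite_sum:
  fixes f :: "'i \<Rightarrow> 'a \<Rightarrow> real"
  assumes "\<And>k. k \<in> I \<Longrightarrow> set_integrable M A (f k)"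
  shows "set_integrable M A (\<lambda>x. \<Sum>k\<in>I. f k x)"
  using assms unfolding set_integrable_def scaleR_sum_right by (intro Bochner_Integration.integrable_sum)

lemma cell_integral_const: "T > 0 \<Longrightarrow> (LINT x:(cell T :: (real^'n::finite) set)|lborel. c::real) = T ^ CARD('n) * c"
proof -
  assume T: "T > 0"
  have "emeasure lborel (cell T :: (real^'n) set) = ennreal (T ^ CARD('n))"
    using nn_integral_cell_const[OF T, where c=1 and 'n='n] by simp
  then have "measure lborel (cell T :: (real^'n) set) = T ^ CARD('n)"
    and "emeasure lborel (cell T :: (real^'n) set) \<noteq> \<infinity>"
    using T by (simp_all add: measure_def)
  then show ?thesis by (subst set_integral_const) auto
qed

lemma cell_integrable_fourth_power:
  assumes dim: "CARD('n::finite) \<in> {2, 3}" and T: "T > 0"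
  shows "\<exists>C\<ge>0. \<forall>(v :: real ^ 'n \<Rightarrow> complex) g. gradient T v g \<longrightarrow>
     set_integrable lborel (cell T) (\<lambda>x. (cmod (v x))^4) \<and>
     (LINT x:cell T|lborel. (cmod (v x))^4) \<le> C * (LINT x:cell T|lborel. (\<Sum>k\<in>UNIV. (cmod (g k x))\<^sup>2) + (cmod (v x))\<^sup>2)\<^sup>2"
proof -
  obtain C where C: "C \<ge> 0" "\<forall>(v :: real ^ 'n \<Rightarrow> complex) g. gradient T v g \<longrightarrow>
     cell_int T (\<lambda>x. ennreal ((norm (v x))^4)) \<le> ennreal C * (H1_energy T v g)\<^sup>2"
    using L4_embedding[OF dim T] by blast
  show ?thesis
  proof (intro exI[of _ C] conjI[OF C(1)] allI impI)
    fix v :: "real ^ 'n \<Rightarrow> complex" and g assume g: "gradient T v g"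
    note gD = gradientD[OF g]
    note [measurable] = gD(4,5)
    define E where "E = (LINT x:cell T|lborel. (\<Sum>k\<in>UNIV. (cmod (g k x))\<^sup>2) + (cmod (v x))\<^sup>2)"
    have int: "set_integrable lborel (cell T) (\<lambda>x. (\<Sum>k\<in>UNIV. (cmod (g k x))\<^sup>2) + (cmod (v x))\<^sup>2)"
      by (intro set_integral_add set_integrable_finite_sum cell_integrable_square gD)
    have E0: "E \<ge> 0" unfolding E_def set_lebesgue_integral_def
      by (intro Bochner_Integration.integral_nonneg) (auto intro!: mult_nonneg_nonneg add_nonneg_nonneg sum_nonneg)
    have "H1_energy T v g = ennreal E" unfolding H1_energy_def E_def
      by (rule cell_nn_integral_eq[OF int]) (auto intro!: add_nonneg_nonneg sum_nonneg)
    moreover have "cell_int T (\<lambda>x. ennreal ((norm (v x))^4)) \<le> ennreal C * (H1_energy T v g)\<^sup>2"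
      using C(2) g by blast
    ultimately have le: "cell_int T (\<lambda>x. ennreal ((norm (v x))^4)) \<le> ennreal (C * E\<^sup>2)"
      using C(1) E0 by (simp add: ennreal_power ennreal_mult)
    have int4: "set_integrable lborel (cell T) (\<lambda>x. (cmod (v x))^4)"
    proof (rule cell_integrableI)
      show "cell_int T (\<lambda>x. ennreal ((cmod (v x))^4)) < \<infinity>"
        using le by (rule le_less_trans) simp
    qed simp_all
    moreover have "(LINT x:cell T|lborel. (cmod (v x))^4) \<le> C * E\<^sup>2"
    proof -
      have "ennreal (LINT x:cell T|lborel. (cmod (v x))^4) \<le> ennreal (C * E\<^sup>2)"
        using le cell_nn_integral_eq[OF int4] by simp
      then show ?thesis using C(1) by (subst (asm) ennreal_le_iff) auto
    qed
    ultimately show "set_integrable lborel (cell T) (\<lambda>x. (cmod (v x))^4) \<and>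
      (LINT x:cell T|lborel. (cmod (v x))^4) \<le> C * (LINT x:cell T|lborel. (\<Sum>k\<in>UNIV. (cmod (g k x))\<^sup>2) + (cmod (v x))\<^sup>2)\<^sup>2"
      unfolding E_def by blast
  qed
qed

definition action_density :: "'n \<Rightarrow> real \<Rightarrow> complex \<Rightarrow> ('n::finite \<Rightarrow> complex) \<Rightarrow> real" where
  "action_density k\<^sub>1 c z \<gamma> = 1 / 2 * (\<Sum>k\<in>UNIV. (cmod (\<gamma> k))\<^sup>2) + 1 / 4 * (1 - (cmod z)\<^sup>2)\<^sup>2 - c / 2 * ((\<i> * \<gamma> k\<^sub>1) \<bullet> z)"

lemma weak_pderiv_eq_gradient:
  assumes "gradient T w g"
  shows "AE x in lborel. \<forall>k. weak_pderiv k w x = g k x" "weak_pderiv k w \<in> borel_measurable borel"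
proof -
  have "\<forall>k. AE x in lborel. weak_pderiv k w x = g k x"
    using weak_pderiv_properties(2)[OF gradientD(3)[OF assms]] by blast
  then show "AE x in lborel. \<forall>k. weak_pderiv k w x = g k x" by (subst AE_all_countable)
  show "weak_pderiv k w \<in> borel_measurable borel"
    using weak_pderiv_properties(3)[OF gradientD(3)[OF assms]] .
qed

text \<open>The fourth power is integrable by the \<open>L\<^sup>4\<close> embedding, so that none of the integrals takes the default
  value 0 of a non-integrable function.\<close>

lemma action_eq:
  fixes w :: "real ^ 'n::finite \<Rightarrow> complex"
  assumes dim: "CARD('n) \<in> {2, 3}" and T: "T > 0" and g: "gradient T w g"
  shows "set_integrable lborel (cell T) (\<lambda>x. action_density k\<^sub>1 c (w x) (\<lambda>k. g k x))"
    and "action k\<^sub>1 c T w = (LINT x:cell T|lborel. action_density k\<^sub>1 c (w x) (\<lambda>k. g k x))"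
proof -
  note gD = gradientD[OF g]
  note [measurable] = gD(4,5) weak_pderiv_eq_gradient(2)[OF g]
  have i1: "set_integrable lborel (cell T) (\<lambda>x. \<Sum>k\<in>UNIV. (cmod (g k x))\<^sup>2)"
    by (intro set_integrable_finite_sum cell_integrable_square gD)
  have i4: "set_integrable lborel (cell T) (\<lambda>x. (cmod (w x))^4)"
    using cell_integrable_fourth_power[OF dim T] g by blast
  have i2: "set_integrable lborel (cell T) (\<lambda>x. (1 - (cmod (w x))\<^sup>2)\<^sup>2)"
  proof (rule set_integrable_dominated[OF _ cell_sets])
    show "set_integrable lborel (cell T) (\<lambda>x. 1 + (cmod (w x))^4)"
      by (intro set_integral_add set_integrable_compact_const[OF compact_cell] i4)
    show "norm ((1 - (cmod (w x))\<^sup>2)\<^sup>2) \<le> 1 + (cmod (w x))^4" for x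
    proof -
      have eq: "(1 - (cmod (w x))\<^sup>2)\<^sup>2 = 1 + (cmod (w x))^4 - 2 * (cmod (w x))\<^sup>2"
        by (simp add: power2_diff flip: power_mult)
      then show ?thesis using zero_le_power2[of "1 - (cmod (w x))\<^sup>2"] zero_le_power2[of "cmod (w x)"]
        unfolding real_norm_def abs_of_nonneg[OF zero_le_power2] by linarith
    qed
  qed measurable
  have i3: "set_integrable lborel (cell T) (\<lambda>x. (\<i> * g k\<^sub>1 x) \<bullet> w x)"
    by (intro cell_integrable_inner L2_loc_cmult gD)
  note eq = weak_pderiv_eq_gradient(1)[OF g]
  have a1: "(LINT x:cell T|lborel. (\<Sum>k\<in>UNIV. (cmod (weak_pderiv k w x))\<^sup>2)) = (LINT x:cell T|lborel. (\<Sum>k\<in>UNIV. (cmod (g k x))\<^sup>2))"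
    by (rule set_lebesgue_integral_cong_AE) (use eq in \<open>auto elim!: eventually_mono\<close>)
  have a3: "(LINT x:cell T|lborel. (\<i> * weak_pderiv k\<^sub>1 w x) \<bullet> w x) = (LINT x:cell T|lborel. (\<i> * g k\<^sub>1 x) \<bullet> w x)"
    by (rule set_lebesgue_integral_cong_AE) (use eq in \<open>auto elim!: eventually_mono\<close>)
  show "set_integrable lborel (cell T) (\<lambda>x. action_density k\<^sub>1 c (w x) (\<lambda>k. g k x))"
    unfolding action_density_def by (intro set_integral_diff set_integral_add set_integrable_mult_right i1 i2 i3) 
  show "action k\<^sub>1 c T w = (LINT x:cell T|lborel. action_density k\<^sub>1 c (w x) (\<lambda>k. g k x))"
    unfolding action_density_def action_def a1 a3
    using i1 i2 i3 by (simp add: set_integral_diff set_integral_add set_integrable_mult_right)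
qed

lemma H1_norm_square:
  fixes v :: "real ^ 'n::finite \<Rightarrow> complex"
  assumes g: "gradient T v g"
  shows "(H1_norm T v)\<^sup>2 = (LINT x:cell T|lborel. (\<Sum>k\<in>UNIV. (cmod (g k x))\<^sup>2) + (cmod (v x))\<^sup>2)"
    and "H1_norm T v \<ge> 0"
proof -
  note gD = gradientD[OF g]
  note [measurable] = gD(4,5) weak_pderiv_eq_gradient(2)[OF g]
  note eq = weak_pderiv_eq_gradient(1)[OF g]
  have "H1_inner T v v = (LINT x:cell T|lborel. (\<Sum>k\<in>UNIV. (cmod (g k x))\<^sup>2) + (cmod (v x))\<^sup>2)"
    unfolding H1_inner_def
    by (rule set_lebesgue_integral_cong_AE) (use eq in \<open>auto elim!: eventually_mono simp: power2_norm_eq_inner\<close>)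
  moreover have nn: "(LINT x:cell T|lborel. (\<Sum>k\<in>UNIV. (cmod (g k x))\<^sup>2) + (cmod (v x))\<^sup>2) \<ge> 0"
    unfolding set_lebesgue_integral_def
    by (intro Bochner_Integration.integral_nonneg) (auto intro!: mult_nonneg_nonneg add_nonneg_nonneg sum_nonneg)
  ultimately show "(H1_norm T v)\<^sup>2 = (LINT x:cell T|lborel. (\<Sum>k\<in>UNIV. (cmod (g k x))\<^sup>2) + (cmod (v x))\<^sup>2)"
    "H1_norm T v \<ge> 0" by (simp_all add: H1_norm_def)
qed

section \<open>The lower bound for the action\<close>

text \<open>The square is completed in the distinguished derivative, and the other derivatives are dropped.\<close>

lemma action_density_lower_bound:
  fixes \<gamma> :: "'n::finite \<Rightarrow> complex" and c :: real
  defines "\<mu> \<equiv> c / 2"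
  shows "1 / 2 * (cmod (\<gamma> k\<^sub>1 + \<i> * \<mu> * z))\<^sup>2 + (1 / 4 * (1 - (cmod z)\<^sup>2)\<^sup>2 - \<mu>\<^sup>2 / 2 * (cmod z)\<^sup>2) \<le> action_density k\<^sub>1 c z \<gamma>"
proof -
  have "(cmod (\<gamma> k\<^sub>1 + \<i> * \<mu> * z))\<^sup>2 = (cmod (\<gamma> k\<^sub>1))\<^sup>2 - 2 * \<mu> * ((\<i> * \<gamma> k\<^sub>1) \<bullet> z) + \<mu>\<^sup>2 * (cmod z)\<^sup>2"
    by (simp only: cmod_power2) (simp add: inner_complex_def power2_eq_square algebra_simps)
  moreover have "(cmod (\<gamma> k\<^sub>1))\<^sup>2 \<le> (\<Sum>k\<in>UNIV. (cmod (\<gamma> k))\<^sup>2)" by (rule member_le_sum) auto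
  ultimately show ?thesis unfolding action_density_def \<mu>_def[symmetric] by (simp add: field_simps)
qed

text \<open>The spectral inequality leaves the integral of a quadratic polynomial in the squared
  modulus, whose minimum is attained at \<open>1 + a\<close>.\<close>

theorem action_lower_bound:
  fixes w :: "real ^ 'n::finite \<Rightarrow> complex" and c :: real
  assumes dim: "CARD('n) \<in> {2, 3}" and T: "T > 0" and w: "w \<in> H1_per T"
    and d: "d \<ge> 0" "\<And>m::int. d \<le> \<bar>c / 2 + 2 * pi * m / T\<bar>"
  defines "a \<equiv> (c / 2)\<^sup>2 - d\<^sup>2"
  shows "T ^ CARD('n) * (- (a\<^sup>2 / 4) - a / 2) \<le> action k\<^sub>1 c T w"
proof -
  obtain g where g: "gradient T w g" using H1_per_gradient[of T w] T w by auto
  note gD = gradientD[OF g]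
  define \<mu> where "\<mu> = c / 2"
  define G where "G x = g k\<^sub>1 x + \<i> * \<mu> * w x" for x
  have G: "G \<in> L2_loc" unfolding G_def[abs_def] by (intro L2_loc_add L2_loc_cmult gD)
  note iG = cell_integrable_square[OF G, of T] and iw = cell_integrable_square[OF gD(1), of T]
  note sp = spectral_inequality[OF g T d[folded \<mu>_def], of k\<^sub>1, folded G_def]
  have "d\<^sup>2 * (LINT x:cell T|lborel. (cmod (w x))\<^sup>2) \<le> (LINT x:cell T|lborel. (cmod (G x))\<^sup>2)"
  proof -
    have nn: "0 \<le> (LINT x:cell T|lborel. (cmod (u x))\<^sup>2)" for u :: "real^'n \<Rightarrow> complex"
      unfolding set_lebesgue_integral_def by (intro Bochner_Integration.integral_nonneg) auto
    from sp have "ennreal (d\<^sup>2 * (LINT x:cell T|lborel. (cmod (w x))\<^sup>2)) \<le> ennreal (LINT x:cell T|lborel. (cmod (G x))\<^sup>2)"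
      unfolding cell_nn_integral_eq[OF iG zero_le_power2] cell_nn_integral_eq[OF iw zero_le_power2]
      using nn by (simp add: ennreal_mult)
    then show ?thesis using nn by (subst (asm) ennreal_le_iff) auto
  qed
  moreover have i2: "set_integrable lborel (cell T) (\<lambda>x. a / 2 * (cmod (w x))\<^sup>2 + (- (a\<^sup>2 / 4) - a / 2))"
    by (intro set_integral_add set_integrable_mult_right set_integrable_compact_const[OF compact_cell] iw)
  have "(LINT x:cell T|lborel. 1 / 2 * (cmod (G x))\<^sup>2 - d\<^sup>2 / 2 * (cmod (w x))\<^sup>2 + (- (a\<^sup>2 / 4) - a / 2)) \<le>
      (LINT x:cell T|lborel. action_density k\<^sub>1 c (w x) (\<lambda>k. g k x))"
  proof (rule set_integral_mono)
    show "set_integrable lborel (cell T) (\<lambda>x. 1 / 2 * (cmod (G x))\<^sup>2 - d\<^sup>2 / 2 * (cmod (w x))\<^sup>2 + (- (a\<^sup>2 / 4) - a / 2))"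
      by (intro set_integral_add set_integral_diff set_integrable_mult_right set_integrable_compact_const[OF compact_cell] iw iG)
    show "set_integrable lborel (cell T) (\<lambda>x. action_density k\<^sub>1 c (w x) (\<lambda>k. g k x))"
      by (rule action_eq[OF dim T g])
    fix x
    let ?s = "(cmod (w x))\<^sup>2"
    have "1 / 4 * (1 - ?s)\<^sup>2 - \<mu>\<^sup>2 / 2 * ?s = 1 / 4 * (?s - 1 - a)\<^sup>2 - d\<^sup>2 / 2 * ?s + (- (a\<^sup>2 / 4) - a / 2)"
      by (simp add: a_def \<mu>_def power2_eq_square field_simps)
    then have "1 / 2 * (cmod (G x))\<^sup>2 - d\<^sup>2 / 2 * ?s + (- (a\<^sup>2 / 4) - a / 2) \<le>
       1 / 2 * (cmod (G x))\<^sup>2 + (1 / 4 * (1 - ?s)\<^sup>2 - \<mu>\<^sup>2 / 2 * ?s)"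
      using zero_le_power2[of "?s - 1 - a"] by linarith
    also have "\<dots> \<le> action_density k\<^sub>1 c (w x) (\<lambda>k. g k x)"
      using action_density_lower_bound[of "\<lambda>k. g k x" k\<^sub>1 c "w x"] by (simp add: G_def \<mu>_def)
    finally show "1 / 2 * (cmod (G x))\<^sup>2 - d\<^sup>2 / 2 * ?s + (- (a\<^sup>2 / 4) - a / 2) \<le> action_density k\<^sub>1 c (w x) (\<lambda>k. g k x)" .
  qed
  moreover have "(LINT x:cell T|lborel. 1 / 2 * (cmod (G x))\<^sup>2 - d\<^sup>2 / 2 * (cmod (w x))\<^sup>2 + (- (a\<^sup>2 / 4) - a / 2)) =
     1 / 2 * (LINT x:cell T|lborel. (cmod (G x))\<^sup>2) - d\<^sup>2 / 2 * (LINT x:cell T|lborel. (cmod (w x))\<^sup>2) + T ^ CARD('n) * (- (a\<^sup>2 / 4) - a / 2)"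
  proof -
    have "(LINT x:cell T|lborel. 1 / 2 * (cmod (G x))\<^sup>2 - d\<^sup>2 / 2 * (cmod (w x))\<^sup>2 + (- (a\<^sup>2 / 4) - a / 2)) =
      (LINT x:cell T|lborel. 1 / 2 * (cmod (G x))\<^sup>2 - d\<^sup>2 / 2 * (cmod (w x))\<^sup>2) + (LINT x:(cell T::(real^'n) set)|lborel. (- (a\<^sup>2 / 4) - a / 2))"
      by (intro set_integral_add set_integral_diff set_integrable_mult_right set_integrable_compact_const[OF compact_cell] iw iG)
    also have "(LINT x:cell T|lborel. 1 / 2 * (cmod (G x))\<^sup>2 - d\<^sup>2 / 2 * (cmod (w x))\<^sup>2) =
      (LINT x:cell T|lborel. 1 / 2 * (cmod (G x))\<^sup>2) - (LINT x:cell T|lborel. d\<^sup>2 / 2 * (cmod (w x))\<^sup>2)"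
      by (intro set_integral_diff set_integrable_mult_right iw iG)
    finally show ?thesis by (simp only: set_integral_mult_right cell_integral_const[OF T])
  qed
  ultimately show ?thesis using action_eq(2)[OF dim T g, of k\<^sub>1 c] by linarith
qed

section \<open>Plane waves\<close>

definition plane_wave :: "'n \<Rightarrow> real \<Rightarrow> real \<Rightarrow> real ^ 'n::finite \<Rightarrow> complex" where
  "plane_wave k\<^sub>1 \<rho> \<kappa> x = \<rho> * cis (- (\<kappa> * x $ k\<^sub>1))"

definition plane_wave_grad :: "'n \<Rightarrow> real \<Rightarrow> real \<Rightarrow> 'n \<Rightarrow> real ^ 'n::finite \<Rightarrow> complex" where
  "plane_wave_grad k\<^sub>1 \<rho> \<kappa> k x = (if k = k\<^sub>1 then - (\<i> * \<kappa> * plane_wave k\<^sub>1 \<rho> \<kappa> x) else 0)"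

lemma plane_wave_gradient:
  fixes k\<^sub>1 :: "'n::finite"
  assumes per: "\<kappa> * T = 2 * pi * of_int m"
  shows "gradient T (plane_wave k\<^sub>1 \<rho> \<kappa>) (plane_wave_grad k\<^sub>1 \<rho> \<kappa>)"
proof -
  have c: "continuous_on UNIV (plane_wave k\<^sub>1 \<rho> \<kappa>)"
    unfolding plane_wave_def[abs_def] by (intro continuous_intros)
  have c': "continuous_on UNIV (plane_wave_grad k\<^sub>1 \<rho> \<kappa> k)" for k
    unfolding plane_wave_grad_def[abs_def] by (cases "k = k\<^sub>1") (auto intro!: continuous_intros c)
  have periodic: "plane_wave k\<^sub>1 \<rho> \<kappa> (x + axis k T) = plane_wave k\<^sub>1 \<rho> \<kappa> x" for x k
  proof (cases "k = k\<^sub>1")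
    case True
    have "- (\<kappa> * (x + axis k T) $ k\<^sub>1) = - (\<kappa> * x $ k\<^sub>1) + 2 * pi * of_int (- m)"
      using True per by (simp add: algebra_simps)
    then have "cis (- (\<kappa> * (x + axis k T) $ k\<^sub>1)) = cis (- (\<kappa> * x $ k\<^sub>1)) * cis (2 * pi * of_int (- m))"
      by (simp only: cis_mult)
    then show ?thesis unfolding plane_wave_def by (simp add: cis_multiple_2pi del: of_int_minus)
  qed (simp add: plane_wave_def axis_def)
  have w: "has_weak_pderiv k (plane_wave k\<^sub>1 \<rho> \<kappa>) (plane_wave_grad k\<^sub>1 \<rho> \<kappa> k)" for k
  proof -
    define \<alpha> where "\<alpha> = (if k = k\<^sub>1 then - \<kappa> else 0)"
    have "has_weak_pderiv k (plane_wave k\<^sub>1 \<rho> \<kappa>) (\<lambda>x. \<i> * \<alpha> * plane_wave k\<^sub>1 \<rho> \<kappa> x)"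
    proof (rule has_weak_pderiv_character)
      show "plane_wave k\<^sub>1 \<rho> \<kappa> \<in> L1_loc" by (intro L2_loc_imp_L1_loc continuous_L2_loc c)
      fix x s
      have "- (\<kappa> * (x + s *\<^sub>R axis k 1) $ k\<^sub>1) = \<alpha> * s + - (\<kappa> * x $ k\<^sub>1)"
        by (simp add: \<alpha>_def axis_def algebra_simps)
      then show "plane_wave k\<^sub>1 \<rho> \<kappa> (x + s *\<^sub>R axis k 1) = cis (\<alpha> * s) * plane_wave k\<^sub>1 \<rho> \<kappa> x"
        unfolding plane_wave_def by (simp only: cis_mult[symmetric] mult_ac)
    qed
    also have "(\<lambda>x. \<i> * \<alpha> * plane_wave k\<^sub>1 \<rho> \<kappa> x) = plane_wave_grad k\<^sub>1 \<rho> \<kappa> k"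
      by (auto simp: \<alpha>_def plane_wave_grad_def)
    finally show ?thesis .
  qed
  show ?thesis
    unfolding gradient_def
  proof (intro conjI allI)
    show "plane_wave k\<^sub>1 \<rho> \<kappa> \<in> L2_loc" "plane_wave_grad k\<^sub>1 \<rho> \<kappa> k \<in> L2_loc" for k
      by (rule continuous_L2_loc; rule c c')+
    show "periodic T (plane_wave k\<^sub>1 \<rho> \<kappa>)" "periodic T (plane_wave_grad k\<^sub>1 \<rho> \<kappa> k)" for k
      using periodic by (auto simp: periodic_def plane_wave_grad_def)
  qed (rule w)
qed

lemma plane_wave_norm: "\<rho> \<ge> 0 \<Longrightarrow> cmod (plane_wave k\<^sub>1 \<rho> \<kappa> x) = \<rho>"
  by (simp add: plane_wave_def norm_mult)

lemma plane_wave_action: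
  fixes k\<^sub>1 :: "'n::finite" and c \<kappa> :: real
  assumes dim: "CARD('n) \<in> {2, 3}" and T: "T > 0" and per: "\<kappa> * T = 2 * pi * of_int m" and \<rho>: "\<rho> \<ge> 0"
  defines "a \<equiv> (c / 2)\<^sup>2 - (c / 2 - \<kappa>)\<^sup>2"
  assumes \<rho>2: "\<rho>\<^sup>2 = 1 + a"
  shows "action k\<^sub>1 c T (plane_wave k\<^sub>1 \<rho> \<kappa>) = T ^ CARD('n) * (- (a\<^sup>2 / 4) - a / 2)"
proof -
  have "action_density k\<^sub>1 c (plane_wave k\<^sub>1 \<rho> \<kappa> x) (\<lambda>k. plane_wave_grad k\<^sub>1 \<rho> \<kappa> k x) = - (a\<^sup>2 / 4) - a / 2" for x
  proof -
    define z where "z = plane_wave k\<^sub>1 \<rho> \<kappa> x"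
    have z: "(cmod z)\<^sup>2 = 1 + a" unfolding z_def using \<rho>2 plane_wave_norm[OF \<rho>, of k\<^sub>1 \<kappa> x] by simp
    have sum: "(\<Sum>k\<in>UNIV. (cmod (plane_wave_grad k\<^sub>1 \<rho> \<kappa> k x))\<^sup>2) = \<kappa>\<^sup>2 * (1 + a)"
    proof -
      have "(\<Sum>k\<in>UNIV. (cmod (plane_wave_grad k\<^sub>1 \<rho> \<kappa> k x))\<^sup>2) = (\<Sum>k\<in>UNIV. if k = k\<^sub>1 then \<kappa>\<^sup>2 * (1 + a) else 0)"
        by (intro sum.cong refl) (auto simp: plane_wave_grad_def z_def[symmetric] norm_mult power_mult_distrib z)
      then show ?thesis by simp
    qed
    have "(\<i> * plane_wave_grad k\<^sub>1 \<rho> \<kappa> k\<^sub>1 x) \<bullet> z = \<kappa> * (cmod z)\<^sup>2"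
      unfolding cmod_power2
      by (simp add: plane_wave_grad_def z_def[symmetric] inner_complex_def power2_eq_square algebra_simps)
    then have "action_density k\<^sub>1 c z (\<lambda>k. plane_wave_grad k\<^sub>1 \<rho> \<kappa> k x) = 1 / 2 * (\<kappa>\<^sup>2 * (1 + a)) + 1 / 4 * a\<^sup>2 - c / 2 * (\<kappa> * (1 + a))"
      unfolding action_density_def sum z by (simp add: z)
    also have "\<dots> = 1 / 2 * (1 + a) * (\<kappa>\<^sup>2 - c * \<kappa>) + 1 / 4 * a\<^sup>2" by (simp add: algebra_simps)
    also have "\<kappa>\<^sup>2 - c * \<kappa> = - a" by (simp add: a_def power2_eq_square algebra_simps)
    also have "1 / 2 * (1 + a) * - a + 1 / 4 * a\<^sup>2 = - (a\<^sup>2 / 4) - a / 2"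
      by (simp add: power2_eq_square field_simps)
    finally show ?thesis unfolding z_def .
  qed
  then show ?thesis
    by (simp add: action_eq(2)[OF dim T plane_wave_gradient[OF per]] cell_integral_const[OF T])
qed

text \<open>A translation by half a wave length changes the sign.\<close>

lemma plane_wave_nonconstant:
  fixes k\<^sub>1 :: "'n::finite"
  assumes \<rho>: "\<rho> > 0" and \<kappa>: "\<kappa> \<noteq> 0"
  shows "nonconstant (plane_wave k\<^sub>1 \<rho> \<kappa>)"
  unfolding nonconstant_def
proof
  assume "\<exists>z. AE x in lborel. plane_wave k\<^sub>1 \<rho> \<kappa> x = z"
  then obtain z where z: "AE x in lborel. plane_wave k\<^sub>1 \<rho> \<kappa> x = z" by blast
  from AE_lborel_shift[OF this, of "axis k\<^sub>1 (pi / \<kappa>)"] z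
  have "AE x::real^'n in lborel. False"
  proof eventually_elim
    case (elim x)
    have "- (\<kappa> * (x + axis k\<^sub>1 (pi / \<kappa>)) $ k\<^sub>1) = - (\<kappa> * x $ k\<^sub>1) - pi" using \<kappa> by (simp add: algebra_simps)
    then have "plane_wave k\<^sub>1 \<rho> \<kappa> (x + axis k\<^sub>1 (pi / \<kappa>)) = - plane_wave k\<^sub>1 \<rho> \<kappa> x"
      unfolding plane_wave_def by (simp add: cis_divide[symmetric])
    with elim have "z = 0" by simp
    with elim(2) plane_wave_norm[of \<rho> k\<^sub>1 \<kappa> x] \<rho> show False by simp
  qed
  then have "ae_filter (lborel :: (real^'n) measure) = bot" by (simp add: eventually_False)
  then show False by (simp add: ae_filter_eq_bot_iff)
qed

section \<open>Minimizers of constant modulus are critical points\<close>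

lemma first_order_coefficient_zero:
  fixes l B :: real
  assumes "\<And>t. \<bar>t\<bar> \<le> 1 \<Longrightarrow> 0 \<le> l * t + B * t\<^sup>2"
  shows "l = 0"
proof -
  have "((\<lambda>t. l * t + B * t\<^sup>2) has_real_derivative l) (at 0)"
    by (auto intro!: derivative_eq_intros)
  then show ?thesis
    by (rule DERIV_local_min[of _ _ 0 1]) (use assms in auto)
qed

text \<open>The density is a polynomial of degree four in \<open>t\<close>; once the terms of order zero and one are
  subtracted, a factor \<open>t\<^sup>2\<close> splits off.\<close>

lemma action_density_expansion:
  fixes z w :: complex and p g :: "'n::finite \<Rightarrow> complex" and c t :: real
  defines "s \<equiv> (cmod z)\<^sup>2" and "\<beta> \<equiv> z \<bullet> w" and "\<nu> \<equiv> (cmod w)\<^sup>2"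
  shows "action_density k\<^sub>1 c (z + t * w) (\<lambda>k. p k + t * g k) - action_density k\<^sub>1 c z p
     - t * ((\<Sum>k\<in>UNIV. p k \<bullet> g k) - (1 - s) * \<beta> - c / 2 * ((\<i> * g k\<^sub>1) \<bullet> z + (\<i> * p k\<^sub>1) \<bullet> w))
   = t\<^sup>2 * (1 / 2 * (\<Sum>k\<in>UNIV. (cmod (g k))\<^sup>2) - (1 - s) / 2 * \<nu> + (\<beta> + t / 2 * \<nu>)\<^sup>2 - c / 2 * ((\<i> * g k\<^sub>1) \<bullet> w))"
proof -
  have sq: "(cmod (z + of_real t * w))\<^sup>2 = (cmod z)\<^sup>2 + 2 * t * (z \<bullet> w) + t\<^sup>2 * (cmod w)\<^sup>2" for z w
    unfolding cmod_power2 by (simp add: inner_complex_def power2_eq_square algebra_simps)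
  have 1: "(\<Sum>k\<in>UNIV. (cmod (p k + of_real t * g k))\<^sup>2) =
    (\<Sum>k\<in>UNIV. (cmod (p k))\<^sup>2) + 2 * t * (\<Sum>k\<in>UNIV. p k \<bullet> g k) + t\<^sup>2 * (\<Sum>k\<in>UNIV. (cmod (g k))\<^sup>2)"
    unfolding sq by (simp add: sum.distrib sum_distrib_left)
  have 2: "(\<i> * (p k\<^sub>1 + of_real t * g k\<^sub>1)) \<bullet> (z + of_real t * w) =
    (\<i> * p k\<^sub>1) \<bullet> z + t * ((\<i> * g k\<^sub>1) \<bullet> z + (\<i> * p k\<^sub>1) \<bullet> w) + t\<^sup>2 * ((\<i> * g k\<^sub>1) \<bullet> w)"
    by (simp add: inner_complex_def power2_eq_square algebra_simps)
  have "1 / 2 * (S0 + 2 * t * S1 + t\<^sup>2 * S2) + 1 / 4 * (1 - (s + 2 * t * \<beta> + t\<^sup>2 * \<nu>))\<^sup>2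
      - c / 2 * (I0 + t * I1 + t\<^sup>2 * I2) - (1 / 2 * S0 + 1 / 4 * (1 - s)\<^sup>2 - c / 2 * I0)
      - t * (S1 - (1 - s) * \<beta> - c / 2 * I1)
    = t\<^sup>2 * (1 / 2 * S2 - (1 - s) / 2 * \<nu> + (\<beta> + t / 2 * \<nu>)\<^sup>2 - c / 2 * I2)" for S0 S1 S2 I0 I1 I2 :: real
    by (simp add: field_simps power2_eq_square)
  then show ?thesis
    unfolding action_density_def 1 2 sq[of z w] s_def[symmetric] \<beta>_def[symmetric] \<nu>_def[symmetric] .
qed

text \<open>Young inequalities bound every term by the \<open>H\<^sup>1\<close> density of \<open>w\<close>, apart from a contribution of the
  fourth power of its modulus. The factor depends on \<open>z\<close> only through its modulus.\<close>

lemma action_density_remainder: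
  fixes z w :: complex and g :: "'n::finite \<Rightarrow> complex" and c t :: real
  defines "s \<equiv> (cmod z)\<^sup>2" and "\<beta> \<equiv> z \<bullet> w" and "\<nu> \<equiv> (cmod w)\<^sup>2"
  assumes t: "\<bar>t\<bar> \<le> 1"
  shows "\<bar>1 / 2 * (\<Sum>k\<in>UNIV. (cmod (g k))\<^sup>2) - (1 - s) / 2 * \<nu> + (\<beta> + t / 2 * \<nu>)\<^sup>2 - c / 2 * ((\<i> * g k\<^sub>1) \<bullet> w)\<bar>
    \<le> (1 / 2 + \<bar>1 - s\<bar> / 2 + 2 * s + \<bar>c\<bar> / 4) * ((\<Sum>k\<in>UNIV. (cmod (g k))\<^sup>2) + \<nu>) + \<nu>\<^sup>2"
proof -
  define S where "S = (\<Sum>k\<in>UNIV. (cmod (g k))\<^sup>2)"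
  define E where "E = S + \<nu>"
  have s0: "s \<ge> 0" and \<nu>0: "\<nu> \<ge> 0" and S: "S \<ge> 0" by (simp_all add: s_def \<nu>_def S_def sum_nonneg)
  then have SE: "S \<le> E" and \<nu>E: "\<nu> \<le> E" by (simp_all add: E_def)
  have "\<bar>(\<i> * g k\<^sub>1) \<bullet> w\<bar> \<le> cmod (\<i> * g k\<^sub>1) * cmod w" by (rule Cauchy_Schwarz_ineq2)
  also have "\<dots> \<le> 1 / 2 * ((cmod (g k\<^sub>1))\<^sup>2 + \<nu>)"
    using zero_le_power2[of "cmod (g k\<^sub>1) - cmod w"] by (simp add: norm_mult \<nu>_def power2_diff)
  also have "(cmod (g k\<^sub>1))\<^sup>2 + \<nu> \<le> E" unfolding E_def S_def by (intro add_right_mono member_le_sum) auto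
  finally have "\<bar>c / 2 * ((\<i> * g k\<^sub>1) \<bullet> w)\<bar> \<le> \<bar>c\<bar> / 2 * (1 / 2 * E)"
    unfolding abs_mult by (intro mult_mono) auto
  moreover have "\<bar>(1 - s) / 2 * \<nu>\<bar> \<le> \<bar>1 - s\<bar> / 2 * E"
    unfolding abs_mult using \<nu>E \<nu>0 by (intro mult_mono) auto
  moreover have "(\<beta> + t / 2 * \<nu>)\<^sup>2 \<le> 2 * s * E + \<nu>\<^sup>2"
  proof -
    have "\<bar>\<beta>\<bar> \<le> cmod z * cmod w" unfolding \<beta>_def by (rule Cauchy_Schwarz_ineq2)
    from power_mono[OF this abs_ge_zero, of 2] have "\<beta>\<^sup>2 \<le> s * \<nu>"
      by (simp add: power_mult_distrib s_def \<nu>_def)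
    also have "\<dots> \<le> s * E" using \<nu>E s0 by (rule mult_left_mono)
    finally have "\<beta>\<^sup>2 \<le> s * E" .
    moreover have "(t / 2 * \<nu>)\<^sup>2 \<le> 1 / 4 * \<nu>\<^sup>2"
      using t by (simp add: power_mult_distrib power_divide abs_square_le_1 mult_left_le_one_le)
    moreover have "(\<beta> + t / 2 * \<nu>)\<^sup>2 \<le> 2 * \<beta>\<^sup>2 + 2 * (t / 2 * \<nu>)\<^sup>2"
      using zero_le_power2[of "\<beta> - t / 2 * \<nu>"] by (simp only: power2_sum power2_diff)
    ultimately show ?thesis using zero_le_power2[of \<nu>] by linarith
  qed
  ultimately have "\<bar>1 / 2 * S - (1 - s) / 2 * \<nu> + (\<beta> + t / 2 * \<nu>)\<^sup>2 - c / 2 * ((\<i> * g k\<^sub>1) \<bullet> w)\<bar>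
      \<le> 1 / 2 * E + \<bar>1 - s\<bar> / 2 * E + (2 * s * E + \<nu>\<^sup>2) + \<bar>c\<bar> / 2 * (1 / 2 * E)"
    using S SE zero_le_power2[of "\<beta> + t / 2 * \<nu>"] by linarith
  also have "\<dots> = (1 / 2 + \<bar>1 - s\<bar> / 2 + 2 * s + \<bar>c\<bar> / 4) * E + \<nu>\<^sup>2" by (simp add: algebra_simps)
  finally show ?thesis unfolding E_def S_def .
qed

text \<open>A constant modulus makes the constants in the remainder independent of the point. Integrating the
  remainder gives a bound \<open>t\<^sup>2 B\<close> with \<open>B = O(\<parallel>v\<parallel>\<^sup>2 + \<parallel>v\<parallel>\<^sup>4)\<close>, the fourth power coming from the
  \<open>L\<^sup>4\<close> embedding. Minimality along the segment \<open>u + t v\<close> makes the coefficient of \<open>t\<close> vanish, and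
  \<open>t = 1\<close> is the assertion.\<close>

theorem critical_point_of_constant_modulus:
  fixes u :: "real ^ 'n::finite \<Rightarrow> complex"
  assumes dim: "CARD('n) \<in> {2, 3}" and T: "T > 0" and p: "gradient T u p"
    and s: "\<And>x. (cmod (u x))\<^sup>2 = s" and min: "global_minimizer T (action k\<^sub>1 c T) u"
  shows "critical_point T (action k\<^sub>1 c T) u"
proof -
  obtain C where C: "C \<ge> 0" "\<forall>(v :: real ^ 'n \<Rightarrow> complex) g. gradient T v g \<longrightarrow>
     set_integrable lborel (cell T) (\<lambda>x. (cmod (v x))^4) \<and>
     (LINT x:cell T|lborel. (cmod (v x))^4) \<le> C * (LINT x:cell T|lborel. (\<Sum>k\<in>UNIV. (cmod (g k x))\<^sup>2) + (cmod (v x))\<^sup>2)\<^sup>2"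
    using cell_integrable_fourth_power[OF dim T] by blast
  define C1 where "C1 = 1 / 2 + \<bar>1 - s\<bar> / 2 + 2 * s + \<bar>c\<bar> / 4"
  have s0: "s \<ge> 0" using s[of 0] zero_le_power2 by metis
  have bound: "\<bar>action k\<^sub>1 c T (\<lambda>x. u x + v x) - action k\<^sub>1 c T u\<bar> \<le> C1 * (H1_norm T v)\<^sup>2 + C * ((H1_norm T v)\<^sup>2)\<^sup>2"
    if v: "v \<in> H1_per T" for v
  proof -
    obtain g where g: "gradient T v g" using H1_per_gradient[of T v] T v by auto
    note pD = gradientD[OF p] and gD = gradientD[OF g]
    define E where "E x = (\<Sum>k\<in>UNIV. (cmod (g k x))\<^sup>2) + (cmod (v x))\<^sup>2" for x
    define dens where "dens t x = action_density k\<^sub>1 c (u x + of_real t * v x) (\<lambda>k. p k x + of_real t * g k x)" for t x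
    define d1 where "d1 x = (\<Sum>k\<in>UNIV. p k x \<bullet> g k x) - (1 - s) * (u x \<bullet> v x)
      - c / 2 * ((\<i> * g k\<^sub>1 x) \<bullet> u x + (\<i> * p k\<^sub>1 x) \<bullet> v x)" for x
    define B where "B = C1 * (H1_norm T v)\<^sup>2 + C * ((H1_norm T v)\<^sup>2)\<^sup>2"
    define l where "l = (LINT x:cell T|lborel. d1 x)"
    have iE: "set_integrable lborel (cell T) E"
      unfolding E_def[abs_def] by (intro set_integral_add set_integrable_finite_sum cell_integrable_square gD)
    have i4: "set_integrable lborel (cell T) (\<lambda>x. ((cmod (v x))\<^sup>2)\<^sup>2)"
      and E4: "(LINT x:cell T|lborel. ((cmod (v x))\<^sup>2)\<^sup>2) \<le> C * ((H1_norm T v)\<^sup>2)\<^sup>2"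
      using C(2) g by (simp_all add: H1_norm_square[OF g] flip: power_mult)
    have EN: "(LINT x:cell T|lborel. E x) = (H1_norm T v)\<^sup>2" by (simp add: H1_norm_square[OF g] E_def)
    have i1: "set_integrable lborel (cell T) d1" unfolding d1_def[abs_def]
      by (intro set_integral_diff set_integral_add set_integrable_finite_sum set_integrable_mult_right cell_integrable_inner L2_loc_cmult pD gD)
    have it: "set_integrable lborel (cell T) (dens t)"
      and A: "action k\<^sub>1 c T (\<lambda>x. u x + of_real t * v x) = (LINT x:cell T|lborel. dens t x)" for t
      using action_eq[OF dim T gradient_add_cmult[OF p g]] unfolding dens_def by auto
    have A0: "action k\<^sub>1 c T u = (LINT x:cell T|lborel. dens 0 x)" using A[of 0] by simp
    have remainder: "\<bar>action k\<^sub>1 c T (\<lambda>x. u x + of_real t * v x) - action k\<^sub>1 c T u - t * l\<bar> \<le> t\<^sup>2 * B" if t: "\<bar>t\<bar> \<le> 1" for t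
    proof -
      let ?r = "\<lambda>x. dens t x - dens 0 x - t * d1 x"
      let ?b = "\<lambda>x. t\<^sup>2 * (C1 * E x + ((cmod (v x))\<^sup>2)\<^sup>2)"
      have ir: "set_integrable lborel (cell T) ?r" by (intro set_integral_diff set_integrable_mult_right it i1)
      have ib: "set_integrable lborel (cell T) ?b" by (intro set_integral_add set_integrable_mult_right iE i4)
      have le: "\<bar>?r x\<bar> \<le> ?b x" for x
        unfolding dens_def d1_def s[of x, symmetric] of_real_0 mult_zero_left add_0_right
          action_density_expansion[of k\<^sub>1 c "u x" t "v x" "\<lambda>k. p k x" "\<lambda>k. g k x"] abs_mult
        using mult_left_mono[OF action_density_remainder[OF t, of "\<lambda>k. g k x" "u x" "v x" c k\<^sub>1], of "t\<^sup>2"]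
        by (simp add: C1_def E_def s)
      have "\<bar>LINT x:cell T|lborel. ?r x\<bar> \<le> (LINT x:cell T|lborel. \<bar>?r x\<bar>)"
        using integral_norm_bound[of lborel "\<lambda>x. indicator (cell T) x *\<^sub>R ?r x"] by (simp add: set_lebesgue_integral_def abs_mult)
      also have "\<dots> \<le> (LINT x:cell T|lborel. ?b x)"
        by (intro set_integral_mono set_integrable_abs ir ib le)
      also have "\<dots> = t\<^sup>2 * (C1 * (H1_norm T v)\<^sup>2 + (LINT x:cell T|lborel. ((cmod (v x))\<^sup>2)\<^sup>2))"
        unfolding EN[symmetric] using iE i4 by (simp add: set_integral_add set_integrable_mult_right)
      also have "\<dots> \<le> t\<^sup>2 * B" unfolding B_def using E4 by (intro mult_left_mono add_left_mono) auto
      also have "(LINT x:cell T|lborel. ?r x) = action k\<^sub>1 c T (\<lambda>x. u x + of_real t * v x) - action k\<^sub>1 c T u - t * l"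
        unfolding A A0 l_def using it i1 by (simp add: set_integral_diff set_integrable_mult_right)
      finally show ?thesis .
    qed
    have "0 \<le> l * t + B * t\<^sup>2" if t: "\<bar>t\<bar> \<le> 1" for t
    proof -
      have "(\<lambda>x. u x + of_real t * v x) \<in> H1_per T"
        by (rule gradient_imp_H1_per[OF gradient_add_cmult[OF p g]])
      then have "action k\<^sub>1 c T u \<le> action k\<^sub>1 c T (\<lambda>x. u x + of_real t * v x)"
        using min by (auto simp: global_minimizer_def)
      then show ?thesis using remainder[OF t] by (simp add: mult.commute)
    qed
    then have "l = 0" by (rule first_order_coefficient_zero)
    then show ?thesis using remainder[of 1] unfolding B_def by simp
  qed
  show ?thesis
    unfolding critical_point_def
  proof (intro conjI allI impI)
    show "u \<in> H1_per T" using min by (simp add: global_minimizer_def)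
    fix e :: real assume e: "e > 0"
    have C1: "C1 \<ge> 0" using s0 by (simp add: C1_def)
    \<comment> \<open>Below 1 the fourth power of the norm is at most its square.\<close>
    define d where "d = min 1 (e / (C1 + C + 1))"
    have d: "d > 0" "d \<le> 1" "d \<le> e / (C1 + C + 1)" using e C1 C(1) by (auto simp: d_def)
    have "\<bar>action k\<^sub>1 c T (\<lambda>x. u x + v x) - action k\<^sub>1 c T u\<bar> \<le> e * H1_norm T v"
      if v: "v \<in> H1_per T" "H1_norm T v < d" for v
    proof -
      define n where "n = H1_norm T v"
      obtain g where g: "gradient T v g" using H1_per_gradient[of T v] T v by auto
      have n: "n \<ge> 0" "n < d" using H1_norm_square(2)[OF g] v by (auto simp: n_def)
      have "n\<^sup>2 \<le> 1" using n d by (simp add: power_le_one)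
      then have "n\<^sup>2 * n\<^sup>2 \<le> n\<^sup>2 * 1" by (intro mult_left_mono) auto
      then have "(n\<^sup>2)\<^sup>2 \<le> n\<^sup>2" unfolding power2_eq_square[of "n\<^sup>2"] by simp
      then have "C1 * n\<^sup>2 + C * (n\<^sup>2)\<^sup>2 \<le> C1 * n\<^sup>2 + C * n\<^sup>2" using C(1) C1 by (intro add_mono mult_left_mono) auto
      also have "\<dots> \<le> (C1 + C + 1) * n * n" by (simp add: algebra_simps power2_eq_square)
      also have "\<dots> \<le> e * n"
      proof (rule mult_right_mono[OF _ n(1)])
        have "(C1 + C + 1) * n \<le> (C1 + C + 1) * (e / (C1 + C + 1))"
          using n d C1 C(1) by (intro mult_left_mono) auto
        also have "\<dots> = e" using C1 C(1) by simp
        finally show "(C1 + C + 1) * n \<le> e" .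
      qed
      finally show ?thesis using bound[OF v(1)] by (simp add: n_def)
    qed
    then show "\<exists>d>0. \<forall>v\<in>H1_per T. H1_norm T v < d \<longrightarrow> \<bar>action k\<^sub>1 c T (\<lambda>x. u x + v x) - action k\<^sub>1 c T u\<bar> \<le> e * H1_norm T v"
      using d(1) by blast
  qed
qed

theorem theorem1p1:
  fixes k\<^sub>1 :: "'n::finite"
  assumes "CARD('n) \<in> {2, 3}"
  shows "\<forall>c>0. \<exists>Tbar>0. \<forall>T>Tbar. \<exists>\<psi> :: real ^ 'n \<Rightarrow> complex.
           periodic_solution k\<^sub>1 c T \<psi> \<and> nonconstant \<psi> \<and>
           global_minimizer T (action k\<^sub>1 c T) \<psi> \<and> action k\<^sub>1 c T \<psi> < 0"
proof (intro allI impI)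
  fix c :: real assume c: "c > 0"
  have "\<exists>\<psi> :: real ^ 'n \<Rightarrow> complex. periodic_solution k\<^sub>1 c T \<psi> \<and> nonconstant \<psi> \<and>
           global_minimizer T (action k\<^sub>1 c T) \<psi> \<and> action k\<^sub>1 c T \<psi> < 0" if TT: "T > 2 * pi / c" for T
  proof -
    have T: "T > 0" using TT c by (meson divide_pos_pos less_trans mult_pos_pos pi_gt_zero zero_less_numeral)
    \<comment> \<open>The frequency \<open>c / 2\<close> in units of \<open>2 \<pi> / T\<close>; rounding it selects the wave number.\<close>
    define y where "y = c * T / (4 * pi)"
    define m where "m = round y"
    define \<kappa> where "\<kappa> = 2 * pi * m / T"
    define d where "d = \<bar>c / 2 - \<kappa>\<bar>"
    define a where "a = (c / 2)\<^sup>2 - (c / 2 - \<kappa>)\<^sup>2"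
    define \<rho> where "\<rho> = sqrt (1 + a)"
    \<comment> \<open>This is the condition on \<open>T\<close>: the frequency is nearer to some nonzero multiple than to 0.\<close>
    have y: "y > 1 / 2" using TT c by (simp add: y_def field_simps)
    have c2: "c / 2 = 2 * pi / T * y" using T by (simp add: y_def)
    have dist: "\<bar>c / 2 + 2 * pi * of_int j / T\<bar> = 2 * pi / T * \<bar>y - of_int (- j)\<bar>" for j :: int
    proof -
      have "c / 2 + 2 * pi * of_int j / T = 2 * pi / T * (y - of_int (- j))"
        unfolding c2 by (simp add: algebra_simps add_divide_distrib)
      then show ?thesis using T by (simp add: abs_mult)
    qed
    have d_eq: "d = 2 * pi / T * \<bar>y - of_int m\<bar>"
      using dist[of "- m"] by (simp add: d_def \<kappa>_def)
    have d0: "d \<ge> 0" by (simp add: d_def)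
    have d_min: "d \<le> \<bar>c / 2 + 2 * pi * of_int j / T\<bar>" for j :: int
      unfolding d_eq dist using T by (intro mult_left_mono) (auto simp: m_def simp del: of_int_minus intro: round_diff_minimal)
    have "\<bar>y - of_int m\<bar> \<le> 1 / 2" using of_int_round_abs_le[of y] by (simp add: m_def abs_minus_commute)
    then have "\<bar>y - of_int m\<bar> < y" using y by linarith
    then have d_lt: "d < c / 2" unfolding d_eq c2 using T by (intro mult_strict_left_mono) auto
    have a_eq: "a = (c / 2)\<^sup>2 - d\<^sup>2" by (simp add: a_def d_def)
    have a: "a > 0" unfolding a_eq using d_lt d0 by (simp add: power_strict_mono)
    have \<rho>: "\<rho> > 0" "\<rho>\<^sup>2 = 1 + a" using a by (simp_all add: \<rho>_def)
    have \<kappa>: "\<kappa> \<noteq> 0" using d_lt c by (auto simp: d_def)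
    have per: "\<kappa> * T = 2 * pi * of_int m" using T by (simp add: \<kappa>_def)
    let ?\<psi> = "plane_wave k\<^sub>1 \<rho> \<kappa>"
    have grad: "gradient T ?\<psi> (plane_wave_grad k\<^sub>1 \<rho> \<kappa>)" by (rule plane_wave_gradient[OF per])
    have val: "action k\<^sub>1 c T ?\<psi> = T ^ CARD('n) * (- (a\<^sup>2 / 4) - a / 2)"
      using plane_wave_action[OF assms T per, of \<rho> c k\<^sub>1] \<rho> by (simp add: a_def)
    have min: "global_minimizer T (action k\<^sub>1 c T) ?\<psi>"
      unfolding global_minimizer_def val a_eq
      using action_lower_bound[OF assms T _ d0 d_min] gradient_imp_H1_per[OF grad] by blast
    have crit: "critical_point T (action k\<^sub>1 c T) ?\<psi>"
      by (rule critical_point_of_constant_modulus[OF assms T grad _ min, of "1 + a"])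
         (use \<rho> plane_wave_norm[of \<rho> k\<^sub>1 \<kappa>] in simp)
    have neg: "action k\<^sub>1 c T ?\<psi> < 0"
      unfolding val using T a zero_le_power2[of a] by (intro mult_pos_neg) (simp, linarith)
    show ?thesis
      using crit min neg plane_wave_nonconstant[OF \<rho>(1) \<kappa>, of k\<^sub>1] unfolding periodic_solution_def by blast
  qed
  then show "\<exists>Tbar>0. \<forall>T>Tbar. \<exists>\<psi> :: real ^ 'n \<Rightarrow> complex.
           periodic_solution k\<^sub>1 c T \<psi> \<and> nonconstant \<psi> \<and>
           global_minimizer T (action k\<^sub>1 c T) \<psi> \<and> action k\<^sub>1 c T \<psi> < 0"
    using c by (intro exI[of _ "2 * pi / c"]) auto
qed

end
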